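(* Let $(A,H,\blacktriangleright,\rho,\chi,\psi)$ be a cocycle Singer pair, where $A$ and $H$ are $*$-Hopf algebras, and let $\gamma:H\to A$ be defined by $\gamma(x)=\sum\chi^{-1}\big(x_2,\mathcal S^{-1}(x_1)\big)$. Then the following two sets of conditions are equivalent. (I) For all $a\in A$, $x,y\in H$: (a) $(x\blacktriangleright a)^*=\mathcal S^{-1}(x^* )\blacktriangleright a^*$; (b) $\chi(x,y)^*=\chi^{-1}\big(\mathcal S^{-1}(x^* ),\mathcal S^{-1}(y^* )\big)$; (c) $\sum(x^* )_H\otimes(x^* )_A=\sum\Big(\mathcal S\big(\mathcal S^{-1}(x)_H\big)\Big)^*\otimes\big(\mathcal S^{-1}(x)_A\big)^*$; (d) $\sum(x^* )_I\otimes(x^* )_{II}=\sum\big(\mathcal S^{-1}(x)_{\widehat I}\big)^*\otimes\big(\mathcal S^{-1}(x)_{\widehat{II}}\big)^*$. (II) For all $a\in A$, $x,y\in H$: (i) $\sum\gamma(x_2^* )\big(x_3^*\blacktriangleright\gamma(x_1)^*\big)=\varepsilon(x^* )1$; (ii) $\sum\gamma(x_2^* )\big(x_3^*\blacktriangleright(x_1\blacktriangleright a)^*\big)=a^*\gamma(x^* )$; (iii) $\sum\gamma(y_1^* )\big(y_2^*\blacktriangleright\gamma(x_1^* )\big)\chi(y_3^*,x_2^* )=\sum\gamma(y_2^*x_2^* )\big((y_3^*x_3^* )\blacktriangleright\chi(x_1,y_1)^*\big)$; (iv) $\sum(x_2^* )_H\otimes\gamma(x_1^* )(x_2^* )_A=\sum\big((x_1)_H\big)^*\otimes\gamma(x_2^*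 )\big(x_3^*\blacktriangleright((x_1)_A)^*\big)$; (v) $\sum\big(\gamma(x_1^* )\big)_1(x_2^* )_I\otimes\big(\gamma(x_1^* )\big)_2(x_2^* )_{II}=\sum\gamma\big(((x_2)_H)^*\big)\Big(((x_3)_H)^*\blacktriangleright((x_1)_I)^*\Big)\otimes\gamma(x_4^* )\Big(x_5^*\blacktriangleright\big((x_1)_{II}(x_2)_A(x_3)_A\big)^*\Big)$.
   Context: All vector spaces are over $\mathbb C$; Sweedler notation is used; $\mathcal S$ denotes antipodes. A $*$-Hopf algebra is a Hopf algebra with a conjugate linear involution $*$ that is antimultiplicative and comultiplicative ($\Delta(x^* )=\sum x_1^*\otimes x_2^*$). A cocycle Singer pair is a sextuple $(A,H,\blacktriangleright,\rho,\chi,\psi)$ where $A$ is a commutative Hopf algebra, $H$ is a cocommutative Hopf algebra (so antipodes are involutive), and $\blacktriangleright:H\otimes A\to A$; $\rho:H\to H\otimes A$, $\rho(x)=\sum x_H\otimes x_A$; $\chi:H\otimes H\to A$; $\psi:H\to A\otimes A$, $\psi(x)=\sum x_I\otimes x_{II}$ are linear maps, $\chi$ and $\psi$ being convolution invertible (in $\operatorname{Hom}(H\otimes H,A)$ and $\operatorname{Hom}(H,A\otimes A)$) with inverses $\chi^{-1}$ and $\psi^{-1}(x)=\sum x_{\widehat I}\otimes x_{\widehat{II}}$, such that for all $x,y,z\in H$, $a,b\in A$ (notation: $x_{1H}=(x_1)_H$, $x_{H1}=(x_H)_1$, $x_{HA}=(x_H)_A$, etc.; $\mathcal S^{-1}(x)_H$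 means $(\mathcal S^{-1}(x))_H$, and similarly for the other subscripts): (1) $x\blacktriangleright1=\varepsilon(x)1$; $x\blacktriangleright ab=\sum(x_1\blacktriangleright a)(x_2\blacktriangleright b)$; $1\blacktriangleright a=a$; $x\blacktriangleright(y\blacktriangleright a)=(xy)\blacktriangleright a$; $\sum\big(x_1\blacktriangleright\chi(y_1,z_1)\big)\chi(x_2,y_2z_2)=\sum\chi(x_1,y_1)\chi(x_2y_2,z)$; $\chi(x,1)=\chi(1,x)=\varepsilon(x)1$. (2) $\sum\varepsilon(x_H)x_A=\varepsilon(x)1$; $\sum x_{H1}\otimes x_{H2}\otimes x_A=\sum x_{1H}\otimes x_{2H}\otimes x_{1A}x_{2A}$; $\sum x_H\varepsilon(x_A)=x$; $\sum x_{HH}\otimes x_{HA}\otimes x_A=\sum x_H\otimes x_{A1}\otimes x_{A2}$; $\sum x_{1I1}x_{2HI}\otimes x_{1I2}x_{2HII}\otimes x_{1II}x_{2A}=\sum x_{1I}\otimes x_{1II1}x_{2I}\otimes x_{1II2}x_{2II}$; $\sum\varepsilon(x_I)x_{II}=\sum x_I\varepsilon(x_{II})=\varepsilon(x)1$. (3) $\varepsilon(x\blacktriangleright a)=\varepsilon(x)\varepsilon(a)$; $\rho(1)=1\otimes1$; $\varepsilon(\chi(x,y))=\varepsilon(x)\varepsilon(y)$; $\psi(1)=1\otimes1$; $\sum(x\blacktriangleright a)_1\otimes(x\blacktriangleright a)_2=\sum(x_{1H}\blacktriangleright a_1)\otimes x_{1A}(x_2\blacktriangleright a_2)$; $\sum(xy)_H\otimes(xy)_A=\sum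 x_{1H}y_H\otimes x_{1A}(x_2\blacktriangleright y_A)$; $\sum\chi(x_1,y_1)_1(x_2y_2)_I\otimes\chi(x_1,y_1)_2(x_2y_2)_{II}=\sum x_{1I}(x_{2H}\blacktriangleright y_{1I})\chi(x_{4H},y_{2H})\otimes x_{1II}x_{2A}(x_3\blacktriangleright y_{1II})x_{4A}(x_5\blacktriangleright y_{2A})\chi(x_6,y_3)$. *)

theory Defs
  imports Complex_Main "HOL-Library.Poly_Mapping"
begin

section \<open>Complex vector spaces and algebras\<close>

class complex_vector = ab_group_add +
  fixes scaleC :: "complex \<Rightarrow> 'a \<Rightarrow> 'a" (infixr "*\<^sub>C" 75)
  assumes scaleC_add_right: "c *\<^sub>C (x + y) = c *\<^sub>C x + c *\<^sub>C y"
    and scaleC_add_left: "(c + d) *\<^sub>C x = c *\<^sub>C x + d *\<^sub>C x"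
    and scaleC_scaleC: "c *\<^sub>C d *\<^sub>C x = (c * d) *\<^sub>C x"
    and scaleC_one: "1 *\<^sub>C x = x"

global_interpretation cvs: vector_space "scaleC :: complex \<Rightarrow> 'a \<Rightarrow> 'a::complex_vector"
  by unfold_locales (simp_all add: scaleC_add_right scaleC_add_left scaleC_scaleC scaleC_one)

abbreviation clinear :: "('a::complex_vector \<Rightarrow> 'b::complex_vector) \<Rightarrow> bool"
  where "clinear \<equiv> Vector_Spaces.linear scaleC scaleC"

definition cbilinear ::
    "('a::complex_vector \<Rightarrow> 'b::complex_vector \<Rightarrow> 'c::complex_vector) \<Rightarrow> bool"
  where "cbilinear f \<longleftrightarrow> (\<forall>x. clinear (f x)) \<and> (\<forall>y. clinear (\<lambda>x. f x y))"

instantiation complex :: complex_vector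
begin

definition scaleC_complex :: "complex \<Rightarrow> complex \<Rightarrow> complex"
  where "scaleC_complex c x = c * x"

instance
  by standard (simp_all add: scaleC_complex_def algebra_simps)

end

(* Unital associative algebras; the zero algebra is not excluded here, so that the tensor
   product of two algebras is an algebra. A bialgebra is nonzero, its counit mapping 1 to 1. *)
class complex_algebra_1 = complex_vector + ring + monoid_mult +
  assumes mult_scaleC_left: "(c *\<^sub>C x) * y = c *\<^sub>C (x * y)"
    and mult_scaleC_right: "x * (c *\<^sub>C y) = c *\<^sub>C (x * y)"

instance complex :: complex_algebra_1
  by standard (simp_all add: scaleC_complex_def)


section \<open>Tensor products\<close>

instantiation poly_mapping :: (type, complex_vector) complex_vector
begin

lift_definition scaleC_poly_mapping :: "complex \<Rightarrow> ('a \<Rightarrow>\<^sub>0 'b) \<Rightarrow> 'a \<Rightarrow>\<^sub>0 'b"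
  is "\<lambda>c f k. c *\<^sub>C f k"
  by (erule finite_subset[rotated]) auto

instance
  by standard (transfer; simp add: scaleC_add_right scaleC_add_left scaleC_scaleC scaleC_one)+

end

(* The free vector space on the set of pairs is realised as the finitely supported functions. *)
inductive_set bilinearity_relators ::
    "('a::complex_vector \<times> 'b::complex_vector \<Rightarrow>\<^sub>0 complex) set" where
  add_left: "Poly_Mapping.single (a + a', b) 1 - Poly_Mapping.single (a, b) 1
               - Poly_Mapping.single (a', b) 1 \<in> bilinearity_relators"
| add_right: "Poly_Mapping.single (a, b + b') 1 - Poly_Mapping.single (a, b) 1
               - Poly_Mapping.single (a, b') 1 \<in> bilinearity_relators"
| scale_left: "Poly_Mapping.single (c *\<^sub>C a, b) 1 - c *\<^sub>C Poly_Mapping.single (a, b) 1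
               \<in> bilinearity_relators"
| scale_right: "Poly_Mapping.single (a, c *\<^sub>C b) 1 - c *\<^sub>C Poly_Mapping.single (a, b) 1
               \<in> bilinearity_relators"

definition tensor_eq ::
    "('a::complex_vector \<times> 'b::complex_vector \<Rightarrow>\<^sub>0 complex) \<Rightarrow> ('a \<times> 'b \<Rightarrow>\<^sub>0 complex) \<Rightarrow> bool"
  where "tensor_eq p q \<longleftrightarrow> p - q \<in> cvs.span bilinearity_relators"

lemma equivp_tensor_eq:
  "equivp (tensor_eq :: ('a::complex_vector \<times> 'b::complex_vector \<Rightarrow>\<^sub>0 complex) \<Rightarrow> _)"
    (is "equivp ?R")
proof (rule equivpI)
  show "reflp ?R"
    by (rule reflpI) (simp add: tensor_eq_def cvs.span_zero)
  show "symp ?R"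
    by (rule sympI) (metis tensor_eq_def cvs.span_neg minus_diff_eq)
  show "transp ?R"
  proof (rule transpI)
    fix p q r :: "'a \<times> 'b \<Rightarrow>\<^sub>0 complex"
    assume "tensor_eq p q" "tensor_eq q r"
    then have "(p - q) + (q - r) \<in> cvs.span bilinearity_relators"
      unfolding tensor_eq_def by (rule cvs.span_add)
    then show "tensor_eq p r" by (simp add: tensor_eq_def)
  qed
qed

quotient_type (overloaded) ('a, 'b) tensor (infixr "\<otimes>" 68) =
    "'a::complex_vector \<times> 'b::complex_vector \<Rightarrow>\<^sub>0 complex" / tensor_eq
  by (rule equivp_tensor_eq)

instantiation tensor :: (complex_vector, complex_vector) complex_vector
begin

lift_definition zero_tensor :: "'a \<otimes> 'b" is 0 .

lift_definition plus_tensor :: "'a \<otimes> 'b \<Rightarrow> 'a \<otimes> 'b \<Rightarrow> 'a \<otimes> 'b" is "(+)"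
  unfolding tensor_eq_def by (metis add_diff_add cvs.span_add)

lift_definition uminus_tensor :: "'a \<otimes> 'b \<Rightarrow> 'a \<otimes> 'b" is uminus
  unfolding tensor_eq_def by (metis cvs.span_neg minus_diff_minus)

lift_definition minus_tensor :: "'a \<otimes> 'b \<Rightarrow> 'a \<otimes> 'b \<Rightarrow> 'a \<otimes> 'b" is "(-)"
proof -
  fix p q r s :: "'a \<times> 'b \<Rightarrow>\<^sub>0 complex"
  assume "tensor_eq p q" "tensor_eq r s"
  then have "(p - q) - (r - s) \<in> cvs.span bilinearity_relators"
    unfolding tensor_eq_def by (rule cvs.span_diff)
  then show "tensor_eq (p - r) (q - s)" by (simp add: tensor_eq_def algebra_simps)
qed

lift_definition scaleC_tensor :: "complex \<Rightarrow> 'a \<otimes> 'b \<Rightarrow> 'a \<otimes> 'b" is scaleC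
  unfolding tensor_eq_def by (metis cvs.scale_right_diff_distrib cvs.span_scale)

instance
proof
  fix x y z :: "'a \<otimes> 'b" and c d :: complex
  note refl = equivp_reflp[OF equivp_tensor_eq]
  show "x + y + z = x + (y + z)" by transfer (simp add: add.assoc refl)
  show "x + y = y + x" by transfer (simp add: add.commute refl)
  show "0 + x = x" by transfer (simp add: refl)
  show "- x + x = 0" by transfer (simp add: refl)
  show "x - y = x + - y" by transfer (simp add: refl)
  show "c *\<^sub>C (x + y) = c *\<^sub>C x + c *\<^sub>C y" by transfer (simp add: scaleC_add_right refl)
  show "(c + d) *\<^sub>C x = c *\<^sub>C x + d *\<^sub>C x" by transfer (simp add: scaleC_add_left refl)
  show "c *\<^sub>C d *\<^sub>C x = (c * d) *\<^sub>C x" by transfer (simp add: scaleC_scaleC refl)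
  show "1 *\<^sub>C x = x" by transfer (simp add: scaleC_one refl)
qed

end

lift_definition pure_tensor :: "'a::complex_vector \<Rightarrow> 'b::complex_vector \<Rightarrow> 'a \<otimes> 'b" (infixr "\<otimes>" 68)
  is "\<lambda>a b. Poly_Mapping.single (a, b) 1" .

lemma tensor_add_left: "(a + a') \<otimes> b = a \<otimes> b + a' \<otimes> b"
  by transfer (simp add: tensor_eq_def diff_diff_eq[symmetric] cvs.span_base add_left)

lemma tensor_add_right: "a \<otimes> (b + b') = a \<otimes> b + a \<otimes> b'"
  by transfer (simp add: tensor_eq_def diff_diff_eq[symmetric] cvs.span_base add_right)

lemma tensor_scaleC_left: "(c *\<^sub>C a) \<otimes> b = c *\<^sub>C (a \<otimes> b)"
  by transfer (simp add: tensor_eq_def cvs.span_base scale_left)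

lemma tensor_scaleC_right: "a \<otimes> (c *\<^sub>C b) = c *\<^sub>C (a \<otimes> b)"
  by transfer (simp add: tensor_eq_def cvs.span_base scale_right)

lemma tensor_zero_left: "0 \<otimes> b = 0"
  using tensor_scaleC_left[of 0 0 b] by simp

lemma tensor_zero_right: "a \<otimes> 0 = 0"
  using tensor_scaleC_right[of a 0 0] by simp

lemma scaleC_single: "c *\<^sub>C Poly_Mapping.single k d = Poly_Mapping.single k (c * d)"
  by transfer (auto simp: scaleC_complex_def when_def fun_eq_iff)

lemma tensor_induct [case_names pure add]:
  assumes pure: "\<And>a b. P (a \<otimes> b)" and add: "\<And>t u. P t \<Longrightarrow> P u \<Longrightarrow> P (t + u)"
  shows "P t"
proof -
  have zero: "P 0" using pure[of 0 0] by (simp add: tensor_zero_left)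
  have "P (abs_tensor p)" for p
  proof (induction p rule: Poly_Mapping.update_induct)
    case const
    show ?case using zero by (simp add: zero_tensor_def)
  next
    case (update p k c)
    have "Poly_Mapping.update k c p = p + Poly_Mapping.single k c"
      using update by (intro poly_mapping_eqI)
        (auto simp: lookup_add lookup_update lookup_single when_def in_keys_iff)
    moreover have "abs_tensor (Poly_Mapping.single k c) = (c *\<^sub>C fst k) \<otimes> snd k"
      unfolding tensor_scaleC_left
      by (simp add: pure_tensor.abs_eq scaleC_tensor.abs_eq scaleC_single scaleC_complex_def)
    ultimately show ?case
      using add[OF update.IH pure] by (simp flip: plus_tensor.abs_eq)
  qed
  then show ?thesis by (metis Quotient_abs_rep Quotient_tensor)
qed

lemma tensor_representation: "\<exists>ps. t = (\<Sum>(a, b)\<leftarrow>ps. a \<otimes> b)"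
proof (induction t rule: tensor_induct)
  case (pure a b)
  have "a \<otimes> b = (\<Sum>(a, b)\<leftarrow>[(a, b)]. a \<otimes> b)" by simp
  then show ?case ..
next
  case (add t u)
  then obtain ps qs where "t = (\<Sum>(a, b)\<leftarrow>ps. a \<otimes> b)" "u = (\<Sum>(a, b)\<leftarrow>qs. a \<otimes> b)" by blast
  then have "t + u = (\<Sum>(a, b)\<leftarrow>ps @ qs. a \<otimes> b)" by simp
  then show ?case ..
qed


section \<open>Sweedler notation\<close>

(* If t is the sum of the a_i \<otimes> b_i, then sweedler t f is the sum of the f a_i b_i. The
   representation of t is arbitrary. By lemma sweedler_eq the value does not depend on it
   whenever f is balanced, which covers bilinear and conjugate bilinear maps. *)
definition sweedler ::
    "'a \<otimes> 'b \<Rightarrow> ('a::complex_vector \<Rightarrow> 'b::complex_vector \<Rightarrow> 'c) \<Rightarrow> 'c::comm_monoid_add"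
  where "sweedler t f = (\<Sum>(a, b)\<leftarrow>(SOME ps. t = (\<Sum>(a, b)\<leftarrow>ps. a \<otimes> b)). f a b)"

definition balanced :: "('a::complex_vector \<Rightarrow> 'b::complex_vector \<Rightarrow> 'c::ab_group_add) \<Rightarrow> bool"
  where "balanced f \<longleftrightarrow> (\<forall>a a' b. f (a + a') b = f a b + f a' b) \<and>
    (\<forall>a b b'. f a (b + b') = f a b + f a b') \<and> (\<forall>c a b. f (c *\<^sub>C a) b = f a (c *\<^sub>C b))"

lemma balancedI:
  assumes "\<And>a a' b. f (a + a') b = f a b + f a' b" "\<And>a b b'. f a (b + b') = f a b + f a b'"
    "\<And>c a b. f (c *\<^sub>C a) b = f a (c *\<^sub>C b)"
  shows "balanced f"
  using assms by (simp add: balanced_def)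

lemma balanced_descends:
  fixes f :: "'a::complex_vector \<Rightarrow> 'b::complex_vector \<Rightarrow> 'c::ab_group_add"
  assumes f: "balanced f"
  shows "\<exists>F. (\<forall>t u. F (t + u) = F t + F u) \<and> (\<forall>a b. F (a \<otimes> b) = f a b)"
proof -
  have fadd: "f (a + a') b = f a b + f a' b" "f a (b + b') = f a b + f a b'"
    and fbal: "f (c *\<^sub>C a) b = f a (c *\<^sub>C b)" for a a' b b' c
    using f by (auto simp: balanced_def)
  have f0: "f 0 b = 0" for b using fadd(1)[of 0 0 b] by simp
  define g where "g p k = f (Poly_Mapping.lookup p k *\<^sub>C fst k) (snd k)" for p k
  define G where "G p = (\<Sum>k\<in>Poly_Mapping.keys p. g p k)" for p
  have G_eq: "G p = (\<Sum>k\<in>S. g p k)" if "finite S" "Poly_Mapping.keys p \<subseteq> S" for p S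
    unfolding G_def using that
    by (intro sum.mono_neutral_left) (auto simp: g_def f0 in_keys_iff)
  have G_add: "G (p + q) = G p + G q" for p q
  proof -
    let ?S = "Poly_Mapping.keys p \<union> Poly_Mapping.keys q"
    have "G (p + q) = (\<Sum>k\<in>?S. g (p + q) k)"
      by (rule G_eq) (simp_all add: keys_add)
    also have "\<dots> = (\<Sum>k\<in>?S. g p k + g q k)"
      by (simp add: g_def lookup_add cvs.scale_left_distrib fadd)
    also have "\<dots> = G p + G q"
      by (simp add: sum.distrib G_eq[of ?S])
    finally show ?thesis .
  qed
  have G0: "G 0 = 0" using G_add[of 0 0] by simp
  have G_diff: "G (p - q) = G p - G q" for p q using G_add[of "p - q" q] by simp
  have G_single: "G (Poly_Mapping.single (a, b) c) = f (c *\<^sub>C a) b" for a b c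
    by (subst G_eq[of "{(a, b)}"]) (auto simp: g_def)
  let ?K = "{p. \<forall>c. G (c *\<^sub>C p) = 0}"
  have "cvs.subspace ?K"
    by (auto simp: cvs.subspace_def G0 cvs.scale_right_distrib G_add)
  moreover have "bilinearity_relators \<subseteq> ?K"
  proof
    fix p :: "'a \<times> 'b \<Rightarrow>\<^sub>0 complex" assume "p \<in> bilinearity_relators"
    then show "p \<in> ?K"
      by cases (simp_all add: cvs.scale_right_diff_distrib cvs.scale_right_distrib
          scaleC_single G_diff G_single fadd fbal mult.commute)
  qed
  ultimately have span: "cvs.span bilinearity_relators \<subseteq> ?K" by (rule cvs.span_minimal[rotated])
  have resp: "G p = G q" if "tensor_eq p q" for p q
  proof -
    have "G (1 *\<^sub>C (p - q)) = 0" using that span unfolding tensor_eq_def by blast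
    then show ?thesis by (simp add: G_diff)
  qed
  have G_rep: "G (rep_tensor (abs_tensor p)) = G p" for p
    by (rule resp) (metis Quotient_rep_abs Quotient_tensor equivp_reflp equivp_tensor_eq)
  let ?F = "\<lambda>t. G (rep_tensor t)"
  have "?F (t + u) = ?F t + ?F u" for t u
  proof -
    have "t + u = abs_tensor (rep_tensor t + rep_tensor u)"
      by (metis Quotient_abs_rep Quotient_tensor plus_tensor.abs_eq)
    then show ?thesis by (simp add: G_rep G_add)
  qed
  moreover have "?F (a \<otimes> b) = f a b" for a b
    by (simp add: pure_tensor.abs_eq G_rep G_single)
  ultimately show ?thesis by (intro exI[of _ ?F]) blast
qed

lemma sweedler_eq:
  fixes f :: "'a::complex_vector \<Rightarrow> 'b::complex_vector \<Rightarrow> 'c::ab_group_add"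
  assumes f: "balanced f" and t: "t = (\<Sum>(a, b)\<leftarrow>ps. a \<otimes> b)"
  shows "sweedler t f = (\<Sum>(a, b)\<leftarrow>ps. f a b)"
proof -
  obtain F where F: "\<And>t u. F (t + u) = F t + F u" "\<And>a b. F (a \<otimes> b) = f a b"
    using balanced_descends[OF f] by blast
  have F0: "F 0 = 0" using F(1)[of 0 0] by simp
  have *: "F (\<Sum>(a, b)\<leftarrow>qs. a \<otimes> b) = (\<Sum>(a, b)\<leftarrow>qs. f a b)" for qs
    by (induction qs) (auto simp: F0 F)
  have "t = (\<Sum>(a, b)\<leftarrow>(SOME ps. t = (\<Sum>(a, b)\<leftarrow>ps. a \<otimes> b)). a \<otimes> b)"
    by (rule someI_ex) (rule tensor_representation)
  then have "sweedler t f = F t" unfolding sweedler_def by (metis *)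
  then show ?thesis using * t by simp
qed

lemma sweedler_pure: "balanced f \<Longrightarrow> sweedler (a \<otimes> b) f = f a b"
  using sweedler_eq[of f "a \<otimes> b" "[(a, b)]"] by simp

lemma sweedler_add: "balanced f \<Longrightarrow> sweedler (t + u) f = sweedler t f + sweedler u f"
proof -
  assume f: "balanced f"
  obtain ps qs where tu: "t = (\<Sum>(a, b)\<leftarrow>ps. a \<otimes> b)" "u = (\<Sum>(a, b)\<leftarrow>qs. a \<otimes> b)"
    using tensor_representation by metis
  then have "t + u = (\<Sum>(a, b)\<leftarrow>ps @ qs. a \<otimes> b)" by simp
  from sweedler_eq[OF f this] sweedler_eq[OF f tu(1)] sweedler_eq[OF f tu(2)]
  show ?thesis by simp
qed

lemma sweedler_zero: "balanced f \<Longrightarrow> sweedler 0 f = 0"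
  using sweedler_eq[of f 0 "[]"] by simp

lemma sweedler_additive:
  assumes "\<And>x y. h (x + y) = h x + h y" "h 0 = 0"
  shows "h (sweedler t f) = sweedler t (\<lambda>a b. h (f a b))"
proof -
  have "h (\<Sum>(a, b)\<leftarrow>ps. f a b) = (\<Sum>(a, b)\<leftarrow>ps. h (f a b))" for ps
    by (induction ps) (auto simp: assms)
  then show ?thesis by (simp add: sweedler_def)
qed

lemma sweedler_add_fun: "sweedler t (\<lambda>a b. f a b + g a b) = sweedler t f + sweedler t g"
proof -
  have "(\<Sum>(a, b)\<leftarrow>ps. f a b + g a b) = (\<Sum>(a, b)\<leftarrow>ps. f a b) + (\<Sum>(a, b)\<leftarrow>ps. g a b)" for ps
    by (induction ps) (auto simp: algebra_simps)
  then show ?thesis by (simp add: sweedler_def)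
qed

lemma sweedler_zero_fun: "sweedler t (\<lambda>a b. 0) = 0"
proof -
  have "(\<Sum>(a, b)\<leftarrow>ps. 0) = 0" for ps :: "('x \<times> 'y) list"
    by (induction ps) auto
  then show ?thesis by (simp add: sweedler_def)
qed

lemma sweedler_scaleC: "c *\<^sub>C sweedler t f = sweedler t (\<lambda>a b. c *\<^sub>C f a b)"
  by (rule sweedler_additive) (simp_all add: cvs.scale_right_distrib)

lemma sweedler_swap:
  "sweedler t (\<lambda>a b. sweedler u (\<lambda>c d. f a b c d)) =
   sweedler u (\<lambda>c d. sweedler t (\<lambda>a b. f a b c d))"
proof -
  have "(\<Sum>(a, b)\<leftarrow>ps. sweedler u (\<lambda>c d. f a b c d)) =
      sweedler u (\<lambda>c d. \<Sum>(a, b)\<leftarrow>ps. f a b c d)" for ps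
    by (induction ps) (auto simp: sweedler_zero_fun sweedler_add_fun)
  then show ?thesis by (simp only: sweedler_def[of t])
qed

lemma balanced_tensor:
  assumes "\<And>x y. f (x + y) = f x + f y" "\<And>x y. g (x + y) = g x + g y"
    "\<And>c x. f (c *\<^sub>C x) = c *\<^sub>C f x" "\<And>c x. g (c *\<^sub>C x) = c *\<^sub>C g x"
  shows "balanced (\<lambda>a b. f a \<otimes> g b)"
  by (rule balancedI)
    (simp_all add: assms tensor_add_left tensor_add_right tensor_scaleC_left tensor_scaleC_right)

lemma sweedler_scaleC_left:
  assumes f: "balanced f" and hom: "\<And>a b. f (c *\<^sub>C a) b = c *\<^sub>C f a b"
  shows "sweedler (c *\<^sub>C t) f = c *\<^sub>C sweedler t f"
proof (induction t rule: tensor_induct)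
  case (pure a b)
  show ?case
    using f hom by (simp add: sweedler_pure flip: tensor_scaleC_left)
next
  case (add t u)
  then show ?case by (simp add: sweedler_add f cvs.scale_right_distrib)
qed


section \<open>Tensor products of algebras\<close>

instantiation tensor :: (complex_algebra_1, complex_algebra_1) complex_algebra_1
begin

definition one_tensor :: "'a \<otimes> 'b"
  where "one_tensor = 1 \<otimes> 1"

definition times_tensor :: "'a \<otimes> 'b \<Rightarrow> 'a \<otimes> 'b \<Rightarrow> 'a \<otimes> 'b"
  where "times_tensor t u = sweedler t (\<lambda>a b. sweedler u (\<lambda>c d. (a * c) \<otimes> (b * d)))"

lemma balanced_times_inner: "balanced (\<lambda>c d. ((a::'a) * c) \<otimes> ((b::'b) * d))"
  by (rule balanced_tensor) (simp_all add: algebra_simps mult_scaleC_right)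

lemma balanced_times_outer:
  "balanced (\<lambda>a b. sweedler u (\<lambda>c d. ((a::'a) * c) \<otimes> ((b::'b) * d)))"
  by (rule balancedI)
    (simp_all add: distrib_right tensor_add_left tensor_add_right sweedler_add_fun
      mult_scaleC_left tensor_scaleC_left tensor_scaleC_right)

lemma times_tensor_pure: "(a \<otimes> b) * (c \<otimes> d) = ((a::'a) * c) \<otimes> ((b::'b) * d)"
  unfolding times_tensor_def sweedler_pure[OF balanced_times_outer]
  by (rule sweedler_pure[OF balanced_times_inner])

lemma times_tensor_add_left: "(t + u) * v = t * v + u * (v :: 'a \<otimes> 'b)"
  by (simp add: times_tensor_def sweedler_add balanced_times_outer)

lemma times_tensor_add_right: "v * (t + u) = v * t + v * (u :: 'a \<otimes> 'b)"
  by (simp add: times_tensor_def sweedler_add balanced_times_inner sweedler_add_fun)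

instance
proof
  fix t u v :: "'a \<otimes> 'b" and c :: complex
  show "(t + u) * v = t * v + u * v" by (rule times_tensor_add_left)
  show "t * (u + v) = t * u + t * v" by (rule times_tensor_add_right)
  show "t * u * v = t * (u * v)"
  proof (induction t rule: tensor_induct)
    case (pure a b)
    show ?case
    proof (induction u rule: tensor_induct)
      case (pure a' b')
      show ?case
        by (induction v rule: tensor_induct)
          (simp_all add: times_tensor_pure times_tensor_add_right mult.assoc)
    qed (simp add: times_tensor_add_left times_tensor_add_right)
  qed (simp add: times_tensor_add_left)
  show "1 * t = t"
    by (induction t rule: tensor_induct)
      (simp_all add: one_tensor_def times_tensor_pure times_tensor_add_right)
  show "t * 1 = t"
    by (induction t rule: tensor_induct)
      (simp_all add: one_tensor_def times_tensor_pure times_tensor_add_left)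
  show "(c *\<^sub>C t) * u = c *\<^sub>C (t * u)"
    unfolding times_tensor_def
    by (rule sweedler_scaleC_left[OF balanced_times_outer])
      (simp add: mult_scaleC_left tensor_scaleC_left sweedler_scaleC)
  show "t * (c *\<^sub>C u) = c *\<^sub>C (t * u)"
    unfolding times_tensor_def sweedler_scaleC
    by (simp add: sweedler_scaleC_left[OF balanced_times_inner]
        mult_scaleC_right tensor_scaleC_left flip: sweedler_scaleC)
qed

end


section \<open>Coalgebras and Hopf algebras\<close>

(* In the following classes the sort constraint on the type variable of the fixed operation, or of
   the first axiom, plays the role of the superclass. The usual form, as in complex_vector + fixes,
   does not admit the tensor product, which is an instance of that class, in the axioms. *)
class coalgebra =
  fixes comult :: "'a::complex_vector \<Rightarrow> 'a \<otimes> 'a" ("\<Delta>") and counit :: "'a \<Rightarrow> complex" ("\<epsilon>")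
  assumes clinear_comult: "clinear \<Delta>"
    and clinear_counit: "clinear \<epsilon>"
    and coassoc: "sweedler (\<Delta> x) (\<lambda>x1 x2. sweedler (\<Delta> x1) (\<lambda>x11 x12. x11 \<otimes> x12 \<otimes> x2)) =
      sweedler (\<Delta> x) (\<lambda>x1 x2. sweedler (\<Delta> x2) (\<lambda>x21 x22. x1 \<otimes> x21 \<otimes> x22))"
    and counit_left: "sweedler (\<Delta> x) (\<lambda>x1 x2. \<epsilon> x1 *\<^sub>C x2) = x"
    and counit_right: "sweedler (\<Delta> x) (\<lambda>x1 x2. \<epsilon> x2 *\<^sub>C x1) = x"

class cocommutative_coalgebra =
  assumes cocommutative: "sweedler (\<Delta> (x::'a::coalgebra)) (\<lambda>x1 x2. x2 \<otimes> x1) = \<Delta> x"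

class bialgebra =
  assumes comult_mult: "\<Delta> ((x::'a::{coalgebra, complex_algebra_1}) * y) = \<Delta> x * \<Delta> y"
    and comult_one: "\<Delta> (1::'a) = 1"
    and counit_mult: "\<epsilon> ((x::'a) * y) = \<epsilon> x * \<epsilon> y"
    and counit_one: "\<epsilon> (1::'a) = 1"

instance bialgebra \<subseteq> ring_1
proof
  interpret Vector_Spaces.linear scaleC scaleC "\<epsilon> :: 'a \<Rightarrow> complex" by (rule clinear_counit)
  show "(0::'a) \<noteq> 1" using counit_one[where 'a = 'a] zero by force
qed

class hopf_algebra =
  fixes antipode :: "'a::bialgebra \<Rightarrow> 'a" ("\<S>")
  assumes clinear_antipode: "clinear \<S>"
    and antipode_left: "sweedler (\<Delta> x) (\<lambda>x1 x2. \<S> x1 * x2) = \<epsilon> x *\<^sub>C 1"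
    and antipode_right: "sweedler (\<Delta> x) (\<lambda>x1 x2. x1 * \<S> x2) = \<epsilon> x *\<^sub>C 1"

class star_hopf_algebra =
  fixes star :: "'a::hopf_algebra \<Rightarrow> 'a" ("_\<^sup>\<star>" [1000] 999)
  assumes star_add: "(x + y)\<^sup>\<star> = x\<^sup>\<star> + y\<^sup>\<star>"
    and star_scaleC: "(c *\<^sub>C x)\<^sup>\<star> = cnj c *\<^sub>C x\<^sup>\<star>"
    and star_star: "(x\<^sup>\<star>)\<^sup>\<star> = x"
    and star_mult: "(x * y)\<^sup>\<star> = y\<^sup>\<star> * x\<^sup>\<star>"
    and comult_star: "\<Delta> (x\<^sup>\<star>) = sweedler (\<Delta> x) (\<lambda>x1 x2. x1\<^sup>\<star> \<otimes> x2\<^sup>\<star>)"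


section \<open>Convolution\<close>

lemma comult_add: "\<Delta> (x + y) = \<Delta> x + \<Delta> y"
  and comult_scaleC: "\<Delta> (c *\<^sub>C x) = c *\<^sub>C \<Delta> x"
  and counit_add: "\<epsilon> (x + y) = \<epsilon> x + \<epsilon> y"
  and counit_scaleC: "\<epsilon> (c *\<^sub>C x) = c * \<epsilon> x"
  using clinear_comult clinear_counit
  by (auto simp: Vector_Spaces.linear_iff scaleC_complex_def)

lemma coassoc_trilinear:
  assumes "\<And>x x' y z. G (x + x') y z = G x y z + G x' y z"
    "\<And>x y y' z. G x (y + y') z = G x y z + G x y' z"
    "\<And>x y z z'. G x y (z + z') = G x y z + G x y z'"
    "\<And>c x y z. G (c *\<^sub>C x) y z = c *\<^sub>C (G x y z :: 'c::complex_vector)"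
    "\<And>c x y z. G x (c *\<^sub>C y) z = c *\<^sub>C G x y z"
    "\<And>c x y z. G x y (c *\<^sub>C z) = c *\<^sub>C G x y z"
  shows "sweedler (\<Delta> x) (\<lambda>x1 x2. sweedler (\<Delta> x1) (\<lambda>x11 x12. G x11 x12 x2)) =
    sweedler (\<Delta> x) (\<lambda>x1 x2. sweedler (\<Delta> x2) (\<lambda>x21 x22. G x1 x21 x22))"
proof -
  have G: "balanced (G x)" for x
    by (rule balancedI) (simp_all add: assms)
  have G_fun: "G (x + x') = (\<lambda>y z. G x y z + G x' y z)" "G (c *\<^sub>C x) = (\<lambda>y z. c *\<^sub>C G x y z)"
    for c x x' by (simp_all add: assms fun_eq_iff)
  let ?G = "\<lambda>x r. sweedler r (G x)"
  have G': "balanced ?G"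
    by (rule balancedI)
      (simp_all add: assms G_fun sweedler_add_fun sweedler_add G sweedler_scaleC_left
        flip: sweedler_scaleC)
  have push: "sweedler (sweedler t f) ?G = sweedler t (\<lambda>a b. sweedler (f a b) ?G)" for t f
    by (rule sweedler_additive) (simp_all add: sweedler_add sweedler_zero G')
  from arg_cong[OF coassoc, of "\<lambda>t. sweedler t ?G" x] show ?thesis
    by (simp add: push sweedler_pure G G')
qed

instantiation tensor :: (coalgebra, coalgebra) coalgebra
begin

definition comult_tensor :: "'a \<otimes> 'b \<Rightarrow> ('a \<otimes> 'b) \<otimes> ('a \<otimes> 'b)"
  where "comult_tensor t = sweedler t (\<lambda>a b. sweedler (\<Delta> a) (\<lambda>a1 a2. sweedler (\<Delta> b) (\<lambda>b1 b2.
    (a1 \<otimes> b1) \<otimes> (a2 \<otimes> b2))))"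

definition counit_tensor :: "'a \<otimes> 'b \<Rightarrow> complex"
  where "counit_tensor t = sweedler t (\<lambda>a b. \<epsilon> a * \<epsilon> b)"

lemma comult_tensor_balanced1:
  "balanced (\<lambda>b1 b2. ((a1::'a) \<otimes> (b1::'b)) \<otimes> ((a2::'a) \<otimes> (b2::'b)))"
  by (rule balanced_tensor) (simp_all add: tensor_add_right tensor_scaleC_right)

lemma comult_tensor_balanced2:
  "balanced (\<lambda>a1 a2. sweedler (\<Delta> b) (\<lambda>b1 b2. ((a1::'a) \<otimes> (b1::'b)) \<otimes> ((a2::'a) \<otimes> (b2::'b))))"
  by (rule balancedI)
    (simp_all add: tensor_add_left tensor_add_right sweedler_add_fun tensor_scaleC_left
      tensor_scaleC_right)

lemma comult_tensor_balanced3: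
  "balanced (\<lambda>a b. sweedler (\<Delta> a) (\<lambda>a1 a2. sweedler (\<Delta> b) (\<lambda>b1 b2.
    ((a1::'a) \<otimes> (b1::'b)) \<otimes> (a2 \<otimes> b2))))"
  and comult_tensor_homogeneous:
  "sweedler (\<Delta> (c *\<^sub>C a)) (\<lambda>a1 a2. sweedler (\<Delta> b) (\<lambda>b1 b2. ((a1::'a) \<otimes> (b1::'b)) \<otimes> (a2 \<otimes> b2))) =
   c *\<^sub>C sweedler (\<Delta> a) (\<lambda>a1 a2. sweedler (\<Delta> b) (\<lambda>b1 b2. (a1 \<otimes> b1) \<otimes> (a2 \<otimes> b2)))"
proof -
  let ?f = "\<lambda>a b. sweedler (\<Delta> a) (\<lambda>a1 a2. sweedler (\<Delta> b) (\<lambda>b1 b2.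
    ((a1::'a) \<otimes> (b1::'b)) \<otimes> (a2 \<otimes> b2)))"
  have l: "?f (c *\<^sub>C a) b = c *\<^sub>C ?f a b" for c a b
    unfolding comult_scaleC
    by (rule sweedler_scaleC_left[OF comult_tensor_balanced2])
      (simp add: tensor_scaleC_left sweedler_scaleC)
  have r: "?f a (c *\<^sub>C b) = c *\<^sub>C ?f a b" for c a b
    by (simp add: comult_scaleC sweedler_scaleC_left[OF comult_tensor_balanced1]
        tensor_scaleC_left tensor_scaleC_right flip: sweedler_scaleC)
  show "balanced ?f"
    by (rule balancedI)
      (simp_all only: l r comult_add sweedler_add comult_tensor_balanced1 comult_tensor_balanced2
        sweedler_add_fun)
  show "?f (c *\<^sub>C a) b = c *\<^sub>C ?f a b" by (rule l)
qed

lemma comult_tensor_pure: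
  "\<Delta> ((a::'a) \<otimes> (b::'b)) =
    sweedler (\<Delta> a) (\<lambda>a1 a2. sweedler (\<Delta> b) (\<lambda>b1 b2. (a1 \<otimes> b1) \<otimes> (a2 \<otimes> b2)))"
  by (simp add: comult_tensor_def sweedler_pure[OF comult_tensor_balanced3])

lemma comult_tensor_add: "\<Delta> (t + u) = \<Delta> t + \<Delta> (u :: 'a \<otimes> 'b)"
  by (simp add: comult_tensor_def sweedler_add[OF comult_tensor_balanced3])

lemma comult_tensor_scaleC: "\<Delta> (c *\<^sub>C t) = c *\<^sub>C \<Delta> (t :: 'a \<otimes> 'b)"
  unfolding comult_tensor_def
  by (rule sweedler_scaleC_left[OF comult_tensor_balanced3]) (rule comult_tensor_homogeneous)

lemma sweedler_comult_tensor_pure: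
  fixes F :: "'a \<otimes> 'b \<Rightarrow> 'a \<otimes> 'b \<Rightarrow> 'c::ab_group_add"
  assumes F: "balanced F"
  shows "sweedler (\<Delta> (a \<otimes> b)) F =
    sweedler (\<Delta> a) (\<lambda>a1 a2. sweedler (\<Delta> b) (\<lambda>b1 b2. F (a1 \<otimes> b1) (a2 \<otimes> b2)))"
proof -
  have push: "sweedler (sweedler t f) F = sweedler t (\<lambda>a b. sweedler (f a b) F)"
    for t :: "'d::complex_vector \<otimes> 'e::complex_vector" and f
    by (rule sweedler_additive) (simp_all add: sweedler_add sweedler_zero F)
  show ?thesis by (simp add: comult_tensor_pure push sweedler_pure F)
qed

lemma counit_tensor_balanced: "balanced (\<lambda>a b. \<epsilon> (a::'a) * \<epsilon> (b::'b))"
  by (rule balancedI) (simp_all add: counit_add counit_scaleC algebra_simps)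

lemma counit_tensor_pure: "\<epsilon> ((a::'a) \<otimes> (b::'b)) = \<epsilon> a * \<epsilon> b"
  by (simp add: counit_tensor_def sweedler_pure counit_tensor_balanced)

lemma counit_tensor_add: "\<epsilon> (t + u) = \<epsilon> t + \<epsilon> (u :: 'a \<otimes> 'b)"
  by (simp add: counit_tensor_def sweedler_add counit_tensor_balanced)

lemma counit_tensor_scaleC: "\<epsilon> (c *\<^sub>C t) = c * \<epsilon> (t :: 'a \<otimes> 'b)"
  using sweedler_scaleC_left[OF counit_tensor_balanced, of c t]
  by (simp add: counit_tensor_def counit_scaleC scaleC_complex_def)

instance
proof
  show "clinear (\<Delta> :: 'a \<otimes> 'b \<Rightarrow> _)"
    by (simp add: Vector_Spaces.linear_iff comult_tensor_add comult_tensor_scaleC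
        cvs.vector_space_axioms)
  show "clinear (\<epsilon> :: 'a \<otimes> 'b \<Rightarrow> _)"
    by (simp add: Vector_Spaces.linear_iff counit_tensor_add counit_tensor_scaleC
        cvs.vector_space_axioms scaleC_complex_def)
  fix t :: "'a \<otimes> 'b"
  show "sweedler (\<Delta> t) (\<lambda>x1 x2. \<epsilon> x1 *\<^sub>C x2) = t"
  proof -
    have F: "balanced (\<lambda>(x1::'a \<otimes> 'b) (x2::'a \<otimes> 'b). \<epsilon> x1 *\<^sub>C x2)"
      by (rule balancedI)
        (simp_all add: counit_tensor_add counit_tensor_scaleC cvs.scale_left_distrib
          cvs.scale_right_distrib mult.commute)
    show ?thesis
    proof (induction t rule: tensor_induct)
      case (pure a b)
      have "sweedler (\<Delta> (a \<otimes> b)) (\<lambda>x1 x2. \<epsilon> x1 *\<^sub>C x2) =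
          sweedler (\<Delta> a) (\<lambda>a1 a2. sweedler (\<Delta> b) (\<lambda>b1 b2. (\<epsilon> a1 *\<^sub>C a2) \<otimes> (\<epsilon> b1 *\<^sub>C b2)))"
        by (simp add: sweedler_comult_tensor_pure F counit_tensor_pure tensor_scaleC_left
            tensor_scaleC_right mult.commute)
      also have "\<dots> = sweedler (\<Delta> a) (\<lambda>a1 a2. (\<epsilon> a1 *\<^sub>C a2) \<otimes> sweedler (\<Delta> b) (\<lambda>b1 b2. \<epsilon> b1 *\<^sub>C b2))"
        by (subst sweedler_additive[where h = "\<lambda>y. _ \<otimes> y"])
          (simp_all add: tensor_add_right tensor_zero_right)
      also have "\<dots> = sweedler (\<Delta> a) (\<lambda>a1 a2. \<epsilon> a1 *\<^sub>C a2) \<otimes> b"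
        by (subst sweedler_additive[where h = "\<lambda>y. y \<otimes> _"])
          (simp_all add: tensor_add_left tensor_zero_left counit_left)
      finally show ?case by (simp add: counit_left)
    qed (simp add: comult_tensor_add sweedler_add F)
  qed
  show "sweedler (\<Delta> t) (\<lambda>x1 x2. \<epsilon> x2 *\<^sub>C x1) = t"
  proof -
    have F: "balanced (\<lambda>(x1::'a \<otimes> 'b) (x2::'a \<otimes> 'b). \<epsilon> x2 *\<^sub>C x1)"
      by (rule balancedI)
        (simp_all add: counit_tensor_add counit_tensor_scaleC cvs.scale_left_distrib
          cvs.scale_right_distrib mult.commute)
    show ?thesis
    proof (induction t rule: tensor_induct)
      case (pure a b)
      have "sweedler (\<Delta> (a \<otimes> b)) (\<lambda>x1 x2. \<epsilon> x2 *\<^sub>C x1) =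
          sweedler (\<Delta> a) (\<lambda>a1 a2. sweedler (\<Delta> b) (\<lambda>b1 b2. (\<epsilon> a2 *\<^sub>C a1) \<otimes> (\<epsilon> b2 *\<^sub>C b1)))"
        by (simp add: sweedler_comult_tensor_pure F counit_tensor_pure tensor_scaleC_left
            tensor_scaleC_right mult.commute)
      also have "\<dots> = sweedler (\<Delta> a) (\<lambda>a1 a2. (\<epsilon> a2 *\<^sub>C a1) \<otimes> sweedler (\<Delta> b) (\<lambda>b1 b2. \<epsilon> b2 *\<^sub>C b1))"
        by (subst sweedler_additive[where h = "\<lambda>y. _ \<otimes> y"])
          (simp_all add: tensor_add_right tensor_zero_right)
      also have "\<dots> = sweedler (\<Delta> a) (\<lambda>a1 a2. \<epsilon> a2 *\<^sub>C a1) \<otimes> b"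
        by (subst sweedler_additive[where h = "\<lambda>y. y \<otimes> _"])
          (simp_all add: tensor_add_left tensor_zero_left counit_right)
      finally show ?case by (simp add: counit_right)
    qed (simp add: comult_tensor_add sweedler_add F)
  qed
  show "sweedler (\<Delta> t) (\<lambda>x1 x2. sweedler (\<Delta> x1) (\<lambda>x11 x12. x11 \<otimes> x12 \<otimes> x2)) =
      sweedler (\<Delta> t) (\<lambda>x1 x2. sweedler (\<Delta> x2) (\<lambda>x21 x22. x1 \<otimes> x21 \<otimes> x22))"
  proof -
    have B1: "balanced (\<lambda>(p::'a \<otimes> 'b) (q::'a \<otimes> 'b). p \<otimes> q \<otimes> (r::'a \<otimes> 'b))" for r
      by (rule balanced_tensor) (simp_all add: tensor_add_left tensor_scaleC_left)
    have B2: "balanced (\<lambda>(p::'a \<otimes> 'b) (q::'a \<otimes> 'b). (r::'a \<otimes> 'b) \<otimes> p \<otimes> q)" for r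
      by (rule balancedI)
        (simp_all add: tensor_add_left tensor_add_right tensor_scaleC_left tensor_scaleC_right)
    have F1: "balanced (\<lambda>x1 (x2::'a \<otimes> 'b). sweedler (\<Delta> x1) (\<lambda>x11 x12. (x11::'a \<otimes> 'b) \<otimes> x12 \<otimes> x2))"
      by (rule balancedI)
        (simp_all add: comult_tensor_add sweedler_add B1 sweedler_add_fun tensor_add_right
          comult_tensor_scaleC sweedler_scaleC_left[OF B1] tensor_scaleC_left tensor_scaleC_right
          flip: sweedler_scaleC)
    have F2: "balanced (\<lambda>(x1::'a \<otimes> 'b) x2. sweedler (\<Delta> x2) (\<lambda>x21 x22. x1 \<otimes> (x21::'a \<otimes> 'b) \<otimes> x22))"
      by (rule balancedI)
        (simp_all add: comult_tensor_add sweedler_add B2 sweedler_add_fun tensor_add_left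
          comult_tensor_scaleC sweedler_scaleC_left[OF B2] tensor_scaleC_left tensor_scaleC_right
          flip: sweedler_scaleC)
    show ?thesis
    proof (induction t rule: tensor_induct)
      case (pure a b)
      let ?T = "\<lambda>x y z x' y' z'. (((x::'a) \<otimes> (x'::'b)) \<otimes> (y \<otimes> y') \<otimes> (z \<otimes> z'))"
      let ?G = "\<lambda>x y z. sweedler (\<Delta> b) (\<lambda>b1 b2. sweedler (\<Delta> b1) (\<lambda>b11 b12. ?T x y z b11 b12 b2))"
      have "sweedler (\<Delta> (a \<otimes> b)) (\<lambda>x1 x2. sweedler (\<Delta> x1) (\<lambda>x11 x12. x11 \<otimes> x12 \<otimes> x2)) =
          sweedler (\<Delta> a) (\<lambda>a1 a2. sweedler (\<Delta> b) (\<lambda>b1 b2. sweedler (\<Delta> a1) (\<lambda>a11 a12.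
            sweedler (\<Delta> b1) (\<lambda>b11 b12. ?T a11 a12 a2 b11 b12 b2))))"
        by (simp add: sweedler_comult_tensor_pure F1 B1)
      also have "\<dots> = sweedler (\<Delta> a) (\<lambda>a1 a2. sweedler (\<Delta> a1) (\<lambda>a11 a12. ?G a11 a12 a2))"
        by (subst sweedler_swap) (rule refl)
      also have "\<dots> = sweedler (\<Delta> a) (\<lambda>a1 a2. sweedler (\<Delta> a2) (\<lambda>a21 a22. ?G a1 a21 a22))"
        by (rule coassoc_trilinear)
          (simp_all add: tensor_add_left tensor_add_right sweedler_add_fun tensor_scaleC_left
            tensor_scaleC_right sweedler_scaleC)
      also have "\<dots> = sweedler (\<Delta> a) (\<lambda>a1 a2. sweedler (\<Delta> a2) (\<lambda>a21 a22.
          sweedler (\<Delta> b) (\<lambda>b1 b2. sweedler (\<Delta> b2) (\<lambda>b21 b22. ?T a1 a21 a22 b1 b21 b22))))"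
        by (subst coassoc_trilinear)
          (simp_all add: tensor_add_left tensor_add_right sweedler_add_fun tensor_scaleC_left
            tensor_scaleC_right sweedler_scaleC)
      also have "\<dots> = sweedler (\<Delta> a) (\<lambda>a1 a2. sweedler (\<Delta> b) (\<lambda>b1 b2. sweedler (\<Delta> a2) (\<lambda>a21 a22.
          sweedler (\<Delta> b2) (\<lambda>b21 b22. ?T a1 a21 a22 b1 b21 b22))))"
        by (subst (2) sweedler_swap) (rule refl)
      also have "\<dots> = sweedler (\<Delta> (a \<otimes> b)) (\<lambda>x1 x2. sweedler (\<Delta> x2) (\<lambda>x21 x22. x1 \<otimes> x21 \<otimes> x22))"
        by (simp add: sweedler_comult_tensor_pure F2 B2)
      finally show ?case .
    next
      case (add t u)
      then show ?case by (simp add: comult_tensor_add sweedler_add[OF F1] sweedler_add[OF F2])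
    qed
  qed
qed

end

definition convolution ::
    "('c::coalgebra \<Rightarrow> 'a::complex_algebra_1) \<Rightarrow> ('c \<Rightarrow> 'a) \<Rightarrow> 'c \<Rightarrow> 'a"
  where "convolution f g x = sweedler (\<Delta> x) (\<lambda>x1 x2. f x1 * g x2)"

definition is_convolution_inverse ::
    "('c::coalgebra \<Rightarrow> 'a::complex_algebra_1) \<Rightarrow> ('c \<Rightarrow> 'a) \<Rightarrow> bool"
  where "is_convolution_inverse f g \<longleftrightarrow> clinear g \<and>
    convolution f g = (\<lambda>x. \<epsilon> x *\<^sub>C 1) \<and> convolution g f = (\<lambda>x. \<epsilon> x *\<^sub>C 1)"

definition convolution_invertible :: "('c::coalgebra \<Rightarrow> 'a::complex_algebra_1) \<Rightarrow> bool"
  where "convolution_invertible f \<longleftrightarrow> (\<exists>g. is_convolution_inverse f g)"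

definition convolution_inverse ::
    "('c::coalgebra \<Rightarrow> 'a::complex_algebra_1) \<Rightarrow> 'c \<Rightarrow> 'a"
  where "convolution_inverse f = (THE g. is_convolution_inverse f g)"

lemma convolution_inverse_eq:
  assumes f: "clinear f" and g: "is_convolution_inverse f g"
  shows "convolution_inverse f = g"
  unfolding convolution_inverse_def
proof (rule the_equality)
  fix h assume h: "is_convolution_inverse f h"
  have lin: "clinear f" "clinear g" "clinear h"
    using f g h by (auto simp: is_convolution_inverse_def)
  note lins = lin[unfolded Vector_Spaces.linear_iff, THEN conjunct2, THEN conjunct2, THEN conjunct1, rule_format]
    lin[unfolded Vector_Spaces.linear_iff, THEN conjunct2, THEN conjunct2, THEN conjunct2, rule_format]
  have inv: "sweedler (\<Delta> y) (\<lambda>y1 y2. f y1 * g y2) = \<epsilon> y *\<^sub>C 1"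
    "sweedler (\<Delta> y) (\<lambda>y1 y2. h y1 * f y2) = \<epsilon> y *\<^sub>C 1" for y
    using g h by (auto simp: is_convolution_inverse_def convolution_def fun_eq_iff)
  have mult: "a * sweedler t k = sweedler t (\<lambda>u v. a * k u v)"
    "sweedler t k * a = sweedler t (\<lambda>u v. k u v * a)"
    for a :: 'b and t :: "'a \<otimes> 'a" and k
    using sweedler_additive[of "\<lambda>b. a * b" t k] sweedler_additive[of "\<lambda>b. b * a" t k]
    by (simp_all add: algebra_simps)
  show "h = g"
  proof
    fix x
    have "h x = h (sweedler (\<Delta> x) (\<lambda>x1 x2. \<epsilon> x2 *\<^sub>C x1))" by (simp add: counit_right)
    also have "\<dots> = sweedler (\<Delta> x) (\<lambda>x1 x2. h x1 * (\<epsilon> x2 *\<^sub>C 1))"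
      using sweedler_additive[of h "\<Delta> x"] lins lins(6)[of 0 0] by (simp add: mult_scaleC_right)
    also have "\<dots> = sweedler (\<Delta> x) (\<lambda>x1 x2. sweedler (\<Delta> x2) (\<lambda>x21 x22. h x1 * f x21 * g x22))"
      by (simp add: mult mult.assoc flip: inv(1))
    also have "\<dots> = sweedler (\<Delta> x) (\<lambda>x1 x2. sweedler (\<Delta> x1) (\<lambda>x11 x12. h x11 * f x12 * g x2))"
      by (rule coassoc_trilinear[symmetric])
        (simp_all add: lins algebra_simps mult_scaleC_left mult_scaleC_right)
    also have "\<dots> = sweedler (\<Delta> x) (\<lambda>x1 x2. (\<epsilon> x1 *\<^sub>C 1) * g x2)"
      by (simp add: mult flip: inv(2))
    also have "\<dots> = g (sweedler (\<Delta> x) (\<lambda>x1 x2. \<epsilon> x1 *\<^sub>C x2))"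
      using sweedler_additive[of g "\<Delta> x"] lins lins(5)[of 0 0] by (simp add: mult_scaleC_left)
    finally show "h x = g x" by (simp add: counit_left)
  qed
qed (rule g)


section \<open>Cocycle Singer pairs\<close>

definition coprod2 :: "'a::coalgebra \<Rightarrow> ('a \<Rightarrow> 'a \<Rightarrow> 'b) \<Rightarrow> 'b::comm_monoid_add"
  where "coprod2 x f = sweedler (\<Delta> x) f"

definition coprod3 :: "'a::coalgebra \<Rightarrow> ('a \<Rightarrow> 'a \<Rightarrow> 'a \<Rightarrow> 'b) \<Rightarrow> 'b::comm_monoid_add"
  where "coprod3 x f = sweedler (\<Delta> x) (\<lambda>x1 x'. coprod2 x' (f x1))"

definition coprod4 :: "'a::coalgebra \<Rightarrow> ('a \<Rightarrow> 'a \<Rightarrow> 'a \<Rightarrow> 'a \<Rightarrow> 'b) \<Rightarrow> 'b::comm_monoid_add"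
  where "coprod4 x f = sweedler (\<Delta> x) (\<lambda>x1 x'. coprod3 x' (f x1))"

definition coprod5 ::
    "'a::coalgebra \<Rightarrow> ('a \<Rightarrow> 'a \<Rightarrow> 'a \<Rightarrow> 'a \<Rightarrow> 'a \<Rightarrow> 'b) \<Rightarrow> 'b::comm_monoid_add"
  where "coprod5 x f = sweedler (\<Delta> x) (\<lambda>x1 x'. coprod4 x' (f x1))"

definition coprod6 ::
    "'a::coalgebra \<Rightarrow> ('a \<Rightarrow> 'a \<Rightarrow> 'a \<Rightarrow> 'a \<Rightarrow> 'a \<Rightarrow> 'a \<Rightarrow> 'b) \<Rightarrow> 'b::comm_monoid_add"
  where "coprod6 x f = sweedler (\<Delta> x) (\<lambda>x1 x'. coprod5 x' (f x1))"

(* The action is curried, a linear map on H \<otimes> A being a bilinear map on H and A. The map \<chi> is kept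
   on H \<otimes> H, the coalgebra which its convolution inverse refers to. A bound variable such as
   x2HI stands for ((x_2)_H)_I. *)
locale cocycle_singer_pair =
  fixes act :: "'h::{hopf_algebra, cocommutative_coalgebra} \<Rightarrow>
      'a::{hopf_algebra, comm_ring_1} \<Rightarrow> 'a" (infixr "\<rhd>" 75)
    and \<rho> :: "'h \<Rightarrow> 'h \<otimes> 'a"
    and \<chi> :: "'h \<otimes> 'h \<Rightarrow> 'a"
    and \<psi> :: "'h \<Rightarrow> 'a \<otimes> 'a"
  assumes cbilinear_act: "cbilinear (\<rhd>)"
    and clinear_rho: "clinear \<rho>"
    and clinear_chi: "clinear \<chi>"
    and clinear_psi: "clinear \<psi>"
    and chi_invertible: "convolution_invertible \<chi>"
    and psi_invertible: "convolution_invertible \<psi>"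

    and act_one: "x \<rhd> 1 = \<epsilon> x *\<^sub>C 1"
    and act_mult: "x \<rhd> (a * b) = coprod2 x (\<lambda>x1 x2. (x1 \<rhd> a) * (x2 \<rhd> b))"
    and one_act: "1 \<rhd> a = a"
    and act_act: "x \<rhd> y \<rhd> a = (x * y) \<rhd> a"
    and chi_cocycle:
      "coprod2 x (\<lambda>x1 x2. coprod2 y (\<lambda>y1 y2. coprod2 z (\<lambda>z1 z2.
         (x1 \<rhd> \<chi> (y1 \<otimes> z1)) * \<chi> (x2 \<otimes> (y2 * z2))))) =
       coprod2 x (\<lambda>x1 x2. coprod2 y (\<lambda>y1 y2. \<chi> (x1 \<otimes> y1) * \<chi> ((x2 * y2) \<otimes> z)))"
    and chi_one_right: "\<chi> (x \<otimes> 1) = \<epsilon> x *\<^sub>C 1"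
    and chi_one_left: "\<chi> (1 \<otimes> x) = \<epsilon> x *\<^sub>C 1"

    and rho_counit_left: "sweedler (\<rho> x) (\<lambda>xH xA. \<epsilon> xH *\<^sub>C xA) = \<epsilon> x *\<^sub>C 1"
    and rho_comult:
      "sweedler (\<rho> x) (\<lambda>xH xA. coprod2 xH (\<lambda>xH1 xH2. xH1 \<otimes> xH2 \<otimes> xA)) =
       coprod2 x (\<lambda>x1 x2. sweedler (\<rho> x1) (\<lambda>x1H x1A. sweedler (\<rho> x2) (\<lambda>x2H x2A.
         x1H \<otimes> x2H \<otimes> (x1A * x2A))))"
    and rho_counit_right: "sweedler (\<rho> x) (\<lambda>xH xA. \<epsilon> xA *\<^sub>C xH) = x"
    and rho_rho:
      "sweedler (\<rho> x) (\<lambda>xH xA. sweedler (\<rho> xH) (\<lambda>xHH xHA. xHH \<otimes> xHA \<otimes> xA)) =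
       sweedler (\<rho> x) (\<lambda>xH xA. coprod2 xA (\<lambda>xA1 xA2. xH \<otimes> xA1 \<otimes> xA2))"
    and psi_cocycle:
      "coprod2 x (\<lambda>x1 x2. sweedler (\<psi> x1) (\<lambda>x1I x1II. coprod2 x1I (\<lambda>x1I1 x1I2.
         sweedler (\<rho> x2) (\<lambda>x2H x2A. sweedler (\<psi> x2H) (\<lambda>x2HI x2HII.
           (x1I1 * x2HI) \<otimes> (x1I2 * x2HII) \<otimes> (x1II * x2A)))))) =
       coprod2 x (\<lambda>x1 x2. sweedler (\<psi> x1) (\<lambda>x1I x1II. coprod2 x1II (\<lambda>x1II1 x1II2.
         sweedler (\<psi> x2) (\<lambda>x2I x2II.
           x1I \<otimes> (x1II1 * x2I) \<otimes> (x1II2 * x2II)))))"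
    and psi_counit_left: "sweedler (\<psi> x) (\<lambda>xI xII. \<epsilon> xI *\<^sub>C xII) = \<epsilon> x *\<^sub>C 1"
    and psi_counit_right: "sweedler (\<psi> x) (\<lambda>xI xII. \<epsilon> xII *\<^sub>C xI) = \<epsilon> x *\<^sub>C 1"

    and counit_act: "\<epsilon> (x \<rhd> a) = \<epsilon> x * \<epsilon> a"
    and rho_one: "\<rho> 1 = 1 \<otimes> 1"
    and counit_chi: "\<epsilon> (\<chi> (x \<otimes> y)) = \<epsilon> x * \<epsilon> y"
    and psi_one: "\<psi> 1 = 1 \<otimes> 1"
    and comult_act:
      "\<Delta> (x \<rhd> a) =
       coprod2 x (\<lambda>x1 x2. sweedler (\<rho> x1) (\<lambda>x1H x1A. coprod2 a (\<lambda>a1 a2.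
         (x1H \<rhd> a1) \<otimes> (x1A * (x2 \<rhd> a2)))))"
    and rho_mult:
      "\<rho> (x * y) =
       coprod2 x (\<lambda>x1 x2. sweedler (\<rho> x1) (\<lambda>x1H x1A. sweedler (\<rho> y) (\<lambda>yH yA.
         (x1H * yH) \<otimes> (x1A * (x2 \<rhd> yA)))))"
    and chi_psi:
      "coprod2 x (\<lambda>x1 x2. coprod2 y (\<lambda>y1 y2.
         coprod2 (\<chi> (x1 \<otimes> y1)) (\<lambda>c1 c2. sweedler (\<psi> (x2 * y2)) (\<lambda>dI dII.
           (c1 * dI) \<otimes> (c2 * dII))))) =
       coprod6 x (\<lambda>x1 x2 x3 x4 x5 x6. coprod3 y (\<lambda>y1 y2 y3.
         sweedler (\<psi> x1) (\<lambda>x1I x1II. sweedler (\<rho> x2) (\<lambda>x2H x2A.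
         sweedler (\<rho> x4) (\<lambda>x4H x4A. sweedler (\<psi> y1) (\<lambda>y1I y1II.
         sweedler (\<rho> y2) (\<lambda>y2H y2A.
           (x1I * (x2H \<rhd> y1I) * \<chi> (x4H \<otimes> y2H)) \<otimes>
           (x1II * x2A * (x3 \<rhd> y1II) * x4A * (x5 \<rhd> y2A) * \<chi> (x6 \<otimes> y3)))))))))"

end

(* The heuristic behind the proof is to treat the elements x, u, v of the cocommutative Hopf algebra H
   as group elements, with S as inversion. Formally, coalgebra maps from a cocommutative coalgebra C
   to H form a group under convolution, which acts on the commutative algebra Hom(C, A), and chi
   becomes a 2-cocycle of this group.

   Let delta(u) = chi(u, S u), so that gamma is the convolution inverse of delta. After replacing
   every x by its adjoint, gamma cancels from each of the conditions (ii)-(v).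
   - (ii) says that u |> (u* |> a)* = a*, which is (a).
   - The cocycle identities for (u, v, S v) and (u v, S v, S u) give
     gamma(u) (u |> gamma(v)) chi(u, v) = gamma(u v) (u v |> chi^-1(S v, S u)), so (iii) is (b).
   - Given (b), (i) is the cocycle identity for (u, S u, u).
   - The inverse of rho(u) is on the one hand (S (x) id) rho(u), on the other hand u |> applied to the
     second factor of rho(S u). This turns (c) into (iv), given (a).
   - The compatibility of chi and psi at (u, S u) expresses the comultiplication of delta(u), hence of
     gamma(u), through psi^-1(S u). Given (a) and (c), this turns (v) into (d). *)
theory Submission
  imports Defs
begin

section \<open>Linear maps and Sweedler sums\<close>

text \<open>No formula is ever evaluated at group-like elements, of which H may have few. An
  identity in u is read as one between linear maps on H, an identity in independent u and v as one
  between linear maps on C = H \<otimes> H, where u and v are the two projections. Words such as u v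
  or S v are again coalgebra maps from C to H, so they may be substituted into the cocycle identity.
  Cocommutativity pays for the repeated occurrence of a variable: it allows the Sweedler factors to
  be regrouped at will. A second obstacle is conjugate linearity, since a starred expression is not
  an element of Hom(C, A). One star inside and one outside, as in
  \<open>(f (u\<^sup>\<star>))\<^sup>\<star>\<close>, restore linearity; hence the replacement of
  every variable by its adjoint. The compatibility of chi and psi lives in Hom(C, A \<otimes> A).
  The action of H on A \<otimes> A occurring there is not the diagonal one but the one that makes
  the comultiplication of A equivariant, and rho enters its definition. Finally, (c) and (iv) meet
  in the formula that rho(u) is the star of \<open>\<rho> (u\<^sup>\<star>)\<close> with u acting on
  its second factor; the same formula is what rewrites (v).\<close>

named_theorems lin

lemma clinearI:
  assumes "\<And>x y. f (x + y) = f x + f y" "\<And>c x. f (c *\<^sub>C x) = c *\<^sub>C f x"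
  shows "clinear f"
  using assms by (simp add: Vector_Spaces.linear_iff cvs.vector_space_axioms)

lemma clinear_add: "clinear f \<Longrightarrow> f (x + y) = f x + f y"
  and clinear_scaleC: "clinear f \<Longrightarrow> f (c *\<^sub>C x) = c *\<^sub>C f x"
  by (simp_all add: Vector_Spaces.linear_iff)

lemma clinear_zero: "clinear f \<Longrightarrow> f 0 = 0"
  using clinear_scaleC[of f 0 0] by simp

lemma clinear_compose: "clinear f \<Longrightarrow> clinear g \<Longrightarrow> clinear (\<lambda>x. f (g x))"
  by (simp add: Vector_Spaces.linear_iff)

lemma balanced_bilinear:
  assumes "\<And>b. clinear (\<lambda>a. f a b)" "\<And>a. clinear (f a)"
  shows "balanced f"
  using clinear_add[OF assms(1)] clinear_add[OF assms(2)]
    clinear_scaleC[OF assms(1)] clinear_scaleC[OF assms(2)]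
  by (simp add: balanced_def)

lemma clinear_sweedler_left:
  assumes "clinear t" "\<And>b. clinear (\<lambda>a. f a b)" "\<And>a. clinear (f a)"
  shows "clinear (\<lambda>x. sweedler (t x) f)"
  using sweedler_add[OF balanced_bilinear[OF assms(2,3)]]
    sweedler_scaleC_left[OF balanced_bilinear[OF assms(2,3)] clinear_scaleC[OF assms(2)]]
  by (intro clinearI) (simp_all add: clinear_add[OF assms(1)] clinear_scaleC[OF assms(1)])

lemma clinear_sweedler_right:
  assumes "\<And>a b. clinear (f a b)"
  shows "clinear (\<lambda>x. sweedler t (\<lambda>a b. f a b x))"
  by (rule clinearI)
    (simp_all add: clinear_add[OF assms] clinear_scaleC[OF assms] sweedler_add_fun sweedler_scaleC)

lemma clinear_ident: "clinear (\<lambda>x. x)"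
  by (rule clinearI) simp_all

lemma clinear_scaleC_right: "clinear f \<Longrightarrow> clinear (\<lambda>x. c *\<^sub>C f x)"
  by (rule clinearI) (simp_all add: clinear_add clinear_scaleC cvs.scale_right_distrib mult.commute)

lemma clinear_scaleC_left: "clinear f \<Longrightarrow> clinear (\<lambda>x. f x *\<^sub>C y)"
  by (rule clinearI)
    (simp_all add: clinear_add clinear_scaleC cvs.scale_left_distrib scaleC_complex_def)

lemma clinear_mult_left:
  fixes f :: "'a::complex_vector \<Rightarrow> 'b::complex_algebra_1"
  shows "clinear f \<Longrightarrow> clinear (\<lambda>x. f x * y)"
  by (rule clinearI) (simp_all add: clinear_add clinear_scaleC algebra_simps mult_scaleC_left)

lemma clinear_mult_right:
  fixes f :: "'a::complex_vector \<Rightarrow> 'b::complex_algebra_1"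
  shows "clinear f \<Longrightarrow> clinear (\<lambda>x. y * f x)"
  by (rule clinearI) (simp_all add: clinear_add clinear_scaleC algebra_simps mult_scaleC_right)

lemma clinear_tensor_left: "clinear f \<Longrightarrow> clinear (\<lambda>x. f x \<otimes> y)"
  by (rule clinearI) (simp_all add: clinear_add clinear_scaleC tensor_add_left tensor_scaleC_left)

lemma clinear_tensor_right: "clinear f \<Longrightarrow> clinear (\<lambda>x. y \<otimes> f x)"
  by (rule clinearI) (simp_all add: clinear_add clinear_scaleC tensor_add_right tensor_scaleC_right)

text \<open>\<open>sweedler\<close> sums over an arbitrary representation, so nearly every rewrite
  below has linearity side conditions; these syntax-directed rules let the simplifier discharge
  them. Constants occur both bare and composed, because the bare form is what remains after
  eta-contraction.\<close>

declare clinear_ident [lin] clinear_scaleC_right [lin] clinear_scaleC_left [lin]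
  clinear_mult_left [lin] clinear_mult_right [lin] clinear_tensor_left [lin]
  clinear_tensor_right [lin] clinear_sweedler_left [lin] clinear_sweedler_right [lin]
  clinear_compose [OF clinear_comult, lin] clinear_compose [OF clinear_counit, lin]
  clinear_compose [OF clinear_antipode, lin]
  clinear_comult [lin] clinear_counit [lin] clinear_antipode [lin]

section \<open>Evaluation of Sweedler sums and their behaviour under linear maps\<close>

lemma sweedler_tensor:
  assumes "\<And>b. clinear (\<lambda>a. f a b)" "\<And>a. clinear (f a)"
  shows "sweedler (a \<otimes> b) f = f a b"
  by (rule sweedler_pure) (rule balanced_bilinear[OF assms])

lemma sweedler_sweedler:
  assumes "\<And>b. clinear (\<lambda>a. F a b)" "\<And>a. clinear (F a)"
  shows "sweedler (sweedler t f) F = sweedler t (\<lambda>a b. sweedler (f a b) F)"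
  by (rule sweedler_additive)
    (simp_all add: sweedler_add sweedler_zero balanced_bilinear assms)

lemma clinear_sweedler: "clinear h \<Longrightarrow> h (sweedler t f) = sweedler t (\<lambda>a b. h (f a b))"
  by (rule sweedler_additive) (simp_all add: clinear_add clinear_zero)

lemma sweedler_mult_left:
  fixes y :: "'b::complex_algebra_1"
  shows "sweedler t f * y = sweedler t (\<lambda>a b. f a b * y)"
  by (rule clinear_sweedler) (simp add: lin)

lemma sweedler_mult_right:
  fixes y :: "'b::complex_algebra_1"
  shows "y * sweedler t f = sweedler t (\<lambda>a b. y * f a b)"
  by (rule clinear_sweedler) (simp add: lin)

lemma sweedler_tensor_left: "sweedler t f \<otimes> y = sweedler t (\<lambda>a b. f a b \<otimes> y)"
  by (rule clinear_sweedler) (simp add: lin)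

lemma sweedler_tensor_right: "y \<otimes> sweedler t f = sweedler t (\<lambda>a b. y \<otimes> f a b)"
  by (rule clinear_sweedler) (simp add: lin)

lemma sweedler_tensor_ident: "sweedler t (\<otimes>) = t"
proof (induction t rule: tensor_induct)
  case (pure a b)
  show ?case by (rule sweedler_tensor) (simp_all add: lin)
next
  case (add t u)
  then show ?case by (simp add: sweedler_add balanced_bilinear lin)
qed

lemma clinear_tensor_ext:
  assumes "clinear f" "clinear g" "\<And>a b. f (a \<otimes> b) = g (a \<otimes> b)"
  shows "f t = g t"
  by (induction t rule: tensor_induct)
    (simp_all add: assms(3) clinear_add[OF assms(1)] clinear_add[OF assms(2)])

section \<open>Coassociativity, cocommutativity and permutations of Sweedler factors\<close>

lemma sweedler_coassoc:
  assumes "\<And>y z. clinear (\<lambda>x. G x y z)" "\<And>x z. clinear (\<lambda>y. G x y z)" "\<And>x y. clinear (G x y)"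
  shows "sweedler (\<Delta> x) (\<lambda>a b. sweedler (\<Delta> a) (\<lambda>c d. G c d b)) =
    sweedler (\<Delta> x) (\<lambda>a b. sweedler (\<Delta> b) (\<lambda>c d. G a c d))"
  by (rule coassoc_trilinear)
    (simp_all add: clinear_add[OF assms(1)] clinear_add[OF assms(2)] clinear_add[OF assms(3)]
      clinear_scaleC[OF assms(1)] clinear_scaleC[OF assms(2)] clinear_scaleC[OF assms(3)])

lemma sweedler_cocommute:
  fixes x :: "'c::{coalgebra, cocommutative_coalgebra}"
  assumes "\<And>b. clinear (\<lambda>a. f a b)" "\<And>a. clinear (f a)"
  shows "sweedler (\<Delta> x) f = sweedler (\<Delta> x) (\<lambda>a b. f b a)"
proof -
  have "sweedler (sweedler (\<Delta> x) (\<lambda>x1 x2. x2 \<otimes> x1)) f = sweedler (\<Delta> x) (\<lambda>a b. f b a)"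
    by (simp add: sweedler_sweedler sweedler_tensor assms)
  then show ?thesis by (simp add: cocommutative)
qed

lemma sweedler_counit_left:
  assumes "clinear f"
  shows "sweedler (\<Delta> x) (\<lambda>a b. \<epsilon> a *\<^sub>C f b) = f x"
  using clinear_sweedler[OF assms, of "\<Delta> x" "\<lambda>a b. \<epsilon> a *\<^sub>C b"]
  by (simp add: counit_left clinear_scaleC[OF assms])

lemma sweedler_counit_right:
  assumes "clinear f"
  shows "sweedler (\<Delta> x) (\<lambda>a b. \<epsilon> b *\<^sub>C f a) = f x"
  using clinear_sweedler[OF assms, of "\<Delta> x" "\<lambda>a b. \<epsilon> b *\<^sub>C a"]
  by (simp add: counit_right clinear_scaleC[OF assms])

(* Cocommutativity says that the comultiplication is itself a morphism of coalgebras. *)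
lemma sweedler_interchange:
  fixes x :: "'c::{coalgebra, cocommutative_coalgebra}"
    and F :: "'c \<Rightarrow> 'c \<Rightarrow> 'c \<Rightarrow> 'c \<Rightarrow> 'd::complex_vector"
  assumes "\<And>b c d. clinear (\<lambda>a. F a b c d)" "\<And>a c d. clinear (\<lambda>b. F a b c d)"
    "\<And>a b d. clinear (\<lambda>c. F a b c d)" "\<And>a b c. clinear (F a b c)"
  shows "sweedler (\<Delta> x) (\<lambda>x1 x2. sweedler (\<Delta> x1) (\<lambda>a b. sweedler (\<Delta> x2) (\<lambda>c d. F a b c d))) =
    sweedler (\<Delta> x) (\<lambda>x1 x2. sweedler (\<Delta> x1) (\<lambda>a c. sweedler (\<Delta> x2) (\<lambda>b d. F a b c d)))"
proof -
  \<comment> \<open>Rebracketing isolates the two middle factors in a single coproduct, where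
    cocommutativity can exchange them.\<close>
  have r: "sweedler (\<Delta> x) (\<lambda>x1 x2. sweedler (\<Delta> x1) (\<lambda>a b. sweedler (\<Delta> x2) (\<lambda>c d. G a b c d))) =
    sweedler (\<Delta> x) (\<lambda>a y. sweedler (\<Delta> y) (\<lambda>z d. sweedler (\<Delta> z) (\<lambda>b c. G a b c d)))"
    if G: "\<And>b c d. clinear (\<lambda>a. G a b c d)" "\<And>a c d. clinear (\<lambda>b. G a b c d)"
    "\<And>a b d. clinear (\<lambda>c. G a b c d)" "\<And>a b c. clinear (G a b c)" for G :: "'c \<Rightarrow> 'c \<Rightarrow> 'c \<Rightarrow> 'c \<Rightarrow> 'd"
  proof -
    note lin [simp] and G [simp]
    have "sweedler (\<Delta> x) (\<lambda>x1 x2. sweedler (\<Delta> x1) (\<lambda>a b. sweedler (\<Delta> x2) (\<lambda>c d. G a b c d))) =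
      sweedler (\<Delta> x) (\<lambda>a y. sweedler (\<Delta> y) (\<lambda>b z. sweedler (\<Delta> z) (\<lambda>c d. G a b c d)))"
      by (rule sweedler_coassoc) simp_all
    also have "\<dots> = sweedler (\<Delta> x) (\<lambda>a y. sweedler (\<Delta> y) (\<lambda>z d. sweedler (\<Delta> z) (\<lambda>b c. G a b c d)))"
      by (simp add: sweedler_coassoc[of "\<lambda>b c d. G _ b c d"])
    finally show ?thesis .
  qed
  have "sweedler (\<Delta> z) (\<lambda>b c. F a b c d) = sweedler (\<Delta> z) (\<lambda>b c. F a c b d)" for z a d
    by (rule sweedler_cocommute) (simp_all add: assms)
  then show ?thesis
    by (simp add: r[of F] r[of "\<lambda>a c b d. F a b c d"] assms)
qed

lemma sweedler_left_commute:
  fixes x :: "'c::{coalgebra, cocommutative_coalgebra}"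
  assumes "\<And>b c. clinear (\<lambda>a. F a b c)" "\<And>a c. clinear (\<lambda>b. F a b c)" "\<And>a b. clinear (F a b)"
  shows "sweedler (\<Delta> x) (\<lambda>a y. sweedler (\<Delta> y) (\<lambda>b c. F a b c)) =
    sweedler (\<Delta> x) (\<lambda>a y. sweedler (\<Delta> y) (\<lambda>b c. F b a c))"
proof -
  have "sweedler (\<Delta> x) (\<lambda>a y. sweedler (\<Delta> y) (\<lambda>b c. F a b c)) =
      sweedler (\<Delta> x) (\<lambda>y c. sweedler (\<Delta> y) (\<lambda>a b. F a b c))"
    by (rule sweedler_coassoc[symmetric]) (simp_all add: assms)
  also have "\<dots> = sweedler (\<Delta> x) (\<lambda>y c. sweedler (\<Delta> y) (\<lambda>a b. F b a c))"
    by (subst sweedler_cocommute) (simp_all add: assms)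
  also have "\<dots> = sweedler (\<Delta> x) (\<lambda>a y. sweedler (\<Delta> y) (\<lambda>b c. F b a c))"
    by (rule sweedler_coassoc) (simp_all add: assms)
  finally show ?thesis .
qed

text \<open>In the conditions (i), (ii) and the right side of (iii) the starred argument carries the
  index 1, while a convolution puts it last. This cyclic shift reconciles the two.\<close>

lemma sweedler_rotate:
  fixes x :: "'c::{coalgebra, cocommutative_coalgebra}"
  assumes "\<And>b c. clinear (\<lambda>a. F a b c)" "\<And>a c. clinear (\<lambda>b. F a b c)" "\<And>a b. clinear (F a b)"
  shows "sweedler (\<Delta> x) (\<lambda>a y. sweedler (\<Delta> y) (\<lambda>b c. F a b c)) =
    sweedler (\<Delta> x) (\<lambda>a y. sweedler (\<Delta> y) (\<lambda>b c. F b c a))"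
proof -
  have "sweedler (\<Delta> x) (\<lambda>a y. sweedler (\<Delta> y) (\<lambda>b c. F b c a)) =
      sweedler (\<Delta> x) (\<lambda>y a. sweedler (\<Delta> y) (\<lambda>b c. F b c a))"
    by (rule sweedler_cocommute) (simp_all add: assms lin)
  also have "\<dots> = sweedler (\<Delta> x) (\<lambda>b y. sweedler (\<Delta> y) (\<lambda>c a. F b c a))"
    by (rule sweedler_coassoc) (simp_all add: assms)
  finally show ?thesis by simp
qed

section \<open>The convolution algebra\<close>

text \<open>The unit of the convolution algebra. With a bialgebra as target it also serves as the
  constant point 1.\<close>

definition unit_counit :: "'c::coalgebra \<Rightarrow> 'a::complex_algebra_1"
  where "unit_counit x = \<epsilon> x *\<^sub>C 1"

lemma clinear_unit_counit [lin]: "clinear unit_counit"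
  unfolding unit_counit_def by (simp add: lin)

lemma clinear_convolution [lin]: "clinear f \<Longrightarrow> clinear g \<Longrightarrow> clinear (convolution f g)"
  unfolding convolution_def
  by (intro lin allI) (simp_all add: lin)

lemma convolution_assoc:
  assumes [lin]: "clinear f" "clinear g" "clinear h"
  shows "convolution (convolution f g) h = convolution f (convolution g h)"
proof
  fix x
  show "convolution (convolution f g) h x = convolution f (convolution g h) x"
    using sweedler_coassoc[of "\<lambda>a b c. f a * g b * h c" x]
    by (simp add: convolution_def sweedler_mult_left sweedler_mult_right lin mult.assoc)
qed

text \<open>Commutativity of the target is a hypothesis and not a sort, so that the lemma also
  covers A \<otimes> A, with \<open>tensor_mult_commute\<close> supplying it.\<close>

lemma convolution_commute:
  fixes f g :: "'c::{coalgebra, cocommutative_coalgebra} \<Rightarrow> 'a::complex_algebra_1"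
  assumes [lin]: "clinear f" "clinear g" and comm: "\<And>a b :: 'a. a * b = b * a"
  shows "convolution f g = convolution g f"
proof
  fix x
  have "convolution f g x = sweedler (\<Delta> x) (\<lambda>a b. f b * g a)"
    unfolding convolution_def by (rule sweedler_cocommute) (simp_all add: lin)
  then show "convolution f g x = convolution g f x"
    by (simp add: convolution_def comm)
qed

lemma convolution_unit_left:
  assumes "clinear f" shows "convolution unit_counit f = f"
  by (simp add: convolution_def unit_counit_def fun_eq_iff mult_scaleC_left sweedler_counit_left assms)

lemma convolution_unit_right:
  assumes "clinear f" shows "convolution f unit_counit = f"
  by (simp add: convolution_def unit_counit_def fun_eq_iff mult_scaleC_right sweedler_counit_right assms)

lemma is_convolution_inverse_iff:
  "is_convolution_inverse f g \<longleftrightarrow>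
     clinear g \<and> convolution f g = unit_counit \<and> convolution g f = unit_counit"
  by (simp add: is_convolution_inverse_def unit_counit_def[abs_def])

text \<open>The source of all identities of antipode type below: two formulas agree because one is a
  left inverse and the other a right inverse of the same map.\<close>

lemma convolution_inverse_unique:
  assumes "clinear f" "clinear g" "clinear h"
    "convolution g f = unit_counit" "convolution f h = unit_counit"
  shows "g = h"
  using convolution_assoc[of g f h] assms
  by (simp add: convolution_unit_left convolution_unit_right)

lemma convolution_left_cancel:
  assumes "clinear f" "clinear f'" "convolution f' f = unit_counit" "clinear g" "clinear h"
  shows "convolution f g = convolution f h \<longleftrightarrow> g = h"
  using convolution_assoc[of f' f g] convolution_assoc[of f' f h] assms
  by (metis convolution_unit_left)

lemma convolution_left_commute:
  fixes f g h :: "'c::{coalgebra, cocommutative_coalgebra} \<Rightarrow> 'a::complex_algebra_1"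
  assumes "clinear f" "clinear g" "clinear h" and comm: "\<And>a b :: 'a. a * b = b * a"
  shows "convolution f (convolution g h) = convolution g (convolution f h)"
  using convolution_assoc[of f g h] convolution_assoc[of g f h] convolution_commute[of f g] assms
  by metis

lemma convolution_inverse_mult:
  fixes f g :: "'c::{coalgebra, cocommutative_coalgebra} \<Rightarrow> 'a::complex_algebra_1"
  assumes [lin]: "clinear f" "clinear g" "clinear f'" "clinear g'"
    and comm: "\<And>a b :: 'a. a * b = b * a"
    and inv: "convolution f f' = unit_counit" "convolution g g' = unit_counit"
  shows "convolution (convolution f g) (convolution f' g') = unit_counit"
proof -
  note ac = convolution_assoc convolution_commute[OF _ _ comm] convolution_left_commute[OF _ _ _ comm]
  have "convolution (convolution f g) (convolution f' g') =
      convolution (convolution f f') (convolution g g')"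
    by (simp add: ac lin)
  then show ?thesis using inv by (simp add: convolution_unit_left lin)
qed

text \<open>In a commutative group, A = B C and D E = C F make both sides equal to the inverse of C
  F, which eliminates C. No inverse of C is at hand, so both sides are instead shown to be inverse
  to D E.\<close>

lemma convolution_quotient_eq:
  fixes A B C D E F :: "'c::{coalgebra, cocommutative_coalgebra} \<Rightarrow> 'a::complex_algebra_1"
  assumes [lin]: "clinear A" "clinear B" "clinear C" "clinear D" "clinear E" "clinear F"
      "clinear A'" "clinear D'" "clinear E'" "clinear F'"
    and comm: "\<And>a b :: 'a. a * b = b * a"
    and inv: "convolution A A' = unit_counit" "convolution D D' = unit_counit"
      "convolution E E' = unit_counit" "convolution F F' = unit_counit"
    and eq: "A = convolution B C" "convolution D E = convolution C F"
  shows "convolution (convolution F' A') B = convolution E' D'"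
proof (rule convolution_inverse_unique)
  note ac = convolution_assoc convolution_commute[OF _ _ comm] convolution_left_commute[OF _ _ _ comm]
  have "convolution (convolution (convolution F' A') B) (convolution C F) =
      convolution (convolution (convolution B C) A') (convolution F F')"
    by (simp add: ac lin)
  then show "convolution (convolution (convolution F' A') B) (convolution D E) = unit_counit"
    using inv eq(1) by (simp add: eq(2) convolution_unit_left lin)
  have "convolution (convolution D E) (convolution E' D') =
      convolution (convolution D D') (convolution E E')"
    by (simp add: ac lin)
  then show "convolution (convolution D E) (convolution E' D') = unit_counit"
    using inv by (simp add: convolution_unit_left lin)
qed (simp_all add: lin)

section \<open>Coalgebra maps as points, and substitution into convolution identities\<close>

definition coalgebra_map :: "('c::coalgebra \<Rightarrow> 'd::coalgebra) \<Rightarrow> bool"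
  where "coalgebra_map p \<longleftrightarrow> clinear p \<and> (\<forall>x. \<epsilon> (p x) = \<epsilon> x) \<and>
    (\<forall>x. \<Delta> (p x) = sweedler (\<Delta> x) (\<lambda>a b. p a \<otimes> p b))"

lemma coalgebra_map_sweedler:
  assumes "coalgebra_map p" "\<And>b. clinear (\<lambda>a. f a b)" "\<And>a. clinear (f a)"
  shows "sweedler (\<Delta> (p x)) f = sweedler (\<Delta> x) (\<lambda>a b. f (p a) (p b))"
  using assms by (simp add: coalgebra_map_def sweedler_sweedler sweedler_tensor)

text \<open>Precomposition with a coalgebra map is a morphism of convolution algebras; this is what
  allows a point \<open>p\<close> to be substituted into an identity.\<close>

lemma convolution_pullback:
  assumes "coalgebra_map p" "clinear f" "clinear g"
  shows "convolution f g (p x) = convolution (\<lambda>x. f (p x)) (\<lambda>x. g (p x)) x"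
  using assms by (simp add: convolution_def coalgebra_map_sweedler lin)

lemma unit_counit_pullback: "coalgebra_map p \<Longrightarrow> unit_counit (p x) = unit_counit x"
  by (simp add: coalgebra_map_def unit_counit_def)

lemma convolution_pushforward:
  assumes "clinear h" "\<And>a b. h (a * b) = h a * h b"
  shows "h (convolution f g x) = convolution (\<lambda>x. h (f x)) (\<lambda>x. h (g x)) x"
  by (simp add: convolution_def clinear_sweedler assms)

lemma unit_counit_pushforward:
  assumes "clinear h" "h 1 = 1"
  shows "h (unit_counit x) = unit_counit x"
  by (simp add: unit_counit_def clinear_scaleC assms)

text \<open>Two independent variables are modelled on H \<otimes> H, which therefore has to qualify
  as a cocommutative domain for convolution.\<close>

instance tensor :: ("{coalgebra, cocommutative_coalgebra}", "{coalgebra, cocommutative_coalgebra}")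
  cocommutative_coalgebra
proof
  fix t :: "'a \<otimes> 'b"
  show "sweedler (\<Delta> t) (\<lambda>x1 x2. x2 \<otimes> x1) = \<Delta> t"
  proof (rule clinear_tensor_ext[where f = "\<lambda>t. sweedler (\<Delta> t) (\<lambda>x1 x2. x2 \<otimes> x1)" and g = \<Delta>])
    fix a :: 'a and b :: 'b
    have "sweedler (\<Delta> (a \<otimes> b)) (\<lambda>x1 x2. x2 \<otimes> x1) =
      sweedler (\<Delta> a) (\<lambda>a1 a2. sweedler (\<Delta> b) (\<lambda>b1 b2. (a2 \<otimes> b2) \<otimes> (a1 \<otimes> b1)))"
      by (subst sweedler_comult_tensor_pure) (simp_all add: balanced_bilinear lin)
    also have "\<dots> = sweedler (\<Delta> a) (\<lambda>a1 a2. sweedler (\<Delta> b) (\<lambda>b1 b2. (a2 \<otimes> b1) \<otimes> (a1 \<otimes> b2)))"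
      by (subst sweedler_cocommute[of _ b]) (simp_all add: lin)
    also have "\<dots> = \<Delta> (a \<otimes> b)"
      unfolding comult_tensor_pure by (subst sweedler_cocommute[of _ a]) (simp_all add: lin)
    finally show "sweedler (\<Delta> (a \<otimes> b)) (\<lambda>x1 x2. x2 \<otimes> x1) = \<Delta> (a \<otimes> b)" .
  qed (simp_all add: lin)
qed

lemma convolution_tensor:
  assumes "clinear f" "clinear g"
  shows "convolution f g (x \<otimes> y) =
    sweedler (\<Delta> x) (\<lambda>x1 x2. sweedler (\<Delta> y) (\<lambda>y1 y2. f (x1 \<otimes> y1) * g (x2 \<otimes> y2)))"
  unfolding convolution_def
  by (rule sweedler_comult_tensor_pure)
    (simp_all add: balanced_bilinear lin clinear_compose[OF assms(1)] clinear_compose[OF assms(2)] assms)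

lemma tensor_mult_commute:
  fixes s t :: "'a::{complex_algebra_1, comm_monoid_mult} \<otimes> 'b::{complex_algebra_1, comm_monoid_mult}"
  shows "s * t = t * s"
proof (induction s rule: tensor_induct)
  case (pure a b)
  show ?case
    by (induction t rule: tensor_induct) (simp_all add: times_tensor_pure mult.commute algebra_simps)
qed (simp add: algebra_simps)

section \<open>Antipodes and involutions\<close>

text \<open>A reformulation of the bialgebra axioms for products. The map is the product u v of the
  two generic points, so this makes u v a point as well.\<close>

lemma coalgebra_map_mult: "coalgebra_map (\<lambda>t. sweedler t (*) :: 'a::{bialgebra})"
proof -
  have m: "\<Delta> (sweedler t (*)) = sweedler (\<Delta> t) (\<lambda>a b. sweedler a (*) \<otimes> sweedler b (*))"
    for t :: "'a \<otimes> 'a"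
  proof (rule clinear_tensor_ext[of "\<lambda>t. \<Delta> (sweedler t (*))"
        "\<lambda>t. sweedler (\<Delta> t) (\<lambda>a b. sweedler a (*) \<otimes> sweedler b (*))"])
    fix a b :: 'a
    have "sweedler (\<Delta> (a \<otimes> b)) (\<lambda>a b. sweedler a (*) \<otimes> sweedler b (*)) =
        sweedler (\<Delta> a) (\<lambda>a1 a2. sweedler (\<Delta> b) (\<lambda>b1 b2.
          sweedler (a1 \<otimes> b1) (*) \<otimes> sweedler (a2 \<otimes> b2) (*)))"
      by (rule sweedler_comult_tensor_pure) (simp add: balanced_bilinear lin)
    also have "\<dots> = sweedler (\<Delta> a) (\<lambda>a1 a2. sweedler (\<Delta> b) (\<lambda>b1 b2. (a1 * b1) \<otimes> (a2 * b2)))"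
      by (simp add: sweedler_tensor lin)
    finally show "\<Delta> (sweedler (a \<otimes> b) (*)) =
        sweedler (\<Delta> (a \<otimes> b)) (\<lambda>a b. sweedler a (*) \<otimes> sweedler b (*))"
      by (simp add: sweedler_tensor lin comult_mult times_tensor_def)
  qed (simp_all add: lin)
  have "\<epsilon> (sweedler t (*)) = \<epsilon> t" for t :: "'a \<otimes> 'a"
    by (rule clinear_tensor_ext[of "\<lambda>t. \<epsilon> (sweedler t (*))" \<epsilon>])
      (simp_all add: lin sweedler_tensor counit_mult counit_tensor_pure)
  with m show ?thesis by (simp add: coalgebra_map_def lin)
qed

lemma counit_antipode: "\<epsilon> (\<S> x) = \<epsilon> (x :: 'a::hopf_algebra)"
proof -
  have "\<epsilon> x = \<epsilon> (sweedler (\<Delta> x) (\<lambda>a b. \<S> a * b))"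
    by (simp add: antipode_left clinear_scaleC[OF clinear_counit] counit_one scaleC_complex_def)
  also have "\<dots> = sweedler (\<Delta> x) (\<lambda>a b. \<epsilon> b *\<^sub>C \<epsilon> (\<S> a))"
    by (simp add: clinear_sweedler[OF clinear_counit] counit_mult scaleC_complex_def mult.commute)
  also have "\<dots> = \<epsilon> (\<S> x)"
    by (rule sweedler_counit_right) (simp add: lin)
  finally show ?thesis by simp
qed

text \<open>Both sides, as maps on the tensor square, are convolution inverses of the
  multiplication: the left side because the multiplication is a coalgebra map, the right side by
  cancelling the inner and then the outer pair of factors.\<close>

lemma antipode_mult: "\<S> (x * y) = \<S> y * \<S> (x :: 'a::hopf_algebra)"
proof -
  let ?m = "\<lambda>t. sweedler t (*) :: 'a"
  let ?s = "\<lambda>t. sweedler t (\<lambda>x y. \<S> y * \<S> x) :: 'a"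
  have s: "clinear ?s" "clinear (\<lambda>t. \<S> (?m t))" by (simp_all add: lin)
  have "convolution (\<lambda>t. \<S> (?m t)) ?m = unit_counit"
  proof
    fix t :: "'a \<otimes> 'a"
    have "convolution (\<lambda>t. \<S> (?m t)) ?m t = convolution \<S> (\<lambda>x. x) (?m t)"
      by (rule convolution_pullback[OF coalgebra_map_mult, symmetric]) (simp_all add: lin)
    also have "\<dots> = unit_counit (?m t)"
      by (simp add: convolution_def antipode_left unit_counit_def)
    finally show "convolution (\<lambda>t. \<S> (?m t)) ?m t = unit_counit t"
      by (simp add: unit_counit_pullback[OF coalgebra_map_mult])
  qed
  moreover have "convolution ?m ?s = unit_counit"
  proof
    fix t :: "'a \<otimes> 'a"
    show "convolution ?m ?s t = unit_counit t"
    proof (rule clinear_tensor_ext[where f = "convolution ?m ?s" and g = unit_counit])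
      fix x y :: 'a
      have "convolution ?m ?s (x \<otimes> y) =
          sweedler (\<Delta> x) (\<lambda>x1 x2. sweedler (\<Delta> y) (\<lambda>y1 y2. (x1 * y1) * (\<S> y2 * \<S> x2)))"
        by (simp add: convolution_tensor sweedler_tensor lin)
      also have "\<dots> = sweedler (\<Delta> x) (\<lambda>x1 x2. x1 * sweedler (\<Delta> y) (\<lambda>y1 y2. y1 * \<S> y2) * \<S> x2)"
        by (simp add: sweedler_mult_left sweedler_mult_right mult.assoc)
      also have "\<dots> = \<epsilon> y *\<^sub>C sweedler (\<Delta> x) (\<lambda>x1 x2. x1 * \<S> x2)"
        by (simp add: antipode_right mult_scaleC_left mult_scaleC_right scaleC_scaleC mult.commute
              flip: sweedler_scaleC)
      finally show "convolution ?m ?s (x \<otimes> y) = unit_counit (x \<otimes> y)"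
        by (simp add: antipode_right unit_counit_def counit_tensor_pure scaleC_scaleC mult.commute)
    qed (intro lin s)+
  qed
  ultimately have "(\<lambda>t. \<S> (?m t)) = ?s"
    using convolution_inverse_unique[of "?m" "\<lambda>t. \<S> (?m t)" "?s"] by (simp add: lin)
  from fun_cong[OF this, of "x \<otimes> y"] show ?thesis
    by (simp add: sweedler_tensor lin)
qed

text \<open>The comultiplication followed by the antipode in both factors, and the antipode followed
  by the comultiplication, are both inverse to \<open>\<Delta>\<close> under convolution. In general
  the antipode reverses the coproduct; cocommutativity enters through
  \<open>sweedler_interchange\<close>.\<close>

lemma coalgebra_map_antipode:
  "coalgebra_map (\<S> :: 'h \<Rightarrow> 'h::{hopf_algebra, cocommutative_coalgebra})"
proof -
  let ?s = "\<lambda>x::'h. sweedler (\<Delta> x) (\<lambda>a b. \<S> a \<otimes> \<S> b)"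
  have "convolution (\<lambda>x. \<Delta> (\<S> x)) \<Delta> = (unit_counit :: 'h \<Rightarrow> _)"
  proof
    fix x :: 'h
    have "convolution (\<lambda>x. \<Delta> (\<S> x)) \<Delta> x = \<Delta> (convolution \<S> (\<lambda>x. x) x)"
      by (rule convolution_pushforward[symmetric]) (simp_all add: lin comult_mult)
    then show "convolution (\<lambda>x. \<Delta> (\<S> x)) \<Delta> x = unit_counit x"
      by (simp add: convolution_def antipode_left unit_counit_def comult_scaleC comult_one)
  qed
  moreover have "convolution \<Delta> ?s = (unit_counit :: 'h \<Rightarrow> _)"
  proof
    fix x :: 'h
    have "convolution \<Delta> ?s x = sweedler (\<Delta> x) (\<lambda>x1 x2. sweedler (\<Delta> x1) (\<lambda>a b.
        sweedler (\<Delta> x2) (\<lambda>c d. (a * \<S> c) \<otimes> (b * \<S> d))))"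
      by (simp add: convolution_def times_tensor_def sweedler_sweedler sweedler_tensor lin)
    also have "\<dots> = sweedler (\<Delta> x) (\<lambda>x1 x2. sweedler (\<Delta> x1) (\<lambda>a c.
        sweedler (\<Delta> x2) (\<lambda>b d. (a * \<S> c) \<otimes> (b * \<S> d))))"
      by (rule sweedler_interchange) (simp_all add: lin)
    also have "\<dots> = sweedler (\<Delta> x) (\<lambda>x1 x2. sweedler (\<Delta> x1) (\<lambda>a c. a * \<S> c) \<otimes>
        sweedler (\<Delta> x2) (\<lambda>b d. b * \<S> d))"
      by (simp only: sweedler_tensor_left, simp only: sweedler_tensor_right)
    also have "\<dots> = sweedler (\<Delta> x) (\<lambda>x1 x2. \<epsilon> x1 *\<^sub>C \<epsilon> x2 *\<^sub>C 1)"
      by (simp add: antipode_right tensor_scaleC_left tensor_scaleC_right one_tensor_def mult.commute)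
    also have "\<dots> = unit_counit x"
      unfolding unit_counit_def by (rule sweedler_counit_left) (simp add: lin)
    finally show "convolution \<Delta> ?s x = unit_counit x" .
  qed
  ultimately have "(\<lambda>x. \<Delta> (\<S> x)) = ?s"
    using convolution_inverse_unique[of "\<Delta>" "\<lambda>x. \<Delta> (\<S> x)" "?s"] by (simp add: lin)
  then show ?thesis
    by (simp add: coalgebra_map_def lin counit_antipode fun_eq_iff)
qed

text \<open>The squared antipode and the identity are both inverse to \<open>\<S>\<close>. For the
  former this is the antipode axiom at the point \<open>\<S>\<close>, which is a coalgebra map by
  cocommutativity.\<close>

lemma antipode_antipode: "\<S> (\<S> x) = (x :: 'h::{hopf_algebra, cocommutative_coalgebra})"
proof -
  have "convolution (\<lambda>x. \<S> (\<S> x)) \<S> = (unit_counit :: 'h \<Rightarrow> _)"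
  proof
    fix x :: 'h
    have "convolution (\<lambda>x. \<S> (\<S> x)) \<S> x = convolution \<S> (\<lambda>x. x) (\<S> x)"
      by (rule convolution_pullback[OF coalgebra_map_antipode, symmetric]) (simp_all add: lin)
    then show "convolution (\<lambda>x. \<S> (\<S> x)) \<S> x = unit_counit x"
      by (simp add: convolution_def antipode_left unit_counit_def counit_antipode)
  qed
  moreover have "convolution \<S> (\<lambda>x. x) = (unit_counit :: 'h \<Rightarrow> _)"
    by (simp add: fun_eq_iff convolution_def antipode_left unit_counit_def)
  ultimately have "(\<lambda>x. \<S> (\<S> x)) = (\<lambda>x::'h. x)"
    using convolution_inverse_unique[of "\<S>" "\<lambda>x. \<S> (\<S> x)" "\<lambda>x. x"] by (simp add: lin)
  then show ?thesis by (rule fun_cong)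
qed

lemma inv_antipode: "inv \<S> = (\<S> :: 'h \<Rightarrow> 'h::{hopf_algebra, cocommutative_coalgebra})"
  by (rule inv_equality) (simp_all add: antipode_antipode)

lemma sweedler_antipode_antipode:
  fixes x :: "'h::{hopf_algebra, cocommutative_coalgebra}"
  assumes "\<And>b. clinear (\<lambda>a. f a b)" "\<And>a. clinear (f a)"
  shows "sweedler (\<Delta> (\<S> x)) f = sweedler (\<Delta> x) (\<lambda>a b. f (\<S> a) (\<S> b))"
  by (rule coalgebra_map_sweedler[OF coalgebra_map_antipode]) (simp_all add: assms)

section \<open>Involutions, their compatibility with counit and antipode, and their extension to
  tensors\<close>

lemma star_zero: "(0 :: 'a::star_hopf_algebra)\<^sup>\<star> = 0"
  using star_scaleC[of 0 "0::'a"] by simp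

lemma star_one: "(1 :: 'a::star_hopf_algebra)\<^sup>\<star> = 1"
  using star_mult[of "1::'a" "1\<^sup>\<star>"] by (simp add: star_star)

lemma star_sweedler: "(sweedler t f)\<^sup>\<star> = sweedler t (\<lambda>a b. (f a b)\<^sup>\<star>)"
  by (rule sweedler_additive) (simp_all add: star_add star_zero)

text \<open>The two conjugations cancel. Starred conditions are brought into this shape so that the
  machinery for linear maps applies to them.\<close>

lemma clinear_star_star: "clinear f \<Longrightarrow> clinear (\<lambda>x. (f (x\<^sup>\<star>))\<^sup>\<star>)"
  by (rule clinearI) (simp_all add: star_add star_scaleC clinear_add clinear_scaleC)

lemma sweedler_comult_star:
  assumes "\<And>b. clinear (\<lambda>a. f a b)" "\<And>a. clinear (f a)"
  shows "sweedler (\<Delta> (x\<^sup>\<star>)) f = sweedler (\<Delta> x) (\<lambda>a b. f (a\<^sup>\<star>) (b\<^sup>\<star>))"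
  by (simp add: comult_star sweedler_sweedler sweedler_tensor assms)

text \<open>Since the involution is comultiplicative, the conjugated functional \<open>?e\<close> is
  again a counit on the left, and a left counit agrees with the right one.\<close>

lemma counit_star: "\<epsilon> (x\<^sup>\<star>) = cnj (\<epsilon> (x :: 'a::star_hopf_algebra))"
proof -
  let ?e = "\<lambda>x::'a. cnj (\<epsilon> (x\<^sup>\<star>))"
  have e: "clinear ?e"
    by (rule clinearI) (simp_all add: star_add star_scaleC counit_add counit_scaleC scaleC_complex_def)
  have "x = (sweedler (\<Delta> (x\<^sup>\<star>)) (\<lambda>a b. \<epsilon> a *\<^sub>C b))\<^sup>\<star>"
    by (simp add: counit_left star_star)
  also have "\<dots> = sweedler (\<Delta> x) (\<lambda>a b. ?e a *\<^sub>C b)"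
    by (subst sweedler_comult_star) (simp_all add: lin star_sweedler star_scaleC star_star)
  finally have "\<epsilon> x = \<epsilon> (sweedler (\<Delta> x) (\<lambda>a b. ?e a *\<^sub>C b))" by simp
  also have "\<dots> = sweedler (\<Delta> x) (\<lambda>a b. \<epsilon> b *\<^sub>C ?e a)"
    by (simp add: clinear_sweedler[OF clinear_counit] counit_scaleC scaleC_complex_def mult.commute)
  also have "\<dots> = ?e x" by (rule sweedler_counit_right[OF e])
  finally show ?thesis by simp
qed

text \<open>Conjugating \<open>\<S>\<close> by the involution yields another convolution inverse of
  the identity: the involution reverses products, and cocommutativity reverses them back. Without
  cocommutativity the inverse antipode would appear on one side.\<close>

lemma antipode_star: "\<S> (x\<^sup>\<star>) = (\<S> (x :: 'h::{star_hopf_algebra, cocommutative_coalgebra}))\<^sup>\<star>"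
proof -
  let ?T = "\<lambda>x::'h. (\<S> (x\<^sup>\<star>))\<^sup>\<star>"
  have "convolution ?T (\<lambda>x. x) = unit_counit"
  proof
    fix x :: 'h
    have "convolution ?T (\<lambda>x. x) x = (sweedler (\<Delta> (x\<^sup>\<star>)) (\<lambda>a b. b * \<S> a))\<^sup>\<star>"
      by (subst sweedler_comult_star)
        (simp_all add: lin star_sweedler star_mult star_star convolution_def)
    also have "sweedler (\<Delta> (x\<^sup>\<star>)) (\<lambda>a b. b * \<S> a) = sweedler (\<Delta> (x\<^sup>\<star>)) (\<lambda>a b. a * \<S> b)"
      by (rule sweedler_cocommute) (simp_all add: lin)
    finally show "convolution ?T (\<lambda>x. x) x = unit_counit x"
      by (simp add: antipode_right star_scaleC star_one counit_star unit_counit_def)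
  qed
  moreover have "convolution (\<lambda>x. x) \<S> = (unit_counit :: 'h \<Rightarrow> _)"
    by (simp add: fun_eq_iff convolution_def antipode_right unit_counit_def)
  ultimately have "?T = \<S>"
    using convolution_inverse_unique[of "\<lambda>x. x" "?T" "\<S>"] clinear_star_star[OF clinear_antipode] by (simp add: lin)
  from fun_cong[OF this, of x] show ?thesis by (metis star_star)
qed

definition tensor_star :: "'a::star_hopf_algebra \<otimes> 'b::star_hopf_algebra \<Rightarrow> 'a \<otimes> 'b"
  where "tensor_star t = sweedler t (\<lambda>a b. a\<^sup>\<star> \<otimes> b\<^sup>\<star>)"

lemma balanced_tensor_star:
  "balanced (\<lambda>a b. (a::'a::star_hopf_algebra)\<^sup>\<star> \<otimes> (b::'b::star_hopf_algebra)\<^sup>\<star>)"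
  by (rule balancedI)
    (simp_all add: star_add star_scaleC tensor_add_left tensor_add_right tensor_scaleC_left
      tensor_scaleC_right)

lemma tensor_star_pure: "tensor_star (a \<otimes> b) = a\<^sup>\<star> \<otimes> b\<^sup>\<star>"
  unfolding tensor_star_def by (rule sweedler_pure[OF balanced_tensor_star])

lemma tensor_star_add: "tensor_star (s + t) = tensor_star s + tensor_star t"
  unfolding tensor_star_def by (rule sweedler_add[OF balanced_tensor_star])

lemma tensor_star_scaleC: "tensor_star (c *\<^sub>C t) = cnj c *\<^sub>C tensor_star t"
proof (induction t rule: tensor_induct)
  case (pure a b)
  show ?case
    by (simp add: tensor_star_pure star_scaleC flip: tensor_scaleC_left)
qed (simp add: tensor_star_add cvs.scale_right_distrib)

lemma tensor_star_tensor_star: "tensor_star (tensor_star t) = t"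
  by (induction t rule: tensor_induct) (simp_all add: tensor_star_pure star_star tensor_star_add)

lemma tensor_star_sweedler: "tensor_star (sweedler t f) = sweedler t (\<lambda>a b. tensor_star (f a b))"
  by (rule sweedler_additive)
    (use tensor_star_scaleC[of 0 0] in \<open>simp_all add: tensor_star_add\<close>)

lemma clinear_tensor_star: "clinear f \<Longrightarrow> clinear (\<lambda>x. tensor_star (f (x\<^sup>\<star>)))"
  by (rule clinearI)
    (simp_all add: star_add star_scaleC tensor_star_add tensor_star_scaleC clinear_add clinear_scaleC)

lemma sweedler_tensor_star:
  assumes "\<And>b. clinear (\<lambda>a. f a b)" "\<And>a. clinear (f a)"
  shows "sweedler (tensor_star t) f = sweedler t (\<lambda>a b. f (a\<^sup>\<star>) (b\<^sup>\<star>))"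
  by (simp add: tensor_star_def sweedler_sweedler sweedler_tensor assms)

lemma coalgebra_map_linear: "coalgebra_map p \<Longrightarrow> clinear p"
  by (simp add: coalgebra_map_def)

lemma coalgebra_map_counit: "coalgebra_map p \<Longrightarrow> \<epsilon> (p x) = \<epsilon> x"
  by (simp add: coalgebra_map_def)

section \<open>Module algebras\<close>

text \<open>Three actions of H are instances: the given one on A, and \<open>theta\<close> and
  \<open>act_right\<close> on A \<otimes> A.\<close>

locale module_algebra =
  fixes op :: "'h::{hopf_algebra, cocommutative_coalgebra} \<Rightarrow> 'r::complex_algebra_1 \<Rightarrow> 'r"
  assumes clinear_op_left: "clinear (\<lambda>x. op x r)"
    and clinear_op_right: "clinear (op x)"
    and op_mult: "op x (r * s) = sweedler (\<Delta> x) (\<lambda>a b. op a r * op b s)"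
    and op_unit: "op x 1 = \<epsilon> x *\<^sub>C 1"
    and one_op: "op 1 r = r"
    and op_op: "op x (op y r) = op (x * y) r"
begin

lemmas clinear_op [lin] = clinear_op_left clinear_op_right
  clinear_compose[OF clinear_op_left] clinear_compose[OF clinear_op_right]

text \<open>The action of the point \<open>q\<close> on the convolution algebra; at a group-like x
  it is \<open>op (q x) (f x)\<close>.\<close>

definition twist :: "('c::coalgebra \<Rightarrow> 'h) \<Rightarrow> ('c \<Rightarrow> 'r) \<Rightarrow> 'c \<Rightarrow> 'r"
  where "twist q f x = sweedler (\<Delta> x) (\<lambda>a b. op (q a) (f b))"

lemma clinear_twist [lin]: "clinear q \<Longrightarrow> clinear f \<Longrightarrow> clinear (twist q f)"
  unfolding twist_def by (simp add: lin)

lemma twist_pullback: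
  assumes p: "coalgebra_map p" and [lin]: "clinear q" "clinear f"
  shows "twist q f (p x) = twist (\<lambda>x. q (p x)) (\<lambda>x. f (p x)) x"
  unfolding twist_def
  by (rule coalgebra_map_sweedler[OF p])
    (simp_all add: lin clinear_compose[OF clinear_op_left] clinear_compose[OF clinear_op_right])

text \<open>Points act by algebra maps. The coproduct split by \<open>op_mult\<close> and the one
  split by the convolution have to be matched crosswise, which is where cocommutativity of the
  domain is used.\<close>

lemma twist_convolution:
  fixes f g :: "'c::{coalgebra, cocommutative_coalgebra} \<Rightarrow> 'r"
  assumes q: "coalgebra_map q" and [lin]: "clinear f" "clinear g"
  shows "twist q (convolution f g) = convolution (twist q f) (twist q g)"
proof
  fix x
  have [lin]: "clinear q" using q by (rule coalgebra_map_linear)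
  have "twist q (convolution f g) x = sweedler (\<Delta> x) (\<lambda>x1 x2.
      sweedler (\<Delta> x2) (\<lambda>c d. sweedler (\<Delta> x1) (\<lambda>a b. op (q a) (f c) * op (q b) (g d))))"
    by (simp add: twist_def convolution_def clinear_sweedler[OF clinear_op_right] op_mult
        coalgebra_map_sweedler[OF q] lin)
  also have "\<dots> = sweedler (\<Delta> x) (\<lambda>x1 x2.
      sweedler (\<Delta> x1) (\<lambda>a b. sweedler (\<Delta> x2) (\<lambda>c d. op (q a) (f c) * op (q b) (g d))))"
    by (subst (2) sweedler_swap) (rule refl)
  also have "\<dots> = sweedler (\<Delta> x) (\<lambda>x1 x2.
      sweedler (\<Delta> x1) (\<lambda>a c. sweedler (\<Delta> x2) (\<lambda>b d. op (q a) (f c) * op (q b) (g d))))"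
    by (rule sweedler_interchange) (simp_all add: lin)
  also have "\<dots> = convolution (twist q f) (twist q g) x"
    by (simp only: convolution_def twist_def sweedler_mult_left, simp only: sweedler_mult_right)
  finally show "twist q (convolution f g) x = convolution (twist q f) (twist q g) x" .
qed

lemma twist_unit:
  assumes q: "coalgebra_map q"
  shows "twist q unit_counit = unit_counit"
proof
  fix x
  have "twist q unit_counit x = sweedler (\<Delta> x) (\<lambda>a b. \<epsilon> a *\<^sub>C unit_counit b)"
    using q by (simp add: twist_def unit_counit_def clinear_scaleC[OF clinear_op_right] op_unit
        coalgebra_map_def scaleC_scaleC mult.commute)
  then show "twist q unit_counit x = unit_counit x"
    by (simp add: sweedler_counit_left lin)
qed

lemma twist_inverse:
  fixes f g :: "'c::{coalgebra, cocommutative_coalgebra} \<Rightarrow> 'r"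
  assumes "coalgebra_map q" "clinear f" "clinear g" "convolution f g = unit_counit"
  shows "convolution (twist q f) (twist q g) = unit_counit"
  using assms by (simp flip: twist_convolution add: twist_unit)

text \<open>The antipode inverts the point \<open>q\<close>, so the action of \<open>q\<close> can
  be undone; hence \<open>twist q\<close> may be cancelled from an equation.\<close>

lemma twist_antipode:
  assumes q: "coalgebra_map q" and [lin]: "clinear f"
  shows "twist (\<lambda>x. \<S> (q x)) (twist q f) = f"
proof
  fix x
  have [lin]: "clinear q" using q by (rule coalgebra_map_linear)
  have [lin]: "clinear (\<lambda>x. \<S> (q x))" by (simp add: lin)
  have "twist (\<lambda>x. \<S> (q x)) (twist q f) x =
      sweedler (\<Delta> x) (\<lambda>a y. sweedler (\<Delta> y) (\<lambda>b c. op (\<S> (q a) * q b) (f c)))"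
    by (simp add: twist_def clinear_sweedler[OF clinear_op_right] op_op)
  also have "\<dots> = sweedler (\<Delta> x) (\<lambda>y c. sweedler (\<Delta> y) (\<lambda>a b. op (\<S> (q a) * q b) (f c)))"
    by (rule sweedler_coassoc[symmetric]) (simp_all add: lin)
  also have "\<dots> = sweedler (\<Delta> x) (\<lambda>y c. op (sweedler (\<Delta> (q y)) (\<lambda>a b. \<S> a * b)) (f c))"
    by (simp add: coalgebra_map_sweedler[OF q] clinear_sweedler[OF clinear_op_left] lin)
  also have "\<dots> = sweedler (\<Delta> x) (\<lambda>y c. \<epsilon> y *\<^sub>C f c)"
    by (simp add: antipode_left clinear_scaleC[OF clinear_op_left] one_op coalgebra_map_counit[OF q])
  finally show "twist (\<lambda>x. \<S> (q x)) (twist q f) x = f x"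
    by (simp add: sweedler_counit_left lin)
qed

lemma twist_inject:
  assumes "coalgebra_map q" "clinear f" "clinear g"
  shows "twist q f = twist q g \<longleftrightarrow> f = g"
  using twist_antipode[OF assms(1,2)] twist_antipode[OF assms(1,3)] by metis

end

section \<open>Morphisms of coalgebras\<close>

lemma coalgebra_map_ident: "coalgebra_map (\<lambda>x. x)"
  by (simp add: coalgebra_map_def lin sweedler_tensor_ident)

lemma coalgebra_map_compose:
  assumes p: "coalgebra_map p" and q: "coalgebra_map q"
  shows "coalgebra_map (\<lambda>x. p (q x))"
proof -
  note [lin] = coalgebra_map_linear[OF p] clinear_compose[OF coalgebra_map_linear[OF p]]
  show ?thesis
    using p q clinear_compose[OF coalgebra_map_linear[OF p] coalgebra_map_linear[OF q]]
    by (simp add: coalgebra_map_def sweedler_sweedler sweedler_tensor lin)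
qed

text \<open>The projections form the generic pair of points (u, v): an identity of convolution type
  at this pair is the identity for two independent elements.\<close>

definition tensor_fst :: "'c::coalgebra \<otimes> 'd::coalgebra \<Rightarrow> 'c"
  where "tensor_fst t = sweedler t (\<lambda>x y. \<epsilon> y *\<^sub>C x)"

definition tensor_snd :: "'c::coalgebra \<otimes> 'd::coalgebra \<Rightarrow> 'd"
  where "tensor_snd t = sweedler t (\<lambda>x y. \<epsilon> x *\<^sub>C y)"

lemma tensor_fst_pure: "tensor_fst (x \<otimes> y) = \<epsilon> y *\<^sub>C x"
  by (simp add: tensor_fst_def sweedler_tensor lin)

lemma tensor_snd_pure: "tensor_snd (x \<otimes> y) = \<epsilon> x *\<^sub>C y"
  by (simp add: tensor_snd_def sweedler_tensor lin)

lemma coalgebra_map_fst: "coalgebra_map (tensor_fst :: 'c::coalgebra \<otimes> 'd::coalgebra \<Rightarrow> 'c)"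
proof -
  have [lin]: "clinear (tensor_fst :: 'c \<otimes> 'd \<Rightarrow> 'c)"
    unfolding tensor_fst_def by (simp add: lin)
  have "\<Delta> (tensor_fst t) = sweedler (\<Delta> t) (\<lambda>a b. tensor_fst a \<otimes> tensor_fst b)" for t :: "'c \<otimes> 'd"
  proof (rule clinear_tensor_ext[where f = "\<lambda>t. \<Delta> (tensor_fst t)"
        and g = "\<lambda>t. sweedler (\<Delta> t) (\<lambda>a b. tensor_fst a \<otimes> tensor_fst b)"])
    fix x :: 'c and y :: 'd
    have "sweedler (\<Delta> (x \<otimes> y)) (\<lambda>a b. tensor_fst a \<otimes> tensor_fst b) =
        sweedler (\<Delta> x) (\<lambda>x1 x2. sweedler (\<Delta> y) (\<lambda>y1 y2. \<epsilon> y1 *\<^sub>C \<epsilon> y2 *\<^sub>C (x1 \<otimes> x2)))"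
      by (subst sweedler_comult_tensor_pure)
        (simp_all add: balanced_bilinear tensor_fst_pure lin tensor_scaleC_left tensor_scaleC_right mult.commute)
    also have "\<dots> = sweedler (\<Delta> x) (\<lambda>x1 x2. \<epsilon> y *\<^sub>C (x1 \<otimes> x2))"
      by (subst sweedler_counit_left) (simp_all add: lin clinear_compose[OF clinear_comult])
    also have "\<dots> = \<epsilon> y *\<^sub>C \<Delta> x"
      by (simp add: sweedler_tensor_ident flip: sweedler_scaleC)
    finally show "\<Delta> (tensor_fst (x \<otimes> y)) = sweedler (\<Delta> (x \<otimes> y)) (\<lambda>a b. tensor_fst a \<otimes> tensor_fst b)"
      by (simp add: tensor_fst_pure lin comult_scaleC)
  qed (simp_all add: lin clinear_compose[OF clinear_comult])
  moreover have "\<epsilon> (tensor_fst t) = \<epsilon> t" for t :: "'c \<otimes> 'd"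
    by (rule clinear_tensor_ext[where f = "\<lambda>t. \<epsilon> (tensor_fst t)" and g = \<epsilon>])
      (simp_all add: tensor_fst_pure lin counit_tensor_pure counit_scaleC)
  ultimately show ?thesis by (simp add: coalgebra_map_def lin)
qed

lemma coalgebra_map_snd: "coalgebra_map (tensor_snd :: 'c::coalgebra \<otimes> 'd::coalgebra \<Rightarrow> 'd)"
proof -
  have [lin]: "clinear (tensor_snd :: 'c \<otimes> 'd \<Rightarrow> 'd)"
    unfolding tensor_snd_def by (simp add: lin)
  have "\<Delta> (tensor_snd t) = sweedler (\<Delta> t) (\<lambda>a b. tensor_snd a \<otimes> tensor_snd b)" for t :: "'c \<otimes> 'd"
  proof (rule clinear_tensor_ext[where f = "\<lambda>t. \<Delta> (tensor_snd t)"
        and g = "\<lambda>t. sweedler (\<Delta> t) (\<lambda>a b. tensor_snd a \<otimes> tensor_snd b)"])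
    fix x :: 'c and y :: 'd
    have "sweedler (\<Delta> (x \<otimes> y)) (\<lambda>a b. tensor_snd a \<otimes> tensor_snd b) =
        sweedler (\<Delta> x) (\<lambda>x1 x2. \<epsilon> x1 *\<^sub>C \<epsilon> x2 *\<^sub>C sweedler (\<Delta> y) (\<lambda>y1 y2. (y1 \<otimes> y2)))"
      by (subst sweedler_comult_tensor_pure)
        (simp_all add: balanced_bilinear tensor_snd_pure lin tensor_scaleC_left tensor_scaleC_right
          mult.commute sweedler_scaleC)
    also have "\<dots> = \<epsilon> x *\<^sub>C \<Delta> y"
      unfolding sweedler_tensor_ident by (rule sweedler_counit_left) (simp add: lin)
    finally show "\<Delta> (tensor_snd (x \<otimes> y)) = sweedler (\<Delta> (x \<otimes> y)) (\<lambda>a b. tensor_snd a \<otimes> tensor_snd b)"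
      by (simp add: tensor_snd_pure lin comult_scaleC)
  qed (simp_all add: lin clinear_compose[OF clinear_comult])
  moreover have "\<epsilon> (tensor_snd t) = \<epsilon> t" for t :: "'c \<otimes> 'd"
    by (rule clinear_tensor_ext[where f = "\<lambda>t. \<epsilon> (tensor_snd t)" and g = \<epsilon>])
      (simp_all add: tensor_snd_pure lin counit_tensor_pure counit_scaleC)
  ultimately show ?thesis by (simp add: coalgebra_map_def lin)
qed

text \<open>The pair (q, r) as a single point of the tensor product; applying chi to it gives chi(q,
  r) as a map on the common domain.\<close>

definition tensor_pair ::
    "('c::coalgebra \<Rightarrow> 'd::coalgebra) \<Rightarrow> ('c \<Rightarrow> 'e::coalgebra) \<Rightarrow> 'c \<Rightarrow> 'd \<otimes> 'e"
  where "tensor_pair q r x = sweedler (\<Delta> x) (\<lambda>a b. q a \<otimes> r b)"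

lemma sweedler_tensor_pair:
  assumes "\<And>b. clinear (\<lambda>a. f a b)" "\<And>a. clinear (f a)"
  shows "sweedler (tensor_pair q r x) f = sweedler (\<Delta> x) (\<lambda>a b. f (q a) (r b))"
  by (simp add: tensor_pair_def sweedler_sweedler sweedler_tensor assms)

lemma clinear_tensor_pair_apply:
  "clinear f \<Longrightarrow> f (tensor_pair q r x) = sweedler (\<Delta> x) (\<lambda>a b. f (q a \<otimes> r b))"
  by (simp add: tensor_pair_def clinear_sweedler)

text \<open>The map is q \<otimes> r after the comultiplication, and the latter is a coalgebra map
  because the domain is cocommutative.\<close>

lemma coalgebra_map_pair:
  fixes q :: "'c::{coalgebra, cocommutative_coalgebra} \<Rightarrow> 'd::coalgebra"
    and r :: "'c \<Rightarrow> 'e::coalgebra"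
  assumes q: "coalgebra_map q" and r: "coalgebra_map r"
  shows "coalgebra_map (tensor_pair q r)"
proof -
  note [lin] = coalgebra_map_linear[OF q] coalgebra_map_linear[OF r]
  have "\<Delta> (tensor_pair q r x) =
      sweedler (\<Delta> x) (\<lambda>a b. tensor_pair q r a \<otimes> tensor_pair q r b)" for x
  proof -
    have "\<Delta> (tensor_pair q r x) = sweedler (\<Delta> x) (\<lambda>x1 x2. sweedler (\<Delta> x1) (\<lambda>a b.
        sweedler (\<Delta> x2) (\<lambda>c d. (q a \<otimes> r c) \<otimes> (q b \<otimes> r d))))"
      by (simp add: clinear_tensor_pair_apply lin comult_tensor_pure coalgebra_map_sweedler[OF q]
          coalgebra_map_sweedler[OF r])
    also have "\<dots> = sweedler (\<Delta> x) (\<lambda>x1 x2. sweedler (\<Delta> x1) (\<lambda>a c.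
        sweedler (\<Delta> x2) (\<lambda>b d. (q a \<otimes> r c) \<otimes> (q b \<otimes> r d))))"
      by (rule sweedler_interchange) (simp_all add: lin)
    also have "\<dots> = sweedler (\<Delta> x) (\<lambda>a b. tensor_pair q r a \<otimes> tensor_pair q r b)"
      unfolding tensor_pair_def
      by (simp only: sweedler_tensor_left, simp only: sweedler_tensor_right)
    finally show ?thesis .
  qed
  moreover have "\<epsilon> (tensor_pair q r x) = \<epsilon> x" for x
    using sweedler_counit_left[OF clinear_counit, of x]
    by (simp add: clinear_tensor_pair_apply lin counit_tensor_pure coalgebra_map_counit[OF q]
        coalgebra_map_counit[OF r] scaleC_complex_def)
  moreover have "clinear (tensor_pair q r)"
    unfolding tensor_pair_def by (simp add: lin)
  ultimately show ?thesis by (simp add: coalgebra_map_def)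
qed

text \<open>The generic pair is the identity point, so chi(u, v) is just chi.\<close>

lemma tensor_pair_fst_snd: "tensor_pair tensor_fst tensor_snd t = t"
proof (rule clinear_tensor_ext[where f = "tensor_pair tensor_fst tensor_snd" and g = "\<lambda>t. t"])
  note [lin] = coalgebra_map_linear[OF coalgebra_map_fst] coalgebra_map_linear[OF coalgebra_map_snd]
  show "clinear (tensor_pair tensor_fst tensor_snd)"
    unfolding tensor_pair_def by (simp add: lin)
  fix x :: 'a and y :: 'b
  have "tensor_pair tensor_fst tensor_snd (x \<otimes> y) = sweedler (\<Delta> x) (\<lambda>x1 x2. \<epsilon> x2 *\<^sub>C
      sweedler (\<Delta> y) (\<lambda>y1 y2. \<epsilon> y1 *\<^sub>C (x1 \<otimes> y2)))"
    unfolding tensor_pair_def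
    by (subst sweedler_comult_tensor_pure)
      (simp_all add: balanced_bilinear lin tensor_fst_pure tensor_snd_pure tensor_scaleC_left
        tensor_scaleC_right sweedler_scaleC mult.commute)
  also have "\<dots> = x \<otimes> y"
    by (simp add: sweedler_counit_left sweedler_counit_right lin)
  finally show "tensor_pair tensor_fst tensor_snd (x \<otimes> y) = x \<otimes> y" .
qed (simp_all add: lin)

lemma tensor_pair_compose:
  assumes "coalgebra_map p" "clinear q" "clinear r"
  shows "tensor_pair q r (p x) = tensor_pair (\<lambda>x. q (p x)) (\<lambda>x. r (p x)) x"
  unfolding tensor_pair_def by (rule coalgebra_map_sweedler) (simp_all add: assms lin)

lemma convolution_eq_mult_pair: "convolution q r x = sweedler (tensor_pair q r x) (*)"
  by (simp add: sweedler_tensor_pair lin convolution_def)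

lemma convolution_fst_snd:
  "convolution tensor_fst tensor_snd = (\<lambda>t. sweedler t (*) :: 'a::bialgebra)"
  by (simp add: fun_eq_iff convolution_eq_mult_pair tensor_pair_fst_snd)

lemma convolution_antipode_right:
  fixes q :: "'c::coalgebra \<Rightarrow> 'd::hopf_algebra"
  assumes "coalgebra_map q"
  shows "convolution q (\<lambda>x. \<S> (q x)) = unit_counit"
proof
  fix x
  have "convolution q (\<lambda>x. \<S> (q x)) x = convolution (\<lambda>x. x) \<S> (q x)"
    by (rule convolution_pullback[OF assms, symmetric]) (simp_all add: lin)
  also have "\<dots> = unit_counit (q x)"
    by (simp add: convolution_def antipode_right unit_counit_def)
  finally show "convolution q (\<lambda>x. \<S> (q x)) x = unit_counit x"
    by (simp add: unit_counit_pullback[OF assms])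
qed

lemma convolution_antipode_left:
  fixes q :: "'c::coalgebra \<Rightarrow> 'd::hopf_algebra"
  assumes "coalgebra_map q"
  shows "convolution (\<lambda>x. \<S> (q x)) q = unit_counit"
proof
  fix x
  have "convolution (\<lambda>x. \<S> (q x)) q x = convolution \<S> (\<lambda>x. x) (q x)"
    by (rule convolution_pullback[OF assms, symmetric]) (simp_all add: lin)
  also have "\<dots> = unit_counit (q x)"
    by (simp add: convolution_def antipode_left unit_counit_def)
  finally show "convolution (\<lambda>x. \<S> (q x)) q x = unit_counit x"
    by (simp add: unit_counit_pullback[OF assms])
qed

lemma antipode_convolution:
  fixes q r :: "'c::{coalgebra, cocommutative_coalgebra} \<Rightarrow> 'd::hopf_algebra"
  assumes "clinear q" "clinear r"
  shows "\<S> (convolution q r x) = convolution (\<lambda>x. \<S> (r x)) (\<lambda>x. \<S> (q x)) x"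
proof -
  have "\<S> (convolution q r x) = sweedler (\<Delta> x) (\<lambda>a b. \<S> (r b) * \<S> (q a))"
    by (simp add: convolution_def clinear_sweedler[OF clinear_antipode] antipode_mult)
  also have "\<dots> = convolution (\<lambda>x. \<S> (r x)) (\<lambda>x. \<S> (q x)) x"
    unfolding convolution_def by (rule sweedler_cocommute) (simp_all add: assms lin)
  finally show ?thesis .
qed

section \<open>The cocycle and its diagonal\<close>

context cocycle_singer_pair
begin

section \<open>Linearity of the structure maps, and the inverses of chi and psi\<close>

lemma clinear_act_left: "clinear (\<lambda>x. x \<rhd> a)"
  and clinear_act_right: "clinear ((\<rhd>) x)"
  using cbilinear_act by (simp_all add: cbilinear_def)

lemmas clinear_structure [lin] =
  clinear_act_left clinear_compose[OF clinear_act_left]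
  clinear_act_right clinear_compose[OF clinear_act_right]
  clinear_rho clinear_compose[OF clinear_rho]
  clinear_psi clinear_compose[OF clinear_psi]
  clinear_chi clinear_compose[OF clinear_chi]

sublocale act: module_algebra "(\<rhd>)"
  by (rule module_algebra.intro)
    (simp_all add: lin act_mult coprod2_def act_one one_act act_act)

lemma chi_inverse: "is_convolution_inverse \<chi> (convolution_inverse \<chi>)"
  using chi_invertible convolution_inverse_eq[OF clinear_chi]
  by (auto simp: convolution_invertible_def)

lemma psi_inverse: "is_convolution_inverse \<psi> (convolution_inverse \<psi>)"
  using psi_invertible convolution_inverse_eq[OF clinear_psi]
  by (auto simp: convolution_invertible_def)

lemma clinear_chi_inverse: "clinear (convolution_inverse \<chi>)"
  and clinear_psi_inverse: "clinear (convolution_inverse \<psi>)"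
  using chi_inverse psi_inverse by (simp_all add: is_convolution_inverse_def)

lemmas clinear_inverses [lin] =
  clinear_chi_inverse clinear_compose[OF clinear_chi_inverse]
  clinear_psi_inverse clinear_compose[OF clinear_psi_inverse]

definition delta :: "'h \<Rightarrow> 'a"
  where "delta x = \<chi> (tensor_pair (\<lambda>x. x) \<S> x)"

text \<open>The factors are in the order of \<open>delta\<close>, so that both are pulled back along
  one coalgebra map and are visibly inverse. Cocommutativity identifies this with the order used in
  the theorem, see \<open>gamma_eq\<close>.\<close>

definition gamma :: "'h \<Rightarrow> 'a"
  where "gamma x = convolution_inverse \<chi> (tensor_pair (\<lambda>x. x) \<S> x)"

lemma clinear_tensor_pair_antipode: "clinear (tensor_pair (\<lambda>x. x) (\<S> :: 'h \<Rightarrow> 'h))"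
  by (intro coalgebra_map_linear coalgebra_map_pair coalgebra_map_ident coalgebra_map_antipode)

lemma clinear_delta: "clinear delta" and clinear_gamma: "clinear gamma"
  unfolding delta_def gamma_def by (simp_all add: lin clinear_tensor_pair_antipode)

lemmas clinear_diagonal [lin] =
  clinear_delta clinear_compose[OF clinear_delta]
  clinear_gamma clinear_compose[OF clinear_gamma]

lemma convolution_chi_pullback:
  assumes "coalgebra_map p"
  shows "convolution (\<lambda>x. \<chi> (p x)) (\<lambda>x. convolution_inverse \<chi> (p x)) = unit_counit"
proof
  fix x
  have "convolution \<chi> (convolution_inverse \<chi>) (p x) = unit_counit (p x)"
    using chi_inverse by (simp add: is_convolution_inverse_iff)
  then show "convolution (\<lambda>x. \<chi> (p x)) (\<lambda>x. convolution_inverse \<chi> (p x)) x = unit_counit x"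
    by (simp add: convolution_pullback[OF assms] unit_counit_pullback[OF assms] lin)
qed

lemma convolution_delta_gamma: "convolution delta gamma = unit_counit"
  unfolding delta_def gamma_def
  by (intro convolution_chi_pullback coalgebra_map_pair coalgebra_map_ident coalgebra_map_antipode)

lemma gamma_eq: "gamma x = sweedler (\<Delta> x) (\<lambda>x1 x2. convolution_inverse \<chi> (x2 \<otimes> \<S> x1))"
proof -
  have "gamma x = sweedler (\<Delta> x) (\<lambda>x1 x2. convolution_inverse \<chi> (x1 \<otimes> \<S> x2))"
    unfolding gamma_def by (rule clinear_tensor_pair_apply) (simp add: lin)
  also have "\<dots> = sweedler (\<Delta> x) (\<lambda>x1 x2. convolution_inverse \<chi> (x2 \<otimes> \<S> x1))"
    by (rule sweedler_cocommute) (simp_all add: lin)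
  finally show ?thesis .
qed

text \<open>The group 2-cocycle identity at points p, q, r. The coproduct of a single element feeds
  all occurrences, so it is regrouped until the two occurrences of each point come from one Sweedler
  factor and the axiom applies; the right side is then reassembled in the same way.\<close>

lemma chi_cocycle_points:
  fixes p q r :: "'c::{coalgebra, cocommutative_coalgebra} \<Rightarrow> 'h"
  assumes p: "coalgebra_map p" and q: "coalgebra_map q" and r: "coalgebra_map r"
  shows "convolution (act.twist p (\<lambda>x. \<chi> (tensor_pair q r x)))
      (\<lambda>x. \<chi> (tensor_pair p (convolution q r) x)) =
    convolution (\<lambda>x. \<chi> (tensor_pair p q x)) (\<lambda>x. \<chi> (tensor_pair (convolution p q) r x))"
proof
  fix c
  note [lin] = coalgebra_map_linear[OF p] coalgebra_map_linear[OF q] coalgebra_map_linear[OF r]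
  note pqr = coalgebra_map_sweedler[OF p] coalgebra_map_sweedler[OF q] coalgebra_map_sweedler[OF r]
  let ?F = "\<lambda>a a' b b' e e'. (p a \<rhd> \<chi> (q b \<otimes> r e)) * \<chi> (p a' \<otimes> (q b' * r e'))"
  let ?K = "\<lambda>a a' b b' e. \<chi> (p a \<otimes> q b) * \<chi> ((p a' * q b') \<otimes> r e)"
  have cocycle: "sweedler (\<Delta> a) (\<lambda>a a'. sweedler (\<Delta> b) (\<lambda>b b'. sweedler (\<Delta> e) (\<lambda>e e'.
      ?F a a' b b' e e'))) = sweedler (\<Delta> a) (\<lambda>a a'. sweedler (\<Delta> b) (\<lambda>b b'. ?K a a' b b' e))"
    for a b e
    using chi_cocycle[of "p a" "q b" "r e"] by (simp add: coprod2_def pqr lin)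
  have swap: "sweedler (\<Delta> y) (\<lambda>b e. sweedler (\<Delta> x) (\<lambda>a' y'. sweedler (\<Delta> y') (\<lambda>b' e'.
      ?F a a' b b' e e'))) = sweedler (\<Delta> x) (\<lambda>a' y'. sweedler (\<Delta> y) (\<lambda>b e.
      sweedler (\<Delta> y') (\<lambda>b' e'. ?F a a' b b' e e')))" for a x y
    by (rule sweedler_swap)
  have swap': "sweedler (\<Delta> x) (\<lambda>a a'. sweedler (\<Delta> y) (\<lambda>b e. sweedler (\<Delta> b) (\<lambda>b b'.
      sweedler (\<Delta> e) (\<lambda>e e'. ?F a a' b b' e e')))) = sweedler (\<Delta> y) (\<lambda>b e. sweedler (\<Delta> x)
      (\<lambda>a a'. sweedler (\<Delta> b) (\<lambda>b b'. sweedler (\<Delta> e) (\<lambda>e e'. ?F a a' b b' e e'))))" for x y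
    by (rule sweedler_swap)
  have "convolution (act.twist p (\<lambda>x. \<chi> (tensor_pair q r x)))
      (\<lambda>x. \<chi> (tensor_pair p (convolution q r) x)) c =
    sweedler (\<Delta> c) (\<lambda>x x'. sweedler (\<Delta> x) (\<lambda>a y. sweedler (\<Delta> x') (\<lambda>a' y'.
      sweedler (\<Delta> y) (\<lambda>b e. sweedler (\<Delta> y') (\<lambda>b' e'. ?F a a' b b' e e')))))"
    by (simp only: convolution_def act.twist_def clinear_tensor_pair_apply lin sweedler_tensor_right
        clinear_sweedler[OF clinear_chi] sweedler_mult_left clinear_sweedler[OF clinear_act_right],
        simp only: sweedler_mult_right swap)
  also have "\<dots> = sweedler (\<Delta> c) (\<lambda>x x'. sweedler (\<Delta> x) (\<lambda>a a'. sweedler (\<Delta> x') (\<lambda>y y'.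
      sweedler (\<Delta> y) (\<lambda>b e. sweedler (\<Delta> y') (\<lambda>b' e'. ?F a a' b b' e e')))))"
    by (rule sweedler_interchange) (simp_all add: lin)
  also have "\<dots> = sweedler (\<Delta> c) (\<lambda>x x'. sweedler (\<Delta> x) (\<lambda>a a'. sweedler (\<Delta> x') (\<lambda>y y'.
      sweedler (\<Delta> y) (\<lambda>b b'. sweedler (\<Delta> y') (\<lambda>e e'. ?F a a' b b' e e')))))"
    by (subst (4) sweedler_interchange) (simp_all add: lin)
  \<comment> \<open>The arguments of p now come from \<open>x\<close>, those of q from
    \<open>y\<close> and those of r from \<open>y'\<close>, so the axiom can be used inside the
    sum.\<close>
  also have "\<dots> = sweedler (\<Delta> c) (\<lambda>x x'. sweedler (\<Delta> x') (\<lambda>b e. sweedler (\<Delta> x) (\<lambda>a a'.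
      sweedler (\<Delta> b) (\<lambda>b b'. ?K a a' b b' e))))"
    by (simp only: swap' cocycle)
  also have "\<dots> = sweedler (\<Delta> c) (\<lambda>y e. sweedler (\<Delta> y) (\<lambda>x x'. sweedler (\<Delta> x) (\<lambda>a a'.
      sweedler (\<Delta> x') (\<lambda>b b'. ?K a a' b b' e))))"
    by (rule sweedler_coassoc[symmetric]) (simp_all add: lin)
  also have "\<dots> = sweedler (\<Delta> c) (\<lambda>y e. sweedler (\<Delta> y) (\<lambda>x x'. sweedler (\<Delta> x) (\<lambda>a b.
      sweedler (\<Delta> x') (\<lambda>a' b'. ?K a a' b b' e))))"
    by (subst (2) sweedler_interchange) (simp_all add: lin)
  also have "\<dots> = sweedler (\<Delta> c) (\<lambda>x y. sweedler (\<Delta> y) (\<lambda>x' e. sweedler (\<Delta> x) (\<lambda>a b.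
      sweedler (\<Delta> x') (\<lambda>a' b'. ?K a a' b b' e))))"
    by (rule sweedler_coassoc) (simp_all add: lin)
  also have "\<dots> = sweedler (\<Delta> c) (\<lambda>x y. sweedler (\<Delta> x) (\<lambda>a b. sweedler (\<Delta> y) (\<lambda>x' e.
      sweedler (\<Delta> x') (\<lambda>a' b'. ?K a a' b b' e))))"
    by (subst (2) sweedler_swap) (rule refl)
  also have "\<dots> = convolution (\<lambda>x. \<chi> (tensor_pair p q x))
      (\<lambda>x. \<chi> (tensor_pair (convolution p q) r x)) c"
    by (simp only: convolution_def clinear_tensor_pair_apply lin sweedler_tensor_left
        clinear_sweedler[OF clinear_chi] sweedler_mult_left, simp only: sweedler_mult_right)
  finally show "convolution (act.twist p (\<lambda>x. \<chi> (tensor_pair q r x)))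
      (\<lambda>x. \<chi> (tensor_pair p (convolution q r) x)) c =
    convolution (\<lambda>x. \<chi> (tensor_pair p q x)) (\<lambda>x. \<chi> (tensor_pair (convolution p q) r x)) c" .
qed

lemma chi_pair_antipode:
  assumes q: "coalgebra_map q"
  shows "\<chi> (tensor_pair q (\<lambda>x. \<S> (q x)) x) = delta (q x)"
  by (simp add: delta_def tensor_pair_compose[OF q] lin)

lemma chi_pair_unit:
  assumes q: "coalgebra_map q"
  shows "\<chi> (tensor_pair q unit_counit x) = unit_counit x"
    and "\<chi> (tensor_pair unit_counit q x) = unit_counit x"
proof -
  note [lin] = coalgebra_map_linear[OF q]
  have "\<chi> (tensor_pair q unit_counit x) = sweedler (\<Delta> x) (\<lambda>a b. \<epsilon> b *\<^sub>C unit_counit a)"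
    by (simp add: clinear_tensor_pair_apply lin unit_counit_def tensor_scaleC_right
        clinear_scaleC[OF clinear_chi] chi_one_right coalgebra_map_counit[OF q])
  then show "\<chi> (tensor_pair q unit_counit x) = unit_counit x"
    by (simp add: sweedler_counit_right lin)
  have "\<chi> (tensor_pair unit_counit q x) = sweedler (\<Delta> x) (\<lambda>a b. \<epsilon> a *\<^sub>C unit_counit b)"
    by (simp add: clinear_tensor_pair_apply lin unit_counit_def tensor_scaleC_left
        clinear_scaleC[OF clinear_chi] chi_one_left coalgebra_map_counit[OF q])
  then show "\<chi> (tensor_pair unit_counit q x) = unit_counit x"
    by (simp add: sweedler_counit_left lin)
qed

text \<open>In the cocycle identity at (u, S u, u) the factors chi(u, 1) and chi(1, u) are trivial
  by normalisation; what remains is u acting on chi(S u, u), equal to chi(u, S u).\<close>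

lemma twist_chi_antipode_left:
  "act.twist (\<lambda>x. x) (\<lambda>x. \<chi> (tensor_pair \<S> (\<lambda>x. x) x)) = delta"
proof -
  have [lin]: "clinear (tensor_pair \<S> (\<lambda>x::'h. x))"
    by (intro coalgebra_map_linear coalgebra_map_pair coalgebra_map_ident coalgebra_map_antipode)
  note [lin] = clinear_compose[OF clinear_chi, of "tensor_pair \<S> (\<lambda>x::'h. x)"]
  show ?thesis
    using chi_cocycle_points[OF coalgebra_map_ident coalgebra_map_antipode coalgebra_map_ident]
      convolution_antipode_left[OF coalgebra_map_ident, where 'd = 'h]
      convolution_antipode_right[OF coalgebra_map_ident, where 'd = 'h]
    by (simp add: chi_pair_unit[OF coalgebra_map_ident] convolution_unit_right lin
        flip: delta_def[abs_def])
qed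

text \<open>Two cocycle identities share the factor chi(u v, S v). Eliminating it evaluates the left
  side as the right side with f = chi^-1(S v, S u), and then gamma and the action of u v
  cancel.\<close>

lemma gamma_twist_chi_iff:
  fixes f :: "'h \<otimes> 'h \<Rightarrow> 'a"
  assumes f: "clinear f"
  shows "convolution (convolution (\<lambda>t. gamma (tensor_fst t))
        (act.twist tensor_fst (\<lambda>t. gamma (tensor_snd t)))) \<chi> =
      convolution (\<lambda>t. gamma (sweedler t (*))) (act.twist (\<lambda>t. sweedler t (*)) f) \<longleftrightarrow>
    f = (\<lambda>t. convolution_inverse \<chi>
      (tensor_pair (\<lambda>t. \<S> (tensor_snd t)) (\<lambda>t. \<S> (tensor_fst t)) t))"
proof -
  let ?u = "tensor_fst :: 'h \<otimes> 'h \<Rightarrow> 'h" and ?v = "tensor_snd :: 'h \<otimes> 'h \<Rightarrow> 'h"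
  let ?m = "\<lambda>t. sweedler t (*) :: 'h"
  let ?Su = "\<lambda>t. \<S> (?u t)" and ?Sv = "\<lambda>t. \<S> (?v t)"
  let ?w = "tensor_pair ?Sv ?Su"
  let ?c = "\<lambda>t. \<chi> (tensor_pair ?m ?Sv t)"
  note maps = coalgebra_map_fst coalgebra_map_snd coalgebra_map_mult
    coalgebra_map_compose[OF coalgebra_map_antipode coalgebra_map_fst]
    coalgebra_map_compose[OF coalgebra_map_antipode coalgebra_map_snd]
  note [lin] = f maps[THEN coalgebra_map_linear]
  have w: "coalgebra_map ?w" by (intro coalgebra_map_pair maps)
  have [lin]: "clinear ?w" "clinear (tensor_pair ?m ?Sv)"
    by (intro coalgebra_map_linear coalgebra_map_pair maps)+
  have m: "convolution ?u ?v = ?m" by (rule convolution_fst_snd)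
  have Sm: "convolution ?Sv ?Su = (\<lambda>t. \<S> (?m t))"
    using antipode_convolution[of ?u ?v] by (simp add: fun_eq_iff m lin)
  have mSv: "convolution ?m ?Sv = ?u"
    using convolution_assoc[of ?u ?v ?Sv]
    by (simp add: m lin convolution_antipode_right[OF coalgebra_map_snd] convolution_unit_right)
  \<comment> \<open>The cocycle identity at (u, v, S v), where chi(u, v S v) = chi(u, 1) is
    trivial.\<close>
  have eq1: "act.twist ?u (\<lambda>t. delta (?v t)) = convolution \<chi> ?c"
    using chi_cocycle_points[OF maps(1,2,5)]
    by (simp add: m chi_pair_antipode[OF maps(2)] convolution_antipode_right[OF maps(2)]
        chi_pair_unit[OF maps(1)] convolution_unit_right lin tensor_pair_fst_snd)
  \<comment> \<open>The cocycle identity at (u v, S v, S u): the last two points multiply to S (u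
    v), the first two to u, so \<open>delta\<close> appears at u v and at u.\<close>
  have eq2: "convolution (act.twist ?m (\<lambda>t. \<chi> (?w t))) (\<lambda>t. delta (?m t)) =
      convolution ?c (\<lambda>t. delta (?u t))"
    using chi_cocycle_points[OF maps(3,5,4)]
    by (simp add: Sm mSv chi_pair_antipode[OF maps(3)] chi_pair_antipode[OF maps(1)])
  have dg: "convolution (\<lambda>t. delta (q t)) (\<lambda>t. gamma (q t)) = unit_counit"
    if "coalgebra_map q" for q :: "'h \<otimes> 'h \<Rightarrow> 'h"
    using fun_cong[OF convolution_delta_gamma]
    by (simp add: fun_eq_iff convolution_pullback[OF that, symmetric] lin unit_counit_pullback[OF that])
  have "convolution (convolution (\<lambda>t. gamma (?u t)) (act.twist ?u (\<lambda>t. gamma (?v t)))) \<chi> =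
      convolution (\<lambda>t. gamma (?m t)) (act.twist ?m (\<lambda>t. convolution_inverse \<chi> (?w t)))"
    by (rule convolution_quotient_eq[OF _ _ _ _ _ _ _ _ _ _ mult.commute _ _ _ _ eq1 eq2])
      (simp_all add: lin dg maps act.twist_inverse convolution_chi_pullback[OF w])
  moreover have "convolution (\<lambda>t. delta (?m t)) (\<lambda>t. gamma (?m t)) = unit_counit"
    by (rule dg[OF maps(3)])
  then have "convolution (\<lambda>t. gamma (?m t)) (\<lambda>t. delta (?m t)) = unit_counit"
    by (subst convolution_commute) (simp_all add: lin mult.commute)
  ultimately show ?thesis
    using convolution_left_cancel[of "\<lambda>t. gamma (?m t)" "\<lambda>t. delta (?m t)"]
      act.twist_inject[OF maps(3) f, of "\<lambda>t. convolution_inverse \<chi> (?w t)"]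
      \<open>convolution (\<lambda>t. delta (?m t)) (\<lambda>t. gamma (?m t)) = unit_counit\<close>
    by (auto simp: lin)
qed

text \<open>Translation into the Sweedler sums of (iii): a projection in one variable leaves a
  counit in the other, which is absorbed.\<close>

lemma gamma_twist_chi_pure:
  "convolution (convolution (\<lambda>t. gamma (tensor_fst t))
      (act.twist tensor_fst (\<lambda>t. gamma (tensor_snd t)))) \<chi> (u \<otimes> v) =
    sweedler (\<Delta> v) (\<lambda>v1 v2. sweedler (\<Delta> u) (\<lambda>u1 y. sweedler (\<Delta> y) (\<lambda>u2 u3.
      gamma u1 * (u2 \<rhd> gamma v1) * \<chi> (u3 \<otimes> v2))))"
proof -
  note [lin] = coalgebra_map_linear[OF coalgebra_map_fst] coalgebra_map_linear[OF coalgebra_map_snd]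
  have tw: "act.twist tensor_fst (\<lambda>t. gamma (tensor_snd t)) (u \<otimes> v) = u \<rhd> gamma v" for u v
  proof -
    have "act.twist tensor_fst (\<lambda>t. gamma (tensor_snd t)) (u \<otimes> v) =
        sweedler (\<Delta> u) (\<lambda>u1 u2. \<epsilon> u2 *\<^sub>C sweedler (\<Delta> v) (\<lambda>v1 v2. \<epsilon> v1 *\<^sub>C (u1 \<rhd> gamma v2)))"
      unfolding act.twist_def
      by (subst sweedler_comult_tensor_pure)
        (simp_all add: balanced_bilinear lin tensor_fst_pure tensor_snd_pure sweedler_scaleC mult.commute
          clinear_scaleC[OF clinear_gamma] clinear_scaleC[OF clinear_act_left]
          clinear_scaleC[OF clinear_act_right])
    also have "\<dots> = u \<rhd> gamma v"
      by (simp add: sweedler_counit_left sweedler_counit_right lin)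
    finally show ?thesis .
  qed
  have g: "convolution (\<lambda>t. gamma (tensor_fst t)) (act.twist tensor_fst (\<lambda>t. gamma (tensor_snd t)))
      (u \<otimes> v) = sweedler (\<Delta> u) (\<lambda>u1 u2. gamma u1 * (u2 \<rhd> gamma v))" for u v
  proof -
    have "convolution (\<lambda>t. gamma (tensor_fst t))
        (act.twist tensor_fst (\<lambda>t. gamma (tensor_snd t))) (u \<otimes> v) =
        sweedler (\<Delta> u) (\<lambda>u1 u2. sweedler (\<Delta> v) (\<lambda>v1 v2. \<epsilon> v1 *\<^sub>C (gamma u1 * (u2 \<rhd> gamma v2))))"
      by (simp add: convolution_tensor lin tensor_fst_pure tw mult_scaleC_left
          clinear_scaleC[OF clinear_gamma])
    then show ?thesis by (simp add: sweedler_counit_left lin)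
  qed
  have "convolution (convolution (\<lambda>t. gamma (tensor_fst t))
      (act.twist tensor_fst (\<lambda>t. gamma (tensor_snd t)))) \<chi> (u \<otimes> v) =
    sweedler (\<Delta> v) (\<lambda>v1 v2. sweedler (\<Delta> u) (\<lambda>y u3. sweedler (\<Delta> y) (\<lambda>u1 u2.
      gamma u1 * (u2 \<rhd> gamma v1) * \<chi> (u3 \<otimes> v2))))"
    by (simp add: convolution_tensor lin g sweedler_mult_left) (rule sweedler_swap)
  then show ?thesis
    by (simp add: sweedler_coassoc[of "\<lambda>u1 u2 u3. gamma u1 * (u2 \<rhd> gamma _) * \<chi> (u3 \<otimes> _)"] lin)
qed

lemma gamma_twist_mult_pure:
  assumes [lin]: "clinear f" "\<And>v. clinear (\<lambda>u. f (u \<otimes> v))" "\<And>u. clinear (\<lambda>v. f (u \<otimes> v))"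
  shows "convolution (\<lambda>t. gamma (sweedler t (*))) (act.twist (\<lambda>t. sweedler t (*)) f) (u \<otimes> v) =
    sweedler (\<Delta> v) (\<lambda>v1 z. sweedler (\<Delta> z) (\<lambda>v2 v3. sweedler (\<Delta> u) (\<lambda>u1 y. sweedler (\<Delta> y) (\<lambda>u2 u3.
      gamma (u2 * v2) * ((u3 * v3) \<rhd> f (u1 \<otimes> v1))))))"
proof -
  have tw: "act.twist (\<lambda>t. sweedler t (*)) f (u \<otimes> v) =
      sweedler (\<Delta> u) (\<lambda>u1 u2. sweedler (\<Delta> v) (\<lambda>v1 v2. (u1 * v1) \<rhd> f (u2 \<otimes> v2)))" for u v
    unfolding act.twist_def
    by (subst sweedler_comult_tensor_pure) (simp_all add: balanced_bilinear lin sweedler_tensor)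
  let ?F = "\<lambda>u1 u2 u3 v1 v2 v3. gamma (u1 * v1) * ((u2 * v2) \<rhd> f (u3 \<otimes> v3))"
  have "convolution (\<lambda>t. gamma (sweedler t (*))) (act.twist (\<lambda>t. sweedler t (*)) f) (u \<otimes> v) =
      sweedler (\<Delta> u) (\<lambda>u1 y. sweedler (\<Delta> v) (\<lambda>v1 z. sweedler (\<Delta> y) (\<lambda>u2 u3.
        sweedler (\<Delta> z) (\<lambda>v2 v3. ?F u1 u2 u3 v1 v2 v3))))"
    by (simp add: convolution_tensor lin sweedler_tensor tw sweedler_mult_right)
  also have "\<dots> = sweedler (\<Delta> u) (\<lambda>u1 y. sweedler (\<Delta> y) (\<lambda>u2 u3.
      sweedler (\<Delta> v) (\<lambda>v1 z. sweedler (\<Delta> z) (\<lambda>v2 v3. ?F u1 u2 u3 v1 v2 v3))))"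
    by (subst (2) sweedler_swap) (rule refl)
  \<comment> \<open>The rotation in each variable moves the argument of \<open>f\<close> from the
    third place to the first, as (iii) has it.\<close>
  also have "\<dots> = sweedler (\<Delta> u) (\<lambda>u1 y. sweedler (\<Delta> y) (\<lambda>u2 u3.
      sweedler (\<Delta> v) (\<lambda>v1 z. sweedler (\<Delta> z) (\<lambda>v2 v3. ?F u2 u3 u1 v2 v3 v1))))"
    by (subst sweedler_rotate, simp_all add: lin) (subst (2) sweedler_rotate, simp_all add: lin)
  also have "\<dots> = sweedler (\<Delta> u) (\<lambda>u1 y. sweedler (\<Delta> v) (\<lambda>v1 z. sweedler (\<Delta> y) (\<lambda>u2 u3.
      sweedler (\<Delta> z) (\<lambda>v2 v3. ?F u2 u3 u1 v2 v3 v1))))"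
    by (subst (2) sweedler_swap) (rule refl)
  also have "\<dots> = sweedler (\<Delta> v) (\<lambda>v1 z. sweedler (\<Delta> u) (\<lambda>u1 y. sweedler (\<Delta> y) (\<lambda>u2 u3.
      sweedler (\<Delta> z) (\<lambda>v2 v3. ?F u2 u3 u1 v2 v3 v1))))"
    by (rule sweedler_swap)
  also have "\<dots> = sweedler (\<Delta> v) (\<lambda>v1 z. sweedler (\<Delta> u) (\<lambda>u1 y. sweedler (\<Delta> z) (\<lambda>v2 v3.
      sweedler (\<Delta> y) (\<lambda>u2 u3. ?F u2 u3 u1 v2 v3 v1))))"
    by (subst (3) sweedler_swap) (rule refl)
  also have "\<dots> = sweedler (\<Delta> v) (\<lambda>v1 z. sweedler (\<Delta> z) (\<lambda>v2 v3. sweedler (\<Delta> u) (\<lambda>u1 y.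
      sweedler (\<Delta> y) (\<lambda>u2 u3. ?F u2 u3 u1 v2 v3 v1))))"
    by (subst (2) sweedler_swap) (rule refl)
  finally show ?thesis .
qed

section \<open>The coaction\<close>

lemma sweedler_rho_comult:
  assumes [lin]: "\<And>y z. clinear (\<lambda>x. F x y z)" "\<And>x z. clinear (\<lambda>y. F x y z)" "\<And>x y. clinear (F x y)"
  shows "sweedler (\<rho> x) (\<lambda>h a. sweedler (\<Delta> h) (\<lambda>h1 h2. F h1 h2 a)) =
    sweedler (\<Delta> x) (\<lambda>x1 x2. sweedler (\<rho> x1) (\<lambda>h a. sweedler (\<rho> x2) (\<lambda>h' a'. F h h' (a * a'))))"
proof -
  let ?G = "\<lambda>t. sweedler t (\<lambda>h u. sweedler u (F h))"
  have G: "clinear ?G" "\<And>h1 h2 a. ?G (h1 \<otimes> h2 \<otimes> a) = F h1 h2 a"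
    by (simp_all add: lin sweedler_tensor)
  from arg_cong[OF rho_comult, of ?G x] show ?thesis
    by (simp only: coprod2_def clinear_sweedler[OF G(1)] G(2))
qed

lemma sweedler_rho_counit:
  assumes "clinear f"
  shows "sweedler (\<rho> x) (\<lambda>h a. \<epsilon> h *\<^sub>C f a) = \<epsilon> x *\<^sub>C f 1"
  using arg_cong[OF rho_counit_left, of f x]
  by (simp add: clinear_sweedler[OF assms] clinear_scaleC[OF assms])

lemma sweedler_rho_mult:
  assumes "\<And>b. clinear (\<lambda>a. f a b)" "\<And>a. clinear (f a)"
  shows "sweedler (\<rho> (x * y)) f = sweedler (\<Delta> x) (\<lambda>x1 x2. sweedler (\<rho> x1) (\<lambda>h a.
    sweedler (\<rho> y) (\<lambda>h' a'. f (h * h') (a * (x2 \<rhd> a')))))"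
  by (simp add: rho_mult coprod2_def sweedler_sweedler sweedler_tensor assms)

lemma sweedler_rho_one:
  assumes "\<And>b. clinear (\<lambda>a. f a b)" "\<And>a. clinear (f a)"
  shows "sweedler (\<rho> 1) f = f 1 1"
  by (simp add: rho_one sweedler_tensor assms)

text \<open>Both sides are convolution inverses of \<open>\<rho>\<close>. On the left this follows
  from the comultiplicativity of rho and the antipode axiom in its H-component; on the right from
  the multiplicativity of rho applied to u S u = 1.\<close>

lemma rho_antipode:
  "sweedler (\<rho> x) (\<lambda>h a. \<S> h \<otimes> a) =
    sweedler (\<Delta> x) (\<lambda>x1 x2. sweedler (\<rho> (\<S> x2)) (\<lambda>h a. h \<otimes> (x1 \<rhd> a)))"
proof -
  let ?Q = "\<lambda>x. sweedler (\<rho> x) (\<lambda>h a. \<S> h \<otimes> a)"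
  let ?P = "\<lambda>x. sweedler (\<Delta> x) (\<lambda>x1 x2. sweedler (\<rho> (\<S> x2)) (\<lambda>h a. h \<otimes> (x1 \<rhd> a)))"
  have "convolution ?Q \<rho> = unit_counit"
  proof
    fix x
    have "convolution ?Q \<rho> x = sweedler (\<Delta> x) (\<lambda>x1 x2. sweedler (\<rho> x1) (\<lambda>h a.
        sweedler (\<rho> x2) (\<lambda>h' a'. (\<S> h * h') \<otimes> (a * a'))))"
      by (simp add: convolution_def times_tensor_def sweedler_sweedler sweedler_tensor lin)
    also have "\<dots> = sweedler (\<rho> x) (\<lambda>h a. sweedler (\<Delta> h) (\<lambda>h1 h2. (\<S> h1 * h2) \<otimes> a))"
      by (rule sweedler_rho_comult[symmetric]) (simp_all add: lin)
    also have "\<dots> = sweedler (\<rho> x) (\<lambda>h a. \<epsilon> h *\<^sub>C (1 \<otimes> a))"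
      by (simp add: antipode_left tensor_scaleC_left flip: sweedler_tensor_left)
    also have "\<dots> = unit_counit x"
      unfolding unit_counit_def one_tensor_def by (rule sweedler_rho_counit) (simp add: lin)
    finally show "convolution ?Q \<rho> x = unit_counit x" .
  qed
  moreover have "convolution \<rho> ?P = unit_counit"
  proof
    fix x
    have "convolution \<rho> ?P x = sweedler (\<Delta> x) (\<lambda>w z. sweedler (\<Delta> z) (\<lambda>y z. sweedler (\<rho> w)
        (\<lambda>h a. sweedler (\<rho> (\<S> z)) (\<lambda>h' a'. (h * h') \<otimes> (a * (y \<rhd> a'))))))"
      by (simp add: convolution_def times_tensor_def sweedler_sweedler sweedler_tensor lin
          sweedler_swap[of "\<rho> s" "\<Delta> t" for s t])
    also have "\<dots> = sweedler (\<Delta> x) (\<lambda>w z. sweedler (\<Delta> w) (\<lambda>w y. sweedler (\<rho> w)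
        (\<lambda>h a. sweedler (\<rho> (\<S> z)) (\<lambda>h' a'. (h * h') \<otimes> (a * (y \<rhd> a'))))))"
      by (rule sweedler_coassoc[symmetric]) (simp_all add: lin)
    also have "\<dots> = sweedler (\<Delta> x) (\<lambda>w z. \<rho> (w * \<S> z))"
      by (simp add: rho_mult coprod2_def)
    also have "\<dots> = \<rho> (\<epsilon> x *\<^sub>C 1)"
      by (simp add: antipode_right flip: clinear_sweedler[OF clinear_rho])
    finally show "convolution \<rho> ?P x = unit_counit x"
      by (simp add: unit_counit_def one_tensor_def clinear_scaleC[OF clinear_rho] rho_one)
  qed
  ultimately have "?Q = ?P"
    using convolution_inverse_unique[of \<rho> ?Q ?P] by (simp add: lin)
  then show ?thesis by (rule fun_cong)
qed

text \<open>Substitution of \<open>\<S> x\<close> into the previous identity gives the shape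
  occurring in (c).\<close>

lemma rho_antipode_twist:
  "sweedler (\<rho> (\<S> x)) (\<lambda>h a. \<S> h \<otimes> a) =
    sweedler (\<Delta> x) (\<lambda>x1 x2. sweedler (\<rho> x1) (\<lambda>h a. h \<otimes> (\<S> x2 \<rhd> a)))"
proof -
  have "sweedler (\<rho> (\<S> x)) (\<lambda>h a. \<S> h \<otimes> a) =
      sweedler (\<Delta> x) (\<lambda>x1 x2. sweedler (\<rho> x2) (\<lambda>h a. h \<otimes> (\<S> x1 \<rhd> a)))"
    by (simp add: rho_antipode sweedler_antipode_antipode antipode_antipode lin)
  also have "\<dots> = sweedler (\<Delta> x) (\<lambda>x1 x2. sweedler (\<rho> x1) (\<lambda>h a. h \<otimes> (\<S> x2 \<rhd> a)))"
    by (rule sweedler_cocommute) (simp_all add: lin)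
  finally show ?thesis .
qed

(* The axiom comult_act reads \<Delta> (x \<rhd> a) = theta x (\<Delta> a). *)
definition theta :: "'h \<Rightarrow> 'a \<otimes> 'a \<Rightarrow> 'a \<otimes> 'a"
  where "theta x t = sweedler (\<Delta> x) (\<lambda>x1 x2. sweedler (\<rho> x1) (\<lambda>h a.
    sweedler t (\<lambda>b c. (h \<rhd> b) \<otimes> (a * (x2 \<rhd> c)))))"

lemma clinear_theta_left: "clinear (\<lambda>x. theta x t)"
  and clinear_theta_right: "clinear (theta x)"
  unfolding theta_def by (simp_all add: lin)

lemmas clinear_theta [lin] =
  clinear_theta_left clinear_compose[OF clinear_theta_left]
  clinear_theta_right clinear_compose[OF clinear_theta_right]

lemma theta_pure: "theta x (b \<otimes> c) =
    sweedler (\<Delta> x) (\<lambda>x1 x2. sweedler (\<rho> x1) (\<lambda>h a. (h \<rhd> b) \<otimes> (a * (x2 \<rhd> c))))"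
  by (simp add: theta_def sweedler_tensor lin)

text \<open>Acting on a product in the first component splits the coproduct of the H-part of rho;
  comultiplicativity turns this into two copies of rho whose A-parts multiply.\<close>

lemma theta_mult: "theta x (s * t) = sweedler (\<Delta> x) (\<lambda>x1 x2. theta x1 s * theta x2 t)"
proof (rule clinear_tensor_ext[where f = "\<lambda>s. theta x (s * t)"])
  fix b c
  show "theta x ((b \<otimes> c) * t) = sweedler (\<Delta> x) (\<lambda>x1 x2. theta x1 (b \<otimes> c) * theta x2 t)"
  proof (rule clinear_tensor_ext[where f = "\<lambda>t. theta x ((b \<otimes> c) * t)"])
    fix b' c'
    let ?F = "\<lambda>p q r s. sweedler (\<rho> p) (\<lambda>h a. sweedler (\<rho> q) (\<lambda>h' a'.
      ((h \<rhd> b) * (h' \<rhd> b')) \<otimes> (a * a' * ((r \<rhd> c) * (s \<rhd> c')))))"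
    have "theta x ((b \<otimes> c) * (b' \<otimes> c')) = sweedler (\<Delta> x) (\<lambda>x1 x2. sweedler (\<Delta> x2) (\<lambda>r s.
        sweedler (\<rho> x1) (\<lambda>h a. sweedler (\<Delta> h) (\<lambda>h1 h2.
          ((h1 \<rhd> b) * (h2 \<rhd> b')) \<otimes> (a * ((r \<rhd> c) * (s \<rhd> c')))))))"
      by (simp add: times_tensor_pure theta_pure act.op_mult sweedler_tensor_left sweedler_mult_right
          sweedler_tensor_right) (subst (2) sweedler_swap, rule refl)
    also have "\<dots> = sweedler (\<Delta> x) (\<lambda>x1 x2. sweedler (\<Delta> x2) (\<lambda>r s. sweedler (\<Delta> x1) (\<lambda>p q. ?F p q r s)))"
      by (subst sweedler_rho_comult) (simp_all add: lin)
    also have "\<dots> = sweedler (\<Delta> x) (\<lambda>x1 x2. sweedler (\<Delta> x1) (\<lambda>p q. sweedler (\<Delta> x2) (\<lambda>r s. ?F p q r s)))"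
      by (subst (2) sweedler_swap) (rule refl)
    also have "\<dots> = sweedler (\<Delta> x) (\<lambda>x1 x2. sweedler (\<Delta> x1) (\<lambda>p r. sweedler (\<Delta> x2) (\<lambda>q s. ?F p q r s)))"
      by (rule sweedler_interchange) (simp_all add: lin)
    also have "\<dots> = sweedler (\<Delta> x) (\<lambda>x1 x2. theta x1 (b \<otimes> c) * theta x2 (b' \<otimes> c'))"
      by (simp only: theta_pure sweedler_mult_left)
        (simp add: sweedler_mult_right times_tensor_pure mult_ac
          sweedler_swap[of "\<rho> s" "\<Delta> t" for s t])
    finally show "theta x ((b \<otimes> c) * (b' \<otimes> c')) =
        sweedler (\<Delta> x) (\<lambda>x1 x2. theta x1 (b \<otimes> c) * theta x2 (b' \<otimes> c'))" .
  qed (simp_all add: lin)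
qed (simp_all add: lin)

lemma theta_one: "theta x 1 = \<epsilon> x *\<^sub>C 1"
proof -
  have "theta x 1 = sweedler (\<Delta> x) (\<lambda>x1 x2. \<epsilon> x2 *\<^sub>C sweedler (\<rho> x1) (\<lambda>h a. \<epsilon> h *\<^sub>C (1 \<otimes> a)))"
    unfolding one_tensor_def theta_pure
    by (simp add: act_one tensor_scaleC_left tensor_scaleC_right mult_scaleC_right sweedler_scaleC
        mult.commute)
  also have "\<dots> = sweedler (\<rho> x) (\<lambda>h a. \<epsilon> h *\<^sub>C (1 \<otimes> a))"
    by (rule sweedler_counit_right) (simp add: lin)
  also have "\<dots> = \<epsilon> x *\<^sub>C 1"
    unfolding one_tensor_def by (rule sweedler_rho_counit) (simp add: lin)
  finally show ?thesis .
qed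

lemma one_theta: "theta 1 t = t"
proof (rule clinear_tensor_ext[where f = "theta 1" and g = "\<lambda>t. t"])
  fix b c
  have "theta 1 (b \<otimes> c) = sweedler (\<rho> 1) (\<lambda>h a. (h \<rhd> b) \<otimes> (a * (1 \<rhd> c)))"
    unfolding theta_pure comult_one one_tensor_def by (rule sweedler_tensor) (simp_all add: lin)
  then show "theta 1 (b \<otimes> c) = b \<otimes> c"
    by (simp add: sweedler_rho_one lin one_act)
qed (simp_all add: lin)

text \<open>Letting y and then x act produces the A-part x1A (x2 \<rhd> yA), which by
  \<open>rho_mult\<close> is that of \<open>\<rho> (x * y)\<close>.\<close>

lemma theta_theta: "theta x (theta y t) = theta (x * y) t"
proof (rule clinear_tensor_ext[where f = "\<lambda>t. theta x (theta y t)"])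
  fix b c
  let ?F = "\<lambda>p r s y1 y2. sweedler (\<rho> p) (\<lambda>h a. sweedler (\<rho> y1) (\<lambda>h' a'.
    ((h * h') \<rhd> b) \<otimes> (a * (r \<rhd> a') * ((s * y2) \<rhd> c))))"
  have "theta x (theta y (b \<otimes> c)) = sweedler (\<Delta> y) (\<lambda>y1 y2. sweedler (\<rho> y1) (\<lambda>h' a'.
      sweedler (\<Delta> x) (\<lambda>x1 x2. sweedler (\<rho> x1) (\<lambda>h a. sweedler (\<Delta> x2) (\<lambda>r s.
        ((h * h') \<rhd> b) \<otimes> (a * (r \<rhd> a') * ((s * y2) \<rhd> c)))))))"
    by (simp add: theta_pure[of y] clinear_sweedler[OF clinear_theta_right] theta_pure act.op_op
        act.op_mult sweedler_mult_right sweedler_tensor_right mult.assoc)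
  also have "\<dots> = sweedler (\<Delta> x) (\<lambda>x1 x2. sweedler (\<Delta> x2) (\<lambda>r s. sweedler (\<Delta> y) (\<lambda>y1 y2.
      sweedler (\<rho> y1) (\<lambda>h' a'. sweedler (\<rho> x1) (\<lambda>h a.
        ((h * h') \<rhd> b) \<otimes> (a * (r \<rhd> a') * ((s * y2) \<rhd> c)))))))"
    by (simp only: sweedler_swap[of "\<rho> s" "\<Delta> t" for s t] sweedler_swap[of "\<Delta> y" "\<Delta> t" for t])
  also have "\<dots> = sweedler (\<Delta> x) (\<lambda>x1 x2. sweedler (\<Delta> x2) (\<lambda>r s. sweedler (\<Delta> y) (\<lambda>y1 y2.
      ?F x1 r s y1 y2)))"
    by (subst (4) sweedler_swap) (rule refl)
  also have "\<dots> = sweedler (\<Delta> x) (\<lambda>x1 x2. sweedler (\<Delta> x1) (\<lambda>p r. sweedler (\<Delta> y) (\<lambda>y1 y2.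
      ?F p r x2 y1 y2)))"
    by (rule sweedler_coassoc[symmetric]) (simp_all add: lin)
  also have "\<dots> = sweedler (\<Delta> x) (\<lambda>x1 x2. sweedler (\<Delta> y) (\<lambda>y1 y2. sweedler (\<rho> (x1 * y1))
      (\<lambda>h a. (h \<rhd> b) \<otimes> (a * ((x2 * y2) \<rhd> c)))))"
    by (simp add: sweedler_rho_mult lin) (subst (2) sweedler_swap, rule refl)
  also have "\<dots> = theta (x * y) (b \<otimes> c)"
    unfolding theta_pure comult_mult times_tensor_def
    by (simp add: sweedler_sweedler sweedler_tensor lin)
  finally show "theta x (theta y (b \<otimes> c)) = theta (x * y) (b \<otimes> c)" .
qed (simp_all add: lin)

sublocale theta: module_algebra theta
  by (rule module_algebra.intro) (simp_all add: lin theta_mult theta_one one_theta theta_theta)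

section \<open>Pulling maps back along the coaction\<close>

definition rho_pull :: "('h \<Rightarrow> 'a) \<Rightarrow> 'h \<Rightarrow> 'a \<otimes> 'a"
  where "rho_pull f x = sweedler (\<rho> x) (\<lambda>h a. f h \<otimes> a)"

lemma clinear_rho_pull [lin]: "clinear f \<Longrightarrow> clinear (rho_pull f)"
  unfolding rho_pull_def by (simp add: lin)

text \<open>Comultiplicativity of rho makes f \<mapsto> (f \<otimes> id) rho a morphism from Hom(H,
  A) to Hom(H, A \<otimes> A). In particular it sends the inverse pair \<open>delta\<close>,
  \<open>gamma\<close> to an inverse pair.\<close>

lemma rho_pull_convolution:
  assumes [lin]: "clinear f" "clinear g"
  shows "rho_pull (convolution f g) = convolution (rho_pull f) (rho_pull g)"
proof
  fix x
  have "rho_pull (convolution f g) x =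
      sweedler (\<rho> x) (\<lambda>h a. sweedler (\<Delta> h) (\<lambda>h1 h2. (f h1 * g h2) \<otimes> a))"
    by (simp add: rho_pull_def convolution_def sweedler_tensor_left)
  also have "\<dots> = sweedler (\<Delta> x) (\<lambda>x1 x2. sweedler (\<rho> x1) (\<lambda>h a. sweedler (\<rho> x2) (\<lambda>h' a'.
      (f h * g h') \<otimes> (a * a'))))"
    by (rule sweedler_rho_comult) (simp_all add: lin)
  also have "\<dots> = convolution (rho_pull f) (rho_pull g) x"
    by (simp only: convolution_def rho_pull_def sweedler_mult_left)
      (simp add: sweedler_mult_right times_tensor_pure)
  finally show "rho_pull (convolution f g) x = convolution (rho_pull f) (rho_pull g) x" .
qed

lemma rho_pull_unit: "rho_pull unit_counit = unit_counit"
  unfolding fun_eq_iff rho_pull_def unit_counit_def one_tensor_def tensor_scaleC_left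
  by (intro allI sweedler_rho_counit) (simp add: lin)

section \<open>The dual cocycle\<close>

text \<open>The compatibility axiom factorises in the convolution algebra. Of the six factors of x,
  the first feeds psi(u), the second and third the \<open>theta\<close>-action of u on psi(v), the
  fourth and fifth the product built from rho(u) and rho(v), and the sixth 1 \<otimes> chi(u,
  v).\<close>

lemma comult_chi_convolution:
  "convolution (\<lambda>t. \<Delta> (\<chi> t)) (\<lambda>t. \<psi> (sweedler t (*))) =
    convolution (\<lambda>t. \<psi> (tensor_fst t))
      (convolution (theta.twist tensor_fst (\<lambda>t. \<psi> (tensor_snd t)))
        (convolution
          (\<lambda>t. sweedler t (\<lambda>x y. sweedler (\<Delta> x) (\<lambda>x1 x2. sweedler (\<rho> x1) (\<lambda>h a.
            sweedler (\<rho> y) (\<lambda>h' a'. \<chi> (h \<otimes> h') \<otimes> (a * (x2 \<rhd> a')))))))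
          (\<lambda>t. 1 \<otimes> \<chi> t)))"
  (is "?lhs = convolution _ (convolution ?E (convolution ?L ?R))")
proof
  fix t
  note [lin] = coalgebra_map_linear[OF coalgebra_map_fst] coalgebra_map_linear[OF coalgebra_map_snd]
  let ?N = "convolution ?L ?R" and ?M = "convolution ?E (convolution ?L ?R)"
  let ?e = "\<lambda>x2 x3 y1. sweedler (\<rho> x2) (\<lambda>h a. sweedler (\<psi> y1) (\<lambda>b c. (h \<rhd> b) \<otimes> (a * (x3 \<rhd> c))))"
  let ?l = "\<lambda>x4 x5 y2. sweedler (\<rho> x4) (\<lambda>h a. sweedler (\<rho> y2) (\<lambda>h' a'.
    \<chi> (h \<otimes> h') \<otimes> (a * (x5 \<rhd> a'))))"
  let ?r = "\<lambda>x6 y3. (1 :: 'a) \<otimes> \<chi> (x6 \<otimes> y3)"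
  have E: "?E (x \<otimes> y) = sweedler (\<Delta> x) (\<lambda>x2 x3. ?e x2 x3 y)" for x y
  proof -
    have "?E (x \<otimes> y) =
        sweedler (\<Delta> x) (\<lambda>x1 x2. \<epsilon> x2 *\<^sub>C sweedler (\<Delta> y) (\<lambda>y1 y2. \<epsilon> y1 *\<^sub>C theta x1 (\<psi> y2)))"
      unfolding theta.twist_def
      by (subst sweedler_comult_tensor_pure)
        (simp_all add: balanced_bilinear lin tensor_fst_pure tensor_snd_pure sweedler_scaleC mult.commute
          clinear_scaleC[OF clinear_psi] clinear_scaleC[OF clinear_theta_left]
          clinear_scaleC[OF clinear_theta_right])
    also have "\<dots> = theta x (\<psi> y)"
      by (simp add: sweedler_counit_left sweedler_counit_right lin)
    finally show ?thesis by (simp add: theta_def)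
  qed
  have N: "?N (x \<otimes> y) = sweedler (\<Delta> x) (\<lambda>s x6. sweedler (\<Delta> s) (\<lambda>x4 x5.
      sweedler (\<Delta> y) (\<lambda>y2 y3. ?l x4 x5 y2 * ?r x6 y3)))" for x y
    by (simp only: convolution_tensor lin sweedler_tensor sweedler_mult_left[of "\<Delta> _"]
        sweedler_swap[of "\<Delta> y" "\<Delta> t" for t])
  have M: "?M (x \<otimes> y) = sweedler (\<Delta> x) (\<lambda>p q. sweedler (\<Delta> p) (\<lambda>x2 x3.
      sweedler (\<Delta> q) (\<lambda>s x6. sweedler (\<Delta> s) (\<lambda>x4 x5.
        sweedler (\<Delta> y) (\<lambda>y1 z. sweedler (\<Delta> z) (\<lambda>y2 y3.
          ?e x2 x3 y1 * (?l x4 x5 y2 * ?r x6 y3)))))))" for x y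
    by (simp only: convolution_tensor[of ?E ?N] lin E N sweedler_mult_left[of "\<Delta> _"])
      (simp only: sweedler_mult_right[of _ "\<Delta> _"] sweedler_swap[of "\<Delta> y" "\<Delta> t" for t])
  have body: "\<psi> x1 * (?e x2 x3 y1 * (?l x4 x5 y2 * ?r x6 y3)) =
      sweedler (\<psi> x1) (\<lambda>x1I x1II. sweedler (\<rho> x2) (\<lambda>x2H x2A. sweedler (\<rho> x4) (\<lambda>x4H x4A.
        sweedler (\<psi> y1) (\<lambda>y1I y1II. sweedler (\<rho> y2) (\<lambda>y2H y2A.
           (x1I * (x2H \<rhd> y1I) * \<chi> (x4H \<otimes> y2H)) \<otimes>
           (x1II * x2A * (x3 \<rhd> y1II) * x4A * (x5 \<rhd> y2A) * \<chi> (x6 \<otimes> y3)))))))"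
    for x1 x2 x3 x4 x5 x6 y1 y2 y3
    unfolding sweedler_swap[of "\<rho> x4" "\<psi> y1"]
    by (subst sweedler_tensor_ident[of "\<psi> x1", symmetric], simp only: sweedler_mult_left)
      (simp add: sweedler_mult_right times_tensor_pure mult.assoc)
  show "?lhs t = convolution (\<lambda>t. \<psi> (tensor_fst t)) ?M t"
  proof (rule clinear_tensor_ext[where f = ?lhs])
    fix x y
    have "?lhs (x \<otimes> y) = sweedler (\<Delta> x) (\<lambda>x1 x. sweedler (\<Delta> x) (\<lambda>x2 x. sweedler (\<Delta> x) (\<lambda>x3 x.
        sweedler (\<Delta> x) (\<lambda>x4 x. sweedler (\<Delta> x) (\<lambda>x5 x6. sweedler (\<Delta> y) (\<lambda>y1 z.
          sweedler (\<Delta> z) (\<lambda>y2 y3. \<psi> x1 * (?e x2 x3 y1 * (?l x4 x5 y2 * ?r x6 y3)))))))))"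
      using chi_psi[of x y]
      by (simp add: convolution_tensor lin sweedler_tensor body coprod2_def coprod3_def coprod4_def
          coprod5_def coprod6_def times_tensor_def[of "\<Delta> _"])
    also have "\<dots> = sweedler (\<Delta> x) (\<lambda>x1 x. sweedler (\<Delta> x) (\<lambda>x2 x. sweedler (\<Delta> x) (\<lambda>x3 x.
        sweedler (\<Delta> x) (\<lambda>s x6. sweedler (\<Delta> s) (\<lambda>x4 x5. sweedler (\<Delta> y) (\<lambda>y1 z.
          sweedler (\<Delta> z) (\<lambda>y2 y3. \<psi> x1 * (?e x2 x3 y1 * (?l x4 x5 y2 * ?r x6 y3)))))))))"
      by (subst (2) sweedler_coassoc[symmetric]) (simp_all add: lin)
    also have "\<dots> = sweedler (\<Delta> x) (\<lambda>x1 x. sweedler (\<Delta> x) (\<lambda>p q. sweedler (\<Delta> p) (\<lambda>x2 x3.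
        sweedler (\<Delta> q) (\<lambda>s x6. sweedler (\<Delta> s) (\<lambda>x4 x5. sweedler (\<Delta> y) (\<lambda>y1 z.
          sweedler (\<Delta> z) (\<lambda>y2 y3. \<psi> x1 * (?e x2 x3 y1 * (?l x4 x5 y2 * ?r x6 y3)))))))))"
      by (subst (2) sweedler_coassoc[symmetric]) (simp_all add: lin)
    also have "\<dots> = sweedler (\<Delta> x) (\<lambda>x1 x. \<psi> x1 * ?M (x \<otimes> y))"
      by (simp only: M sweedler_mult_right[of _ "\<Delta> _"])
    \<comment> \<open>The factor psi(u) consumes no part of y, so a counit in y is inserted to match
      a convolution over H \<otimes> H.\<close>
    also have "\<dots> = sweedler (\<Delta> x) (\<lambda>x1 x2. sweedler (\<Delta> y) (\<lambda>y1 y2. \<epsilon> y1 *\<^sub>C (\<psi> x1 * ?M (x2 \<otimes> y2))))"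
      by (subst sweedler_counit_left) (simp_all add: lin clinear_compose[of ?M])
    also have "\<dots> = convolution (\<lambda>t. \<psi> (tensor_fst t)) ?M (x \<otimes> y)"
      by (subst convolution_tensor)
        (simp_all add: lin tensor_fst_pure clinear_scaleC[OF clinear_psi] mult_scaleC_left)
    finally show "?lhs (x \<otimes> y) = convolution (\<lambda>t. \<psi> (tensor_fst t)) ?M (x \<otimes> y)" .
  qed (simp_all add: lin)
qed

text \<open>At the pair (u, S u) the product is 1, so psi of it disappears by
  \<open>psi_one\<close>, and the factor built from rho(u) and rho(S u) collapses to (delta
  \<otimes> id) rho(u).\<close>

lemma comult_delta:
  "(\<lambda>x. \<Delta> (delta x)) = convolution \<psi> (convolution (theta.twist (\<lambda>x. x) (\<lambda>x. \<psi> (\<S> x)))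
    (convolution (rho_pull delta) (\<lambda>x. 1 \<otimes> delta x)))"
proof
  fix x
  let ?p = "tensor_pair (\<lambda>x. x) (\<S> :: 'h \<Rightarrow> 'h)"
  have p: "coalgebra_map ?p"
    by (intro coalgebra_map_pair coalgebra_map_ident coalgebra_map_antipode)
  note [lin] = coalgebra_map_linear[OF coalgebra_map_fst] coalgebra_map_linear[OF coalgebra_map_snd]
    coalgebra_map_linear[OF p]
  have "sweedler (\<Delta> x) (\<lambda>a b. \<epsilon> b *\<^sub>C a) = x" "sweedler (\<Delta> x) (\<lambda>a b. \<epsilon> a *\<^sub>C \<S> b) = \<S> x" for x :: 'h
    by (simp_all add: counit_right sweedler_counit_left lin)
  then have fst: "tensor_fst (?p x) = x" and snd: "tensor_snd (?p x) = \<S> x" for x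
    by (simp_all add: tensor_fst_def tensor_snd_def sweedler_tensor_pair lin counit_antipode)
  have m: "sweedler (?p x) (*) = unit_counit x" for x
    using convolution_antipode_right[OF coalgebra_map_ident, where 'd = 'h]
    by (simp flip: convolution_eq_mult_pair)
  have psi_unit: "\<psi> (unit_counit x) = unit_counit x" for x :: 'h
    by (simp add: unit_counit_def clinear_scaleC[OF clinear_psi] psi_one one_tensor_def)
  let ?L = "\<lambda>t. sweedler t (\<lambda>x y. sweedler (\<Delta> x) (\<lambda>x1 x2. sweedler (\<rho> x1) (\<lambda>h a.
    sweedler (\<rho> y) (\<lambda>h' a'. \<chi> (h \<otimes> h') \<otimes> (a * (x2 \<rhd> a'))))))"
  \<comment> \<open>\<open>rho_antipode\<close> trades u acting on the second factor of rho(S u) for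
    the antipode on the first factor of rho(u). Comultiplicativity then collects chi(h1, S h2),
    which is \<open>delta\<close> of the H-part.\<close>
  have L: "?L (?p x) = rho_pull delta x" for x
  proof -
    have "?L (?p x) = sweedler (\<Delta> x) (\<lambda>u v. sweedler (\<Delta> u) (\<lambda>u y. sweedler (\<rho> u) (\<lambda>h a.
        sweedler (\<rho> (\<S> v)) (\<lambda>h' a'. \<chi> (h \<otimes> h') \<otimes> (a * (y \<rhd> a'))))))"
      by (simp add: sweedler_tensor_pair lin)
    also have "\<dots> = sweedler (\<Delta> x) (\<lambda>u w. sweedler (\<Delta> w) (\<lambda>y z. sweedler (\<rho> u) (\<lambda>h a.
        sweedler (\<rho> (\<S> z)) (\<lambda>h' a'. \<chi> (h \<otimes> h') \<otimes> (a * (y \<rhd> a'))))))"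
      by (rule sweedler_coassoc) (simp_all add: lin)
    also have "\<dots> = sweedler (\<Delta> x) (\<lambda>u w. sweedler (\<rho> u) (\<lambda>h a.
        sweedler (sweedler (\<Delta> w) (\<lambda>y z. sweedler (\<rho> (\<S> z)) (\<lambda>h' a'. h' \<otimes> (y \<rhd> a'))))
          (\<lambda>h' a'. \<chi> (h \<otimes> h') \<otimes> (a * a'))))"
      by (simp add: sweedler_sweedler sweedler_tensor lin sweedler_swap[of "\<rho> s" "\<Delta> t" for s t])
    also have "\<dots> = sweedler (\<Delta> x) (\<lambda>u w. sweedler (\<rho> u) (\<lambda>h a. sweedler (\<rho> w) (\<lambda>h' a'.
        \<chi> (h \<otimes> \<S> h') \<otimes> (a * a'))))"
      by (simp add: sweedler_sweedler sweedler_tensor lin flip: rho_antipode)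
    also have "\<dots> = sweedler (\<rho> x) (\<lambda>h a. sweedler (\<Delta> h) (\<lambda>h1 h2. \<chi> (h1 \<otimes> \<S> h2) \<otimes> a))"
      by (rule sweedler_rho_comult[symmetric]) (simp_all add: lin)
    also have "\<dots> = rho_pull delta x"
      by (simp add: rho_pull_def delta_def clinear_tensor_pair_apply lin sweedler_tensor_left)
    finally show ?thesis .
  qed
  \<comment> \<open>The unit is inserted as psi(u S u), which produces the left side of the
    factorised axiom.\<close>
  have "\<Delta> (delta x) = convolution (\<lambda>x. \<Delta> (delta x)) unit_counit x"
    by (simp add: convolution_unit_right lin)
  also have "\<dots> = convolution (\<lambda>t. \<Delta> (\<chi> t)) (\<lambda>t. \<psi> (sweedler t (*))) (?p x)"
    by (simp add: convolution_pullback[OF p] lin m psi_unit flip: delta_def)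
  also have "\<dots> = convolution \<psi> (convolution (theta.twist (\<lambda>x. x) (\<lambda>x. \<psi> (\<S> x)))
      (convolution (rho_pull delta) (\<lambda>x. 1 \<otimes> delta x))) x"
    unfolding comult_chi_convolution
    by (simp add: convolution_pullback[OF p] theta.twist_pullback[OF p] lin L fst snd
        flip: delta_def)
  finally show "\<Delta> (delta x) = convolution \<psi> (convolution (theta.twist (\<lambda>x. x) (\<lambda>x. \<psi> (\<S> x)))
      (convolution (rho_pull delta) (\<lambda>x. 1 \<otimes> delta x))) x" .
qed

text \<open>Inverting \<open>comult_delta\<close> factor by factor shows that D(u) = psi^-1(S u)
  satisfies the equation; invertibility of the gamma factors and of the \<open>theta\<close>-action
  makes the solution unique.\<close>

lemma comult_gamma_iff:
  assumes [lin]: "clinear D"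
  shows "convolution (\<lambda>x. \<Delta> (gamma x)) \<psi> =
      convolution (\<lambda>x. 1 \<otimes> gamma x) (convolution (rho_pull gamma) (theta.twist (\<lambda>x. x) D)) \<longleftrightarrow>
    D = (\<lambda>x. convolution_inverse \<psi> (\<S> x))"
proof -
  let ?psiS = "\<lambda>x. \<psi> (\<S> x)" and ?psi'S = "\<lambda>x. convolution_inverse \<psi> (\<S> x)"
  let ?T = "theta.twist (\<lambda>x. x)"
  note comm = tensor_mult_commute[where 'a = 'a and 'b = 'a]
  note ac = convolution_assoc convolution_commute[OF _ _ comm] convolution_left_commute[OF _ _ _ comm]
  have dg: "convolution (\<lambda>x. h (delta x)) (\<lambda>x. h (gamma x)) = unit_counit"
    if "clinear h" "\<And>a b. h (a * b) = h a * h b" "h 1 = 1" for h :: "'a \<Rightarrow> 'a \<otimes> 'a"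
    using fun_cong[OF convolution_delta_gamma]
    by (simp add: fun_eq_iff that(1,3) unit_counit_pushforward
        flip: convolution_pushforward[OF that(1,2)])
  have Dg: "convolution (\<lambda>x. \<Delta> (delta x)) (\<lambda>x. \<Delta> (gamma x)) = unit_counit"
    by (rule dg) (simp_all add: lin comult_mult comult_one)
  have one: "convolution (\<lambda>x. 1 \<otimes> delta x) (\<lambda>x. 1 \<otimes> gamma x) = (unit_counit :: 'h \<Rightarrow> 'a \<otimes> 'a)"
    by (rule dg) (simp_all add: lin times_tensor_pure one_tensor_def)
  have push: "convolution (rho_pull delta) (rho_pull gamma) = unit_counit"
    by (simp add: convolution_delta_gamma rho_pull_unit lin flip: rho_pull_convolution)
  have "convolution ?psiS ?psi'S = unit_counit"
  proof
    fix x
    have "convolution \<psi> (convolution_inverse \<psi>) (\<S> x) = unit_counit (\<S> x)"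
      using psi_inverse by (simp add: is_convolution_inverse_iff)
    then show "convolution ?psiS ?psi'S x = unit_counit x"
      by (simp add: convolution_pullback[OF coalgebra_map_antipode]
          unit_counit_pullback[OF coalgebra_map_antipode] lin)
  qed
  then have tw: "convolution (?T ?psiS) (?T ?psi'S) = unit_counit"
    by (intro theta.twist_inverse coalgebra_map_ident) (simp_all add: lin)
  define K where "K = convolution (rho_pull delta) (\<lambda>x. 1 \<otimes> delta x)"
  define K' where "K' = convolution (rho_pull gamma) (\<lambda>x. (1 :: 'a) \<otimes> gamma x)"
  have [lin]: "clinear K" "clinear K'" unfolding K_def K'_def by (simp_all add: lin)
  have KK: "convolution K K' = unit_counit"
    unfolding K_def K'_def by (rule convolution_inverse_mult[OF _ _ _ _ comm push one]) (simp_all add: lin)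
  have full: "convolution (convolution (?T ?psiS) K) (convolution (?T ?psi'S) K') = unit_counit"
    by (rule convolution_inverse_mult[OF _ _ _ _ comm tw KK]) (simp_all add: lin)
  have Dd: "(\<lambda>x. \<Delta> (delta x)) = convolution \<psi> (convolution (?T ?psiS) K)"
    unfolding K_def by (rule comult_delta)
  \<comment> \<open>Inserting the remaining factors of \<open>comult_delta\<close> together with
    their inverses lets psi recombine to the comultiplication of delta, which cancels that of
    gamma.\<close>
  have "convolution (\<lambda>x. \<Delta> (gamma x)) \<psi> =
      convolution (convolution (\<lambda>x. \<Delta> (gamma x)) \<psi>)
        (convolution (convolution (?T ?psiS) K) (convolution (?T ?psi'S) K'))"
    by (simp add: full convolution_unit_right lin)
  also have "\<dots> = convolution (convolution (convolution \<psi> (convolution (?T ?psiS) K)) (\<lambda>x. \<Delta> (gamma x)))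
      (convolution (?T ?psi'S) K')"
    by (simp add: ac lin)
  also have "\<dots> = convolution K' (?T ?psi'S)"
    unfolding Dd[symmetric] Dg by (simp add: convolution_unit_left lin ac)
  finally have "convolution (\<lambda>x. \<Delta> (gamma x)) \<psi> = convolution K' (?T ?psi'S)" .
  moreover have "convolution (\<lambda>x. 1 \<otimes> gamma x) (convolution (rho_pull gamma) (?T D)) = convolution K' (?T D)"
    unfolding K'_def by (simp add: ac lin)
  moreover have "convolution K' (?T ?psi'S) = convolution K' (?T D) \<longleftrightarrow> ?T ?psi'S = ?T D"
    by (rule convolution_left_cancel[where f' = K]) (simp_all add: lin KK)
  moreover have "?T ?psi'S = ?T D \<longleftrightarrow> ?psi'S = D"
    by (rule theta.twist_inject[OF coalgebra_map_ident]) (simp_all add: lin)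
  ultimately show ?thesis by auto
qed

text \<open>The action of H on the second factor alone. Unlike \<open>theta\<close> it does not
  involve rho; it models the outer action of x5 in (v) and the action in the starred form of the
  coaction.\<close>

definition act_right :: "'h \<Rightarrow> 'a \<otimes> 'a \<Rightarrow> 'a \<otimes> 'a"
  where "act_right x t = sweedler t (\<lambda>b c. b \<otimes> (x \<rhd> c))"

lemma clinear_act_right_left: "clinear (\<lambda>x. act_right x t)"
  and clinear_act_right_right: "clinear (act_right x)"
  unfolding act_right_def by (simp_all add: lin)

lemmas clinear_act_right_compose [lin] =
  clinear_act_right_left clinear_compose[OF clinear_act_right_left]
  clinear_act_right_right clinear_compose[OF clinear_act_right_right]

lemma act_right_pure: "act_right x (b \<otimes> c) = b \<otimes> (x \<rhd> c)"
  by (simp add: act_right_def sweedler_tensor lin)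

lemma act_right_mult: "act_right x (s * t) = sweedler (\<Delta> x) (\<lambda>x1 x2. act_right x1 s * act_right x2 t)"
proof (rule clinear_tensor_ext[where f = "\<lambda>s. act_right x (s * t)"])
  fix b c
  show "act_right x ((b \<otimes> c) * t) = sweedler (\<Delta> x) (\<lambda>x1 x2. act_right x1 (b \<otimes> c) * act_right x2 t)"
    by (rule clinear_tensor_ext[where f = "\<lambda>t. act_right x ((b \<otimes> c) * t)"])
      (simp_all add: lin times_tensor_pure act_right_pure act.op_mult sweedler_tensor_right)
qed (simp_all add: lin)

lemma act_right_act_right: "act_right x (act_right y t) = act_right (x * y) t"
  by (rule clinear_tensor_ext[where f = "\<lambda>t. act_right x (act_right y t)"])
    (simp_all add: lin act_right_pure act_act)

lemma one_act_right: "act_right 1 t = t"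
  by (rule clinear_tensor_ext[where f = "act_right 1" and g = "\<lambda>t. t"])
    (simp_all add: lin act_right_pure one_act)

sublocale right: module_algebra act_right
proof (rule module_algebra.intro)
  show "act_right x 1 = \<epsilon> x *\<^sub>C 1" for x
    by (simp add: one_tensor_def act_right_pure act_one tensor_scaleC_right)
qed (simp_all add: lin act_right_mult act_right_act_right one_act_right)

text \<open>By hypothesis rho(u) is R(u) with u acting on the second factor. Distributing the outer
  action of (v) over the product c a a' therefore turns both copies of R into rho: one gives (gamma
  \<otimes> id) rho(u), the other combines with D into the \<open>theta\<close>-action.\<close>

lemma twist_coaction_eq:
  assumes [lin]: "clinear R" "clinear D"
    and rho: "\<And>x. \<rho> x = sweedler (\<Delta> x) (\<lambda>x1 x2. sweedler (R x1) (\<lambda>h a. h \<otimes> (x2 \<rhd> a)))"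
  shows "sweedler (\<Delta> x) (\<lambda>x1 x. sweedler (\<Delta> x) (\<lambda>x2 x. sweedler (\<Delta> x) (\<lambda>x3 x. sweedler (\<Delta> x) (\<lambda>x4 x5.
      sweedler (D x1) (\<lambda>b c. sweedler (R x2) (\<lambda>h a. sweedler (R x3) (\<lambda>h' a'.
        (gamma h * (h' \<rhd> b)) \<otimes> (gamma x4 * (x5 \<rhd> (c * a * a')))))))))) =
    convolution (\<lambda>x. 1 \<otimes> gamma x) (convolution (rho_pull gamma) (theta.twist (\<lambda>x. x) D)) x"
proof -
  let ?U = "\<lambda>x. sweedler (R x) (\<lambda>h a. gamma h \<otimes> a)"
  let ?V = "\<lambda>x. sweedler (\<Delta> x) (\<lambda>x1 x2. sweedler (R x1) (\<lambda>h a. sweedler (D x2) (\<lambda>b c.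
    (h \<rhd> b) \<otimes> (a * c))))"
  let ?Z = "\<lambda>d r r' g k. sweedler (D d) (\<lambda>b c. sweedler (R r) (\<lambda>h a. sweedler (R r') (\<lambda>h' a'.
        (gamma h * (h' \<rhd> b)) \<otimes> (gamma g * (k \<rhd> (c * a * a'))))))"
  let ?T = "right.twist (\<lambda>x. x)"
  have rho': "sweedler (\<rho> x) f = sweedler (\<Delta> x) (\<lambda>x1 x2. sweedler (R x1) (\<lambda>h a. f h (x2 \<rhd> a)))"
    if "\<And>b. clinear (\<lambda>a. f a b)" "\<And>a. clinear (f a)" for x and f :: "'h \<Rightarrow> 'a \<Rightarrow> 'a \<otimes> 'a"
    by (simp add: rho sweedler_sweedler sweedler_tensor lin that)
  have U: "?T ?U = rho_pull gamma"
  proof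
    fix x
    have "?T ?U x = sweedler (\<Delta> x) (\<lambda>x1 x2. sweedler (R x2) (\<lambda>h a. gamma h \<otimes> (x1 \<rhd> a)))"
      by (simp add: right.twist_def clinear_sweedler[OF clinear_act_right_right] act_right_pure)
    also have "\<dots> = sweedler (\<Delta> x) (\<lambda>x1 x2. sweedler (R x1) (\<lambda>h a. gamma h \<otimes> (x2 \<rhd> a)))"
      by (rule sweedler_cocommute) (simp_all add: lin)
    finally show "?T ?U x = rho_pull gamma x"
      by (simp add: rho_pull_def rho' lin)
  qed
  \<comment> \<open>u acts separately on the A-part of R and on the second component of D; the
    former completes R to rho, the latter is the remaining action in \<open>theta\<close>.\<close>
  have V: "?T ?V = theta.twist (\<lambda>x. x) D"
  proof
    fix x
    let ?W = "\<lambda>p q v w. sweedler (R v) (\<lambda>h a. sweedler (D w) (\<lambda>b c. (h \<rhd> b) \<otimes> ((p \<rhd> a) * (q \<rhd> c))))"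
    have "?T ?V x = sweedler (\<Delta> x) (\<lambda>u y. sweedler (\<Delta> u) (\<lambda>p q. sweedler (\<Delta> y) (\<lambda>v w. ?W p q v w)))"
      by (simp add: right.twist_def clinear_sweedler[OF clinear_act_right_right] act_right_pure act.op_mult
          sweedler_tensor_right sweedler_swap[of "R s" "\<Delta> t" for s t]
          sweedler_swap[of "D s" "\<Delta> t" for s t])
        (subst (2) sweedler_swap, rule refl)
    also have "\<dots> = sweedler (\<Delta> x) (\<lambda>u y. sweedler (\<Delta> u) (\<lambda>p v. sweedler (\<Delta> y) (\<lambda>q w. ?W p q v w)))"
      by (rule sweedler_interchange) (simp_all add: lin)
    also have "\<dots> = sweedler (\<Delta> x) (\<lambda>u y. sweedler (\<Delta> u) (\<lambda>v p. sweedler (\<Delta> y) (\<lambda>q w. ?W p q v w)))"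
      by (subst (2) sweedler_cocommute) (simp_all add: lin)
    also have "\<dots> = sweedler (\<Delta> x) (\<lambda>u y. sweedler (\<Delta> y) (\<lambda>q w. sweedler (\<Delta> u) (\<lambda>v p. ?W p q v w)))"
      by (subst (2) sweedler_swap) (rule refl)
    also have "\<dots> = sweedler (\<Delta> x) (\<lambda>y w. sweedler (\<Delta> y) (\<lambda>u q. sweedler (\<Delta> u) (\<lambda>v p. ?W p q v w)))"
      by (rule sweedler_coassoc[symmetric]) (simp_all add: lin)
    also have "\<dots> = theta.twist (\<lambda>x. x) D x"
      by (simp add: theta.twist_def theta_def rho' lin)
    finally show "?T ?V x = theta.twist (\<lambda>x. x) D x" .
  qed
  have swap: "sweedler (\<Delta> P) (\<lambda>r w. sweedler (\<Delta> w) (\<lambda>r' d. sweedler (\<Delta> c) (\<lambda>g k.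
      ?Z d r r' g k))) = sweedler (\<Delta> c) (\<lambda>g k. sweedler (\<Delta> P) (\<lambda>r w. sweedler (\<Delta> w) (\<lambda>r' d.
      ?Z d r r' g k)))" for c P
    by (simp only: sweedler_swap[of "\<Delta> w" "\<Delta> c" for w])
  \<comment> \<open>The regrouping ends with g for the outer gamma, k for the outer action, r for
    \<open>?U\<close>, and r', d for the copy of R and the D inside \<open>?V\<close>.\<close>
  have "sweedler (\<Delta> x) (\<lambda>x1 x. sweedler (\<Delta> x) (\<lambda>x2 x. sweedler (\<Delta> x) (\<lambda>x3 x. sweedler (\<Delta> x) (\<lambda>x4 x5.
      ?Z x1 x2 x3 x4 x5)))) =
    sweedler (\<Delta> x) (\<lambda>d x. sweedler (\<Delta> x) (\<lambda>w c. sweedler (\<Delta> w) (\<lambda>r r'. sweedler (\<Delta> c) (\<lambda>g k.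
      ?Z d r r' g k))))"
    by (subst (2) sweedler_coassoc[symmetric]) (simp_all add: lin)
  also have "\<dots> = sweedler (\<Delta> x) (\<lambda>P c. sweedler (\<Delta> P) (\<lambda>d w. sweedler (\<Delta> w) (\<lambda>r r'.
      sweedler (\<Delta> c) (\<lambda>g k. ?Z d r r' g k))))"
    by (rule sweedler_coassoc[symmetric]) (simp_all add: lin)
  also have "\<dots> = sweedler (\<Delta> x) (\<lambda>c P. sweedler (\<Delta> P) (\<lambda>d w. sweedler (\<Delta> w) (\<lambda>r r'.
      sweedler (\<Delta> c) (\<lambda>g k. ?Z d r r' g k))))"
    by (rule sweedler_cocommute) (simp_all add: lin)
  also have "\<dots> = sweedler (\<Delta> x) (\<lambda>c P. sweedler (\<Delta> P) (\<lambda>w d. sweedler (\<Delta> w) (\<lambda>r r'.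
      sweedler (\<Delta> c) (\<lambda>g k. ?Z d r r' g k))))"
    by (subst (2) sweedler_cocommute) (simp_all add: lin)
  also have "\<dots> = sweedler (\<Delta> x) (\<lambda>c P. sweedler (\<Delta> P) (\<lambda>r w. sweedler (\<Delta> w) (\<lambda>r' d.
      sweedler (\<Delta> c) (\<lambda>g k. ?Z d r r' g k))))"
    by (subst sweedler_coassoc) (simp_all add: lin)
  also have "\<dots> = sweedler (\<Delta> x) (\<lambda>c P. sweedler (\<Delta> c) (\<lambda>g k. sweedler (\<Delta> P) (\<lambda>r w.
      sweedler (\<Delta> w) (\<lambda>r' d. ?Z d r r' g k))))"
    by (simp only: swap)
  also have "\<dots> = sweedler (\<Delta> x) (\<lambda>g y. sweedler (\<Delta> y) (\<lambda>k P. sweedler (\<Delta> P) (\<lambda>r w.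
      sweedler (\<Delta> w) (\<lambda>r' d. ?Z d r r' g k))))"
    by (rule sweedler_coassoc) (simp_all add: lin)
  also have "\<dots> = convolution (\<lambda>x. 1 \<otimes> gamma x) (?T (convolution ?U ?V)) x"
    by (simp only: convolution_def right.twist_def sweedler_mult_left[of "R s" for s])
      (simp add: clinear_sweedler[OF clinear_act_right_right] sweedler_mult_right act_right_pure
        times_tensor_pure sweedler_swap[of "R s" "\<Delta> t" for s t] sweedler_swap[of "D s" "\<Delta> t" for s t]
        sweedler_swap[of "D s" "R t" for s t] mult_ac)
  also have "\<dots> = convolution (\<lambda>x. 1 \<otimes> gamma x) (convolution (rho_pull gamma) (theta.twist (\<lambda>x. x) D)) x"
    by (subst right.twist_convolution) (simp_all add: U V coalgebra_map_ident lin)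
  finally show ?thesis .
qed

end

section \<open>Involutions on cocycle Singer pairs\<close>

text \<open>Only the types are narrowed, so that stars can be written; compatibility of the stars
  with the structure maps is what is under study and is not assumed.\<close>

locale star_singer_pair = cocycle_singer_pair act \<rho> \<chi> \<psi>
  for act :: "'h::{star_hopf_algebra, cocommutative_coalgebra} \<Rightarrow>
      'a::{star_hopf_algebra, comm_ring_1} \<Rightarrow> 'a" (infixr "\<rhd>" 75)
    and \<rho> :: "'h \<Rightarrow> 'h \<otimes> 'a"
    and \<chi> :: "'h \<otimes> 'h \<Rightarrow> 'a"
    and \<psi> :: "'h \<Rightarrow> 'a \<otimes> 'a"
begin

section \<open>The conditions on the action and on chi\<close>

lemma all_star: "(\<forall>x::'h. P (x\<^sup>\<star>)) \<longleftrightarrow> (\<forall>x. P x)"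
  by (metis star_star)

lemma convolution_gamma_delta: "convolution gamma delta = unit_counit"
  using convolution_delta_gamma convolution_commute[OF clinear_gamma clinear_delta]
  by (simp add: mult.commute)

text \<open>The common left side of (i) and (ii): f(u) is
  \<open>(gamma (u\<^sup>\<star>))\<^sup>\<star>\<close> in the one and
  \<open>(u\<^sup>\<star> \<rhd> a)\<^sup>\<star>\<close> in the other.\<close>

lemma gamma_twist_star:
  assumes [lin]: "clinear f"
  shows "sweedler (\<Delta> x) (\<lambda>x1 y. sweedler (\<Delta> y) (\<lambda>x2 x3. gamma (x2\<^sup>\<star>) * (x3\<^sup>\<star> \<rhd> f (x1\<^sup>\<star>)))) =
    convolution gamma (act.twist (\<lambda>x. x) f) (x\<^sup>\<star>)"
proof -
  have "sweedler (\<Delta> x) (\<lambda>x1 y. sweedler (\<Delta> y) (\<lambda>x2 x3. gamma (x2\<^sup>\<star>) * (x3\<^sup>\<star> \<rhd> f (x1\<^sup>\<star>)))) =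
      sweedler (\<Delta> (x\<^sup>\<star>)) (\<lambda>x1 y. sweedler (\<Delta> y) (\<lambda>x2 x3. gamma x2 * (x3 \<rhd> f x1)))"
    by (simp add: sweedler_comult_star lin)
  also have "\<dots> = sweedler (\<Delta> (x\<^sup>\<star>)) (\<lambda>x1 y. sweedler (\<Delta> y) (\<lambda>x2 x3. gamma x1 * (x2 \<rhd> f x3)))"
    by (rule sweedler_rotate[symmetric]) (simp_all add: lin)
  finally show ?thesis
    by (simp add: convolution_def act.twist_def sweedler_mult_right)
qed

lemma act_star_iff:
  "(\<forall>x a. sweedler (\<Delta> x) (\<lambda>x1 y. sweedler (\<Delta> y) (\<lambda>x2 x3. gamma (x2\<^sup>\<star>) * (x3\<^sup>\<star> \<rhd> (x1 \<rhd> a)\<^sup>\<star>))) =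
      a\<^sup>\<star> * gamma (x\<^sup>\<star>)) \<longleftrightarrow>
    (\<forall>x a. (x \<rhd> a)\<^sup>\<star> = \<S> (x\<^sup>\<star>) \<rhd> a\<^sup>\<star>)"
proof -
  have "(\<forall>x. sweedler (\<Delta> x) (\<lambda>x1 y. sweedler (\<Delta> y) (\<lambda>x2 x3. gamma (x2\<^sup>\<star>) * (x3\<^sup>\<star> \<rhd> (x1 \<rhd> a)\<^sup>\<star>))) =
      a\<^sup>\<star> * gamma (x\<^sup>\<star>)) \<longleftrightarrow> (\<forall>x. (x \<rhd> a)\<^sup>\<star> = \<S> (x\<^sup>\<star>) \<rhd> a\<^sup>\<star>)" for a
  proof -
    let ?f = "\<lambda>u. (u\<^sup>\<star> \<rhd> a)\<^sup>\<star>" and ?e = "\<lambda>u. \<epsilon> u *\<^sub>C a\<^sup>\<star>" and ?s = "\<lambda>u. \<S> u \<rhd> a\<^sup>\<star>"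
    have [lin]: "clinear ?f" by (rule clinear_star_star) (simp add: lin)
    have e: "convolution gamma ?e = (\<lambda>u. a\<^sup>\<star> * gamma u)"
      by (simp add: fun_eq_iff convolution_def mult_scaleC_right sweedler_counit_right lin mult.commute)
    \<comment> \<open>\<open>?s\<close> solves the equation that remains after gamma is cancelled,
      since u S u = 1; injectivity of the twist makes it the only solution.\<close>
    have s: "act.twist (\<lambda>x. x) ?s = ?e"
      by (simp add: fun_eq_iff act.twist_def act_act antipode_right one_act
          clinear_scaleC[OF clinear_act_left] flip: clinear_sweedler[OF clinear_act_left])
    have "(\<forall>x. sweedler (\<Delta> x) (\<lambda>x1 y. sweedler (\<Delta> y) (\<lambda>x2 x3. gamma (x2\<^sup>\<star>) * (x3\<^sup>\<star> \<rhd> (x1 \<rhd> a)\<^sup>\<star>))) =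
        a\<^sup>\<star> * gamma (x\<^sup>\<star>)) \<longleftrightarrow>
      (\<forall>x. convolution gamma (act.twist (\<lambda>x. x) ?f) (x\<^sup>\<star>) = convolution gamma ?e (x\<^sup>\<star>))"
      using gamma_twist_star[of ?f] by (simp add: lin star_star e)
    also have "\<dots> \<longleftrightarrow> convolution gamma (act.twist (\<lambda>x. x) ?f) = convolution gamma ?e"
      unfolding fun_eq_iff by (rule all_star)
    also have "\<dots> \<longleftrightarrow> act.twist (\<lambda>x. x) ?f = ?e"
      by (rule convolution_left_cancel[where f' = delta])
        (simp_all add: lin convolution_delta_gamma)
    also have "\<dots> \<longleftrightarrow> ?f = ?s"
      unfolding s[symmetric] by (rule act.twist_inject[OF coalgebra_map_ident]) (simp_all add: lin)
    also have "\<dots> \<longleftrightarrow> (\<forall>x. ?f (x\<^sup>\<star>) = ?s (x\<^sup>\<star>))"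
      by (simp add: all_star[of "\<lambda>x. ?f x = ?s x"] fun_eq_iff)
    finally show ?thesis by (simp add: star_star)
  qed
  then show ?thesis by blast
qed

lemma chi_star_iff:
  "(\<forall>x y. sweedler (\<Delta> x) (\<lambda>x1 x2. sweedler (\<Delta> y) (\<lambda>y1 z. sweedler (\<Delta> z) (\<lambda>y2 y3.
        gamma (y1\<^sup>\<star>) * (y2\<^sup>\<star> \<rhd> gamma (x1\<^sup>\<star>)) * \<chi> (y3\<^sup>\<star> \<otimes> x2\<^sup>\<star>)))) =
      sweedler (\<Delta> x) (\<lambda>x1 w. sweedler (\<Delta> w) (\<lambda>x2 x3. sweedler (\<Delta> y) (\<lambda>y1 z. sweedler (\<Delta> z) (\<lambda>y2 y3.
        gamma (y2\<^sup>\<star> * x2\<^sup>\<star>) * ((y3\<^sup>\<star> * x3\<^sup>\<star>) \<rhd> (\<chi> (x1 \<otimes> y1))\<^sup>\<star>)))))) \<longleftrightarrow>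
    (\<forall>x y. (\<chi> (x \<otimes> y))\<^sup>\<star> = convolution_inverse \<chi> (\<S> (x\<^sup>\<star>) \<otimes> \<S> (y\<^sup>\<star>)))"
    (is "(\<forall>x y. ?l x y = ?r x y) \<longleftrightarrow> _")
proof -
  \<comment> \<open>The generic pair stands for \<open>y\<^sup>\<star>\<close>,
    \<open>x\<^sup>\<star>\<close> in this order, because the products in (iii) are
    \<open>y\<^sup>\<star> * x\<^sup>\<star>\<close>. This accounts for the exchanged arguments in
    \<open>?f\<close> and \<open>?g\<close>.\<close>
  let ?f = "\<lambda>t. sweedler t (\<lambda>u v. (\<chi> (v\<^sup>\<star> \<otimes> u\<^sup>\<star>))\<^sup>\<star>)"
  let ?g = "\<lambda>t. convolution_inverse \<chi> (tensor_pair (\<lambda>t. \<S> (tensor_snd t)) (\<lambda>t. \<S> (tensor_fst t)) t)"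
  let ?L = "convolution (convolution (\<lambda>t. gamma (tensor_fst t))
        (act.twist tensor_fst (\<lambda>t. gamma (tensor_snd t)))) \<chi>"
  let ?R = "convolution (\<lambda>t. gamma (sweedler t (*))) (act.twist (\<lambda>t. sweedler t (*)) ?f)"
  have [lin]: "clinear (\<lambda>u. (\<chi> (v \<otimes> u\<^sup>\<star>))\<^sup>\<star>)" "clinear (\<lambda>v. (\<chi> (v\<^sup>\<star> \<otimes> u))\<^sup>\<star>)" for u v
    by (rule clinear_star_star, simp add: lin)+
  note maps = coalgebra_map_fst[where 'c = 'h and 'd = 'h] coalgebra_map_snd[where 'c = 'h and 'd = 'h]
  note maps' = maps[THEN coalgebra_map_compose[OF coalgebra_map_antipode]]
  note [lin] = maps[THEN coalgebra_map_linear] coalgebra_map_linear[OF coalgebra_map_pair[OF maps'(2,1)]]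
  have f: "clinear ?f" "?f (u \<otimes> v) = (\<chi> (v\<^sup>\<star> \<otimes> u\<^sup>\<star>))\<^sup>\<star>" for u v
    by (simp_all add: sweedler_tensor lin)
  have g: "?g (u \<otimes> v) = convolution_inverse \<chi> (\<S> v \<otimes> \<S> u)" for u v
  proof -
    have "?g (u \<otimes> v) = sweedler (\<Delta> u) (\<lambda>u1 u2. \<epsilon> u1 *\<^sub>C sweedler (\<Delta> v) (\<lambda>v1 v2. \<epsilon> v2 *\<^sub>C
        convolution_inverse \<chi> (\<S> v1 \<otimes> \<S> u2)))"
      by (subst clinear_tensor_pair_apply, simp add: lin, subst sweedler_comult_tensor_pure)
        (simp_all add: balanced_bilinear lin tensor_fst_pure tensor_snd_pure sweedler_scaleC mult.commute
          clinear_scaleC[OF clinear_antipode] tensor_scaleC_left tensor_scaleC_right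
          clinear_scaleC[OF clinear_chi_inverse])
    then show ?thesis by (simp add: sweedler_counit_left sweedler_counit_right lin)
  qed
  have l: "?l x y = ?L (y\<^sup>\<star> \<otimes> x\<^sup>\<star>)" for x y
    by (simp add: gamma_twist_chi_pure sweedler_comult_star lin)
  have r: "?r x y = ?R (y\<^sup>\<star> \<otimes> x\<^sup>\<star>)" for x y
    by (subst gamma_twist_mult_pure) (simp_all add: f sweedler_comult_star lin star_star)
  have ext: "F = G \<longleftrightarrow> (\<forall>x y. F (y\<^sup>\<star> \<otimes> x\<^sup>\<star>) = G (y\<^sup>\<star> \<otimes> x\<^sup>\<star>))"
    if "clinear F" "clinear G" for F G :: "'h \<otimes> 'h \<Rightarrow> 'a"
    using clinear_tensor_ext[OF that] by (metis star_star ext)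
  have "(\<forall>x y. ?l x y = ?r x y) \<longleftrightarrow> ?L = ?R"
    unfolding l r by (rule ext[symmetric]) (simp_all add: lin f)
  also have "\<dots> \<longleftrightarrow> ?f = ?g"
    by (rule gamma_twist_chi_iff[OF f(1)])
  also have "\<dots> \<longleftrightarrow> (\<forall>x y. ?f (y\<^sup>\<star> \<otimes> x\<^sup>\<star>) = ?g (y\<^sup>\<star> \<otimes> x\<^sup>\<star>))"
    by (rule ext) (simp_all add: lin f)
  finally show ?thesis by (simp add: f g star_star)
qed

text \<open>Under (b) the star of gamma at \<open>u\<^sup>\<star>\<close> is chi(S u, u). The action
  of u turns this into delta(u), which gamma(u) cancels.\<close>

lemma gamma_star_unit:
  assumes chi: "\<And>x y. (\<chi> (x \<otimes> y))\<^sup>\<star> = convolution_inverse \<chi> (\<S> (x\<^sup>\<star>) \<otimes> \<S> (y\<^sup>\<star>))"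
  shows "sweedler (\<Delta> x) (\<lambda>x1 y. sweedler (\<Delta> y) (\<lambda>x2 x3. gamma (x2\<^sup>\<star>) * (x3\<^sup>\<star> \<rhd> (gamma x1)\<^sup>\<star>))) =
    \<epsilon> (x\<^sup>\<star>) *\<^sub>C 1"
proof -
  let ?f = "\<lambda>u. (gamma (u\<^sup>\<star>))\<^sup>\<star>"
  have "clinear ?f" by (rule clinear_star_star) (simp add: lin)
  \<comment> \<open>This is (b) read backwards: star and antipode are commuting involutions, so
    starring (b) at the transformed arguments exchanges chi and its inverse.\<close>
  have inv: "(convolution_inverse \<chi> (x \<otimes> y))\<^sup>\<star> = \<chi> (\<S> (x\<^sup>\<star>) \<otimes> \<S> (y\<^sup>\<star>))" for x y
    using chi[of "\<S> (x\<^sup>\<star>)" "\<S> (y\<^sup>\<star>)"] by (simp add: antipode_star star_star antipode_antipode)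
      (metis star_star)
  have "?f u = \<chi> (tensor_pair \<S> (\<lambda>x. x) u)" for u
  proof -
    have "gamma (u\<^sup>\<star>) = sweedler (\<Delta> u) (\<lambda>a b. convolution_inverse \<chi> (a\<^sup>\<star> \<otimes> \<S> (b\<^sup>\<star>)))"
      by (simp add: gamma_def clinear_tensor_pair_apply sweedler_comult_star lin)
    then show ?thesis
      by (simp add: star_sweedler inv antipode_star star_star antipode_antipode
          clinear_tensor_pair_apply lin)
  qed
  then have "act.twist (\<lambda>x. x) ?f = delta" by (simp add: twist_chi_antipode_left)
  then show ?thesis
    using gamma_twist_star[OF \<open>clinear ?f\<close>, of x]
    by (simp add: star_star convolution_gamma_delta unit_counit_def)
qed

section \<open>The conditions on the coaction and on psi\<close>

lemma clinear_rho_star: "clinear (\<lambda>u. tensor_star (\<rho> (u\<^sup>\<star>)))"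
  by (rule clinear_tensor_star[OF clinear_rho])

lemma one_tensor_mult: "(1 \<otimes> g) * t = sweedler t (\<lambda>h a. h \<otimes> (g * a :: 'a))"
  for t :: "'b::complex_algebra_1 \<otimes> 'a"
  by (rule clinear_tensor_ext[where f = "\<lambda>t. (1 \<otimes> g) * t"])
    (simp_all add: lin times_tensor_pure sweedler_tensor)

lemma convolution_one_tensor_gamma:
  fixes f :: "'h \<Rightarrow> 'b::complex_algebra_1 \<otimes> 'a"
  assumes "clinear f" "clinear g"
  shows "convolution (\<lambda>x. 1 \<otimes> gamma x) f = convolution (\<lambda>x. 1 \<otimes> gamma x) g \<longleftrightarrow> f = g"
proof (rule convolution_left_cancel[where f' = "\<lambda>x. 1 \<otimes> delta x"])
  show "convolution (\<lambda>x. 1 \<otimes> delta x) (\<lambda>x. 1 \<otimes> gamma x) = (unit_counit :: 'h \<Rightarrow> 'b \<otimes> 'a)"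
    using fun_cong[OF convolution_delta_gamma]
    by (simp add: fun_eq_iff convolution_def times_tensor_pure unit_counit_def tensor_scaleC_right
        one_tensor_def flip: sweedler_tensor_right)
qed (simp_all add: assms lin)

text \<open>Cancelling 1 \<otimes> gamma from (iv) leaves a formula for rho in terms of its starred
  form, which is the hypothesis shape of \<open>twist_coaction_eq\<close>.\<close>

lemma rho_star_iff:
  "(\<forall>x. sweedler (\<Delta> x) (\<lambda>x1 x2. sweedler (\<rho> (x2\<^sup>\<star>)) (\<lambda>h a. h \<otimes> (gamma (x1\<^sup>\<star>) * a))) =
      sweedler (\<Delta> x) (\<lambda>x1 y. sweedler (\<Delta> y) (\<lambda>x2 x3. sweedler (\<rho> x1) (\<lambda>x1H x1A.
        x1H\<^sup>\<star> \<otimes> (gamma (x2\<^sup>\<star>) * (x3\<^sup>\<star> \<rhd> x1A\<^sup>\<star>)))))) \<longleftrightarrow>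
    (\<forall>x. \<rho> x = sweedler (\<Delta> x) (\<lambda>x1 x2. sweedler (tensor_star (\<rho> (x1\<^sup>\<star>))) (\<lambda>h a. h \<otimes> (x2 \<rhd> a))))"
    (is "(\<forall>x. ?l x = ?r x) \<longleftrightarrow> (\<forall>x. \<rho> x = ?R x)")
proof -
  let ?c = "convolution (\<lambda>x. 1 \<otimes> gamma x) :: _ \<Rightarrow> 'h \<Rightarrow> 'h \<otimes> 'a"
  note [lin] = clinear_rho_star
  have l: "?l x = ?c \<rho> (x\<^sup>\<star>)" for x
    by (simp add: convolution_def one_tensor_mult sweedler_comult_star lin)
  have r: "?r x = ?c ?R (x\<^sup>\<star>)" for x
  proof -
    have "?r x = sweedler (\<Delta> x) (\<lambda>x1 y. sweedler (\<Delta> y) (\<lambda>x2 x3.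
        sweedler (tensor_star (\<rho> ((x1\<^sup>\<star>)\<^sup>\<star>))) (\<lambda>h a. h \<otimes> (gamma (x2\<^sup>\<star>) * (x3\<^sup>\<star> \<rhd> a)))))"
      by (simp add: sweedler_tensor_star lin star_star)
    also have "\<dots> = sweedler (\<Delta> (x\<^sup>\<star>)) (\<lambda>x1 y. sweedler (\<Delta> y) (\<lambda>x2 x3.
        sweedler (tensor_star (\<rho> (x1\<^sup>\<star>))) (\<lambda>h a. h \<otimes> (gamma x2 * (x3 \<rhd> a)))))"
      by (simp add: sweedler_comult_star lin)
    also have "\<dots> = sweedler (\<Delta> (x\<^sup>\<star>)) (\<lambda>x2 y. sweedler (\<Delta> y) (\<lambda>x1 x3.
        sweedler (tensor_star (\<rho> (x1\<^sup>\<star>))) (\<lambda>h a. h \<otimes> (gamma x2 * (x3 \<rhd> a)))))"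
      by (rule sweedler_left_commute) (simp_all add: lin)
    also have "\<dots> = ?c ?R (x\<^sup>\<star>)"
      by (simp add: convolution_def sweedler_mult_right times_tensor_pure)
    finally show ?thesis .
  qed
  have "(\<forall>x. ?l x = ?r x) \<longleftrightarrow> ?c \<rho> = ?c ?R"
    by (simp add: l r fun_eq_iff all_star[of "\<lambda>x. ?c \<rho> x = ?c ?R x"])
  also have "\<dots> \<longleftrightarrow> \<rho> = ?R"
    by (rule convolution_one_tensor_gamma) (simp_all add: lin)
  finally show ?thesis by (simp add: fun_eq_iff)
qed

text \<open>\<open>rho_antipode_twist\<close> rewrites the right side of (c) with
  \<open>\<S> (x2\<^sup>\<star>)\<close> acting on the A-part; by (a), the outer star turns this
  into x2 acting on the starred A-part.\<close>

lemma rho_star_twist_iff: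
  assumes act: "\<And>x a. (x \<rhd> a)\<^sup>\<star> = \<S> (x\<^sup>\<star>) \<rhd> a\<^sup>\<star>"
  shows "(\<forall>x. \<rho> (x\<^sup>\<star>) = sweedler (\<rho> (\<S> x)) (\<lambda>h a. (\<S> h)\<^sup>\<star> \<otimes> a\<^sup>\<star>)) \<longleftrightarrow>
    (\<forall>x. \<rho> x = sweedler (\<Delta> x) (\<lambda>x1 x2. sweedler (tensor_star (\<rho> (x1\<^sup>\<star>))) (\<lambda>h a. h \<otimes> (x2 \<rhd> a))))"
proof -
  have "sweedler (\<rho> (\<S> (u\<^sup>\<star>))) (\<lambda>h a. (\<S> h)\<^sup>\<star> \<otimes> a\<^sup>\<star>) =
      sweedler (\<Delta> u) (\<lambda>x1 x2. sweedler (tensor_star (\<rho> (x1\<^sup>\<star>))) (\<lambda>h a. h \<otimes> (x2 \<rhd> a)))" for u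
  proof -
    have "sweedler (\<rho> (\<S> (u\<^sup>\<star>))) (\<lambda>h a. (\<S> h)\<^sup>\<star> \<otimes> a\<^sup>\<star>) =
        tensor_star (sweedler (\<rho> (\<S> (u\<^sup>\<star>))) (\<lambda>h a. \<S> h \<otimes> a))"
      by (simp add: tensor_star_sweedler tensor_star_pure)
    also have "\<dots> = tensor_star (sweedler (\<Delta> u) (\<lambda>x1 x2. sweedler (\<rho> (x1\<^sup>\<star>))
        (\<lambda>h a. h \<otimes> (\<S> (x2\<^sup>\<star>) \<rhd> a))))"
      by (simp add: rho_antipode_twist sweedler_comult_star lin)
    also have "\<dots> = sweedler (\<Delta> u) (\<lambda>x1 x2. sweedler (\<rho> (x1\<^sup>\<star>)) (\<lambda>h a. h\<^sup>\<star> \<otimes> (x2 \<rhd> a\<^sup>\<star>)))"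
      by (simp add: tensor_star_sweedler tensor_star_pure act antipode_star star_star antipode_antipode)
    finally show ?thesis by (simp add: sweedler_tensor_star lin)
  qed
  then show ?thesis
    using all_star[of "\<lambda>x. \<rho> (x\<^sup>\<star>) = sweedler (\<rho> (\<S> x)) (\<lambda>h a. (\<S> h)\<^sup>\<star> \<otimes> a\<^sup>\<star>)"]
    by (simp add: star_star)
qed

text \<open>With D the starred psi and R the starred rho, \<open>twist_coaction_eq\<close> brings
  the right side of (v) into the form of \<open>comult_gamma_iff\<close>, whose unique solution D is
  (d).\<close>

lemma psi_star_iff:
  assumes rho: "\<And>x. \<rho> x =
    sweedler (\<Delta> x) (\<lambda>x1 x2. sweedler (tensor_star (\<rho> (x1\<^sup>\<star>))) (\<lambda>h a. h \<otimes> (x2 \<rhd> a)))"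
  shows "(\<forall>x. sweedler (\<Delta> x) (\<lambda>x1 x2. sweedler (\<Delta> (gamma (x1\<^sup>\<star>))) (\<lambda>g1 g2.
        sweedler (\<psi> (x2\<^sup>\<star>)) (\<lambda>a b. (g1 * a) \<otimes> (g2 * b)))) =
      sweedler (\<Delta> x) (\<lambda>x1 x. sweedler (\<Delta> x) (\<lambda>x2 x. sweedler (\<Delta> x) (\<lambda>x3 x. sweedler (\<Delta> x) (\<lambda>x4 x5.
        sweedler (\<psi> x1) (\<lambda>x1I x1II. sweedler (\<rho> x2) (\<lambda>x2H x2A. sweedler (\<rho> x3) (\<lambda>x3H x3A.
          (gamma (x2H\<^sup>\<star>) * (x3H\<^sup>\<star> \<rhd> x1I\<^sup>\<star>)) \<otimes>
          (gamma (x4\<^sup>\<star>) * (x5\<^sup>\<star> \<rhd> (x1II * x2A * x3A)\<^sup>\<star>)))))))))) \<longleftrightarrow>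
    (\<forall>x. \<psi> (x\<^sup>\<star>) = tensor_star (convolution_inverse \<psi> (\<S> x)))"
    (is "(\<forall>x. ?l x = ?r x) \<longleftrightarrow> _")
proof -
  define R where "R u = tensor_star (\<rho> (u\<^sup>\<star>))" for u
  define D where "D u = tensor_star (\<psi> (u\<^sup>\<star>))" for u
  have [lin]: "clinear R" "clinear D"
    unfolding R_def D_def by (simp_all add: clinear_tensor_star lin)
  have rho': "\<rho> x = sweedler (\<Delta> x) (\<lambda>x1 x2. sweedler (R x1) (\<lambda>h a. h \<otimes> (x2 \<rhd> a)))" for x
    unfolding R_def by (rule rho)
  let ?L = "convolution (\<lambda>x. \<Delta> (gamma x)) \<psi>"
  let ?R = "convolution (\<lambda>x. 1 \<otimes> gamma x) (convolution (rho_pull gamma) (theta.twist (\<lambda>x. x) D))"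
  have l: "?l x = ?L (x\<^sup>\<star>)" for x
    by (simp add: convolution_def sweedler_comult_star lin times_tensor_def)
  have r: "?r x = ?R (x\<^sup>\<star>)" for x
  proof -
    have "?R (x\<^sup>\<star>) = sweedler (\<Delta> x) (\<lambda>x1 x. sweedler (\<Delta> x) (\<lambda>x2 x. sweedler (\<Delta> x) (\<lambda>x3 x.
        sweedler (\<Delta> x) (\<lambda>x4 x5. sweedler (D (x1\<^sup>\<star>)) (\<lambda>b c. sweedler (R (x2\<^sup>\<star>)) (\<lambda>h a.
          sweedler (R (x3\<^sup>\<star>)) (\<lambda>h' a'.
            (gamma h * (h' \<rhd> b)) \<otimes> (gamma (x4\<^sup>\<star>) * (x5\<^sup>\<star> \<rhd> (c * a * a'))))))))))"
      unfolding twist_coaction_eq[OF \<open>clinear R\<close> \<open>clinear D\<close> rho', symmetric]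
      by (simp add: sweedler_comult_star lin)
    then show ?thesis
      by (simp add: R_def D_def sweedler_tensor_star lin star_star star_mult mult_ac)
  qed
  have "(\<forall>x. ?l x = ?r x) \<longleftrightarrow> ?L = ?R"
    by (simp add: l r fun_eq_iff all_star[of "\<lambda>x. ?L x = ?R x"])
  also have "\<dots> \<longleftrightarrow> D = (\<lambda>x. convolution_inverse \<psi> (\<S> x))"
    by (rule comult_gamma_iff) (simp add: lin)
  also have "\<dots> \<longleftrightarrow> (\<forall>x. \<psi> (x\<^sup>\<star>) = tensor_star (convolution_inverse \<psi> (\<S> x)))"
    by (auto simp: D_def fun_eq_iff) (metis tensor_star_tensor_star)+
  finally show ?thesis .
qed

end

theorem theorem6p10:
  fixes act :: "'h::{star_hopf_algebra, cocommutative_coalgebra} \<Rightarrow>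
      'a::{star_hopf_algebra, comm_ring_1} \<Rightarrow> 'a" (infixr "\<rhd>" 75)
    and \<rho> :: "'h \<Rightarrow> 'h \<otimes> 'a"
    and \<chi> :: "'h \<otimes> 'h \<Rightarrow> 'a"
    and \<psi> :: "'h \<Rightarrow> 'a \<otimes> 'a"
    and \<gamma> :: "'h \<Rightarrow> 'a"
  assumes "cocycle_singer_pair (\<rhd>) \<rho> \<chi> \<psi>"
    and "\<And>x. \<gamma> x = coprod2 x (\<lambda>x1 x2. convolution_inverse \<chi> (x2 \<otimes> inv \<S> x1))"
  shows
    "((\<forall>x a. (x \<rhd> a)\<^sup>\<star> = inv \<S> (x\<^sup>\<star>) \<rhd> a\<^sup>\<star>) \<and>
      (\<forall>x y. (\<chi> (x \<otimes> y))\<^sup>\<star> = convolution_inverse \<chi> (inv \<S> (x\<^sup>\<star>) \<otimes> inv \<S> (y\<^sup>\<star>))) \<and>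
      (\<forall>x. \<rho> (x\<^sup>\<star>) = sweedler (\<rho> (inv \<S> x)) (\<lambda>h a. (\<S> h)\<^sup>\<star> \<otimes> a\<^sup>\<star>)) \<and>
      (\<forall>x. \<psi> (x\<^sup>\<star>) = sweedler (convolution_inverse \<psi> (inv \<S> x)) (\<lambda>a b. a\<^sup>\<star> \<otimes> b\<^sup>\<star>)))
    \<longleftrightarrow>
     ((\<forall>x. coprod3 x (\<lambda>x1 x2 x3. \<gamma> (x2\<^sup>\<star>) * (x3\<^sup>\<star> \<rhd> (\<gamma> x1)\<^sup>\<star>)) = \<epsilon> (x\<^sup>\<star>) *\<^sub>C 1) \<and>
      (\<forall>x a. coprod3 x (\<lambda>x1 x2 x3. \<gamma> (x2\<^sup>\<star>) * (x3\<^sup>\<star> \<rhd> (x1 \<rhd> a)\<^sup>\<star>)) = a\<^sup>\<star> * \<gamma> (x\<^sup>\<star>)) \<and>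
      (\<forall>x y.
        coprod2 x (\<lambda>x1 x2. coprod3 y (\<lambda>y1 y2 y3.
          \<gamma> (y1\<^sup>\<star>) * (y2\<^sup>\<star> \<rhd> \<gamma> (x1\<^sup>\<star>)) * \<chi> (y3\<^sup>\<star> \<otimes> x2\<^sup>\<star>))) =
        coprod3 x (\<lambda>x1 x2 x3. coprod3 y (\<lambda>y1 y2 y3.
          \<gamma> (y2\<^sup>\<star> * x2\<^sup>\<star>) * ((y3\<^sup>\<star> * x3\<^sup>\<star>) \<rhd> (\<chi> (x1 \<otimes> y1))\<^sup>\<star>)))) \<and>
      (\<forall>x.
        coprod2 x (\<lambda>x1 x2. sweedler (\<rho> (x2\<^sup>\<star>)) (\<lambda>h a. h \<otimes> (\<gamma> (x1\<^sup>\<star>) * a))) =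
        coprod3 x (\<lambda>x1 x2 x3. sweedler (\<rho> x1) (\<lambda>x1H x1A.
          x1H\<^sup>\<star> \<otimes> (\<gamma> (x2\<^sup>\<star>) * (x3\<^sup>\<star> \<rhd> x1A\<^sup>\<star>))))) \<and>
      (\<forall>x.
        coprod2 x (\<lambda>x1 x2. coprod2 (\<gamma> (x1\<^sup>\<star>)) (\<lambda>g1 g2. sweedler (\<psi> (x2\<^sup>\<star>)) (\<lambda>a b.
          (g1 * a) \<otimes> (g2 * b)))) =
        coprod5 x (\<lambda>x1 x2 x3 x4 x5.
          sweedler (\<psi> x1) (\<lambda>x1I x1II. sweedler (\<rho> x2) (\<lambda>x2H x2A. sweedler (\<rho> x3) (\<lambda>x3H x3A.
            (\<gamma> (x2H\<^sup>\<star>) * (x3H\<^sup>\<star> \<rhd> x1I\<^sup>\<star>)) \<otimes>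
            (\<gamma> (x4\<^sup>\<star>) * (x5\<^sup>\<star> \<rhd> (x1II * x2A * x3A)\<^sup>\<star>))))))))"
  (is "?a \<and> ?b \<and> ?c \<and> ?d \<longleftrightarrow> ?i \<and> ?ii \<and> ?iii \<and> ?iv \<and> ?v")
proof -
  interpret cocycle_singer_pair "(\<rhd>)" \<rho> \<chi> \<psi> by fact
  interpret star_singer_pair "(\<rhd>)" \<rho> \<chi> \<psi> ..
  have \<gamma>: "\<gamma> = gamma"
    using assms(2) by (simp add: fun_eq_iff gamma_eq coprod2_def inv_antipode)
  note defs = coprod2_def coprod3_def coprod4_def coprod5_def inv_antipode \<gamma>
  have a: "?ii \<longleftrightarrow> ?a" unfolding defs by (rule act_star_iff)
  have b: "?iii \<longleftrightarrow> ?b" unfolding defs by (rule chi_star_iff)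
  have i: ?i if ?b
    using that unfolding defs by (intro allI gamma_star_unit) blast
  \<comment> \<open>The pivot of the argument: (iv) is equivalent to \<open>?R\<close>, under (a) so
    is (c), and \<open>?R\<close> is the form of the coaction from which (v) and (d) are
    compared.\<close>
  let ?R = "\<forall>x. \<rho> x =
    sweedler (\<Delta> x) (\<lambda>x1 x2. sweedler (tensor_star (\<rho> (x1\<^sup>\<star>))) (\<lambda>h a. h \<otimes> (x2 \<rhd> a)))"
  have iv: "?iv \<longleftrightarrow> ?R" unfolding defs by (rule rho_star_iff)
  have c: "?c \<longleftrightarrow> ?R" if ?a
    using that unfolding defs by (intro rho_star_twist_iff) blast
  have d: "?v \<longleftrightarrow> ?d" if ?R
    using that unfolding defs tensor_star_def[symmetric] by (intro psi_star_iff) blast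
  show ?thesis using a b i iv c d by blast
qed

end
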